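(* Let $0<\delta<1$ and let $\phi$ be either the hinge loss $\phi_h$ or a twice smooth classifying loss. Suppose $f_\rho^\phi\in Lip^{(r,c_0)}$ for some $r>0$, $c_0>0$ (for $\phi=\phi_h$: some pointwise minimizer $f_\rho^{\phi_h}$ lies in $Lip^{(r,c_0)}$). Let $\lambda=m^{-1}$ and $\sigma=m^{-1/(2r+d)}$. Then for every $0<\nu<\frac{r}{2r+d}$, with probability at least $1-\delta$ over the i.i.d. sample $D$ of size $m$, $$\mathcal R(\mathrm{sign}(f_{D,\sigma,\lambda}))-\mathcal R(f_c)\le C\,m^{-\frac{r}{2r+d}+\nu}\log\frac4\delta,$$ where $C>0$ is a constant independent of $m$ and $\delta$.
   Context: Setting: $X=[0,1]^d$, $Y=\{-1,1\}$, $\rho$ is an unknown Borel probability measure on $Z=X\times Y$ with marginal $\rho_X$ on $X$ and conditional distributions $\rho(\cdot|x)$; $\eta(x)=\mathbf P[y=1|x]$. The sample $D=\{(x_i,y_i)\}_{i=1}^m$ is drawn i.i.d. from $\rho$. For a classifier $\mathcal C:X\to Y$, $\mathcal R(\mathcal C)=\mathbf P[\mathcal C(x)\ne y]$; the Bayes rule is $f_c(x)=1$ if $\eta(x)\ge 1/2$ and $f_c(x)=-1$ otherwise. For a loss $\phi:\mathbf R\to\mathbf R_+$, $\mathcal E^\phi(f)=\int_Z\phi(yf(x))\,d\rho$ and $f_\rho^\phi(x)$ denotes a minimizer over $t\in\mathbf R$ of $\int_Y\phi(yt)\,d\rho(y|x)$. A classifying loss is a convex $\phi:\mathbf R\to\mathbf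 R_+$, differentiable at $0$ with $\phi'(0)<0$, whose smallest zero is $1$. A twice smooth classifying loss is a classifying loss that is differentiable with continuous derivative satisfying $|\phi'(u)-\phi'(v)|\le L^*|u-v|$ for all $u,v$ (some $L^*>0$), and whose modulus of convexity $\delta(\epsilon)=\inf\{\frac{\phi(u)+\phi(v)}2-\phi(\frac{u+v}2):|u-v|\ge\epsilon\}$ satisfies $\delta(\epsilon)\ge\mu\epsilon^2$ for some $\mu>0$. The hinge loss is $\phi_h(u)=\max\{1-u,0\}$. The Gaussian kernel is $G_\sigma(x,x')=\exp(-\|x-x'\|_2^2/\sigma^2)$, $\mathcal H_\sigma$ its RKHS with norm $\|\cdot\|_\sigma$, and $$f_{D,\sigma,\lambda}=\arg\min_{f\in\mathcal H_\sigma}\Big\{\frac1m\sum_{i=1}^m\phi(y_if(x_i))+\lambda\|f\|_\sigma^2\Big\}.$$ For $r=u+v$ with $u\in\{0,1,2,\dots\}$, $0<v\le1$, $Lip^{(r,c_0)}$ is the set of $f:X\to\mathbf R$ all of whose partial derivatives of total order $u$ exist and satisfy $|\partial^\alpha f(x)-\partial^\alpha f(x')|\le c_0\|x-x'\|_2^{v}$ for all $|\alpha|=u$, $x,x'\in X$. *)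

theory Defs
  imports "HOL-Probability.Probability"
begin

definition unit_cube :: "(real^'d) set" where
  "unit_cube = {x. \<forall>i. 0 \<le> x $ i \<and> x $ i \<le> 1}"

definition hinge_loss :: "real \<Rightarrow> real" where
  "hinge_loss u = max (1 - u) 0"

definition classifying_loss :: "(real \<Rightarrow> real) \<Rightarrow> bool" where
  "classifying_loss \<phi> \<longleftrightarrow>
     convex_on UNIV \<phi> \<and> (\<forall>u. 0 \<le> \<phi> u) \<and>
     \<phi> differentiable (at 0) \<and> deriv \<phi> 0 < 0 \<and>
     \<phi> 1 = 0 \<and> (\<forall>u<1. \<phi> u \<noteq> 0)"

definition modulus_of_convexity :: "(real \<Rightarrow> real) \<Rightarrow> real \<Rightarrow> real" where
  "modulus_of_convexity \<phi> \<epsilon> =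
     Inf {(\<phi> u + \<phi> v) / 2 - \<phi> ((u + v) / 2) | u v. \<bar>u - v\<bar> \<ge> \<epsilon>}"

definition twice_smooth_classifying_loss :: "(real \<Rightarrow> real) \<Rightarrow> bool" where
  "twice_smooth_classifying_loss \<phi> \<longleftrightarrow>
     classifying_loss \<phi> \<and>
     (\<exists>\<phi>'. (\<forall>u. (\<phi> has_real_derivative \<phi>' u) (at u)) \<and> continuous_on UNIV \<phi>' \<and>
        (\<exists>L>0. \<forall>u v. \<bar>\<phi>' u - \<phi>' v\<bar> \<le> L * \<bar>u - v\<bar>)) \<and>
     (\<exists>\<mu>>0. \<forall>\<epsilon>>0. modulus_of_convexity \<phi> \<epsilon> \<ge> \<mu> * \<epsilon>\<^sup>2)"

text \<open>Conditional phi-risk at a point x with eta = P[y=1|x]: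
  integral over Y of phi(y t) d rho(y|x).\<close>
definition cond_phi_risk :: "(real \<Rightarrow> real) \<Rightarrow> real \<Rightarrow> real \<Rightarrow> real" where
  "cond_phi_risk \<phi> e t = e * \<phi> t + (1 - e) * \<phi> (- t)"

text \<open>F ds is the iterated partial derivative of f along the coordinate directions in
  the list ds (the head is applied last); partial derivatives are taken within X.\<close>
definition lip_class :: "real \<Rightarrow> real \<Rightarrow> (real^'d \<Rightarrow> real) \<Rightarrow> bool" where
  "lip_class r c0 f \<longleftrightarrow>
     (let u = nat (\<lceil>r\<rceil> - 1); v = r - real u in
      \<exists>F :: 'd list \<Rightarrow> real^'d \<Rightarrow> real.
        (\<forall>x\<in>unit_cube. F [] x = f x) \<and>
        (\<forall>ds i. length ds < u \<longrightarrow> (\<forall>x\<in>unit_cube.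
           ((\<lambda>t. F ds (x + t *\<^sub>R axis i 1)) has_real_derivative F (i # ds) x)
             (at 0 within {t. x + t *\<^sub>R axis i 1 \<in> unit_cube}))) \<and>
        (\<forall>ds. length ds = u \<longrightarrow> (\<forall>x\<in>unit_cube. \<forall>x'\<in>unit_cube.
           \<bar>F ds x - F ds x'\<bar> \<le> c0 * norm (x - x') powr v)))"

section \<open>Gaussian kernel and its RKHS on X (Moore--Aronszajn completion)\<close>

definition gauss_kernel :: "real \<Rightarrow> real^'d \<Rightarrow> real^'d \<Rightarrow> real" where
  "gauss_kernel \<sigma> x x' = exp (- (norm (x - x'))\<^sup>2 / \<sigma>\<^sup>2)"

definition kcomb_eval :: "real \<Rightarrow> (real \<times> (real^'d)) list \<Rightarrow> real^'d \<Rightarrow> real" where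
  "kcomb_eval \<sigma> L x = (\<Sum>(a, t)\<leftarrow>L. a * gauss_kernel \<sigma> x t)"

definition kcomb_norm2 :: "real \<Rightarrow> (real \<times> (real^'d)) list \<Rightarrow> real" where
  "kcomb_norm2 \<sigma> L = (\<Sum>(a, t)\<leftarrow>L. \<Sum>(b, s)\<leftarrow>L. a * b * gauss_kernel \<sigma> t s)"

definition kcomb_diff :: "(real \<times> (real^'d)) list \<Rightarrow> (real \<times> (real^'d)) list \<Rightarrow> (real \<times> (real^'d)) list" where
  "kcomb_diff L M = L @ map (\<lambda>(b, s). (- b, s)) M"

definition rkhs_approx :: "real \<Rightarrow> (nat \<Rightarrow> (real \<times> (real^'d)) list) \<Rightarrow> (real^'d \<Rightarrow> real) \<Rightarrow> bool" where
  "rkhs_approx \<sigma> g f \<longleftrightarrow>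
     (\<forall>k. \<forall>(a, t)\<in>set (g k). t \<in> unit_cube) \<and>
     (\<forall>e>0. \<exists>N. \<forall>k\<ge>N. \<forall>l\<ge>N. kcomb_norm2 \<sigma> (kcomb_diff (g k) (g l)) < e) \<and>
     (\<forall>x\<in>unit_cube. (\<lambda>k. kcomb_eval \<sigma> (g k) x) \<longlonglongrightarrow> f x)"

text \<open>Functions on X are represented extensionally (value 0 outside X).\<close>
definition in_rkhs :: "real \<Rightarrow> (real^'d \<Rightarrow> real) \<Rightarrow> bool" where
  "in_rkhs \<sigma> f \<longleftrightarrow> (\<forall>x. x \<notin> unit_cube \<longrightarrow> f x = 0) \<and> (\<exists>g. rkhs_approx \<sigma> g f)"

text \<open>Squared RKHS norm ||f||_sigma^2 (the limit is independent of the approximating sequence).\<close>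
definition rkhs_norm2 :: "real \<Rightarrow> (real^'d \<Rightarrow> real) \<Rightarrow> real" where
  "rkhs_norm2 \<sigma> f = Inf {c. \<exists>g. rkhs_approx \<sigma> g f \<and> (\<lambda>k. kcomb_norm2 \<sigma> (g k)) \<longlonglongrightarrow> c}"

definition reg_objective ::
  "(real \<Rightarrow> real) \<Rightarrow> real \<Rightarrow> real \<Rightarrow> nat \<Rightarrow> (nat \<Rightarrow> (real^'d) \<times> real) \<Rightarrow> (real^'d \<Rightarrow> real) \<Rightarrow> real" where
  "reg_objective \<phi> \<sigma> lam m D f =
     (1 / real m) * (\<Sum>i<m. \<phi> (snd (D i) * f (fst (D i)))) + lam * rkhs_norm2 \<sigma> f"

definition is_reg_minimizer ::
  "(real \<Rightarrow> real) \<Rightarrow> real \<Rightarrow> real \<Rightarrow> nat \<Rightarrow> (nat \<Rightarrow> (real^'d) \<times> real) \<Rightarrow> (real^'d \<Rightarrow> real) \<Rightarrow> bool" where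
  "is_reg_minimizer \<phi> \<sigma> lam m D f \<longleftrightarrow>
     in_rkhs \<sigma> f \<and> (\<forall>g. in_rkhs \<sigma> g \<longrightarrow> reg_objective \<phi> \<sigma> lam m D f \<le> reg_objective \<phi> \<sigma> lam m D g)"

definition sign_clf :: "(real^'d \<Rightarrow> real) \<Rightarrow> real^'d \<Rightarrow> real" where
  "sign_clf f x = (if f x \<ge> 0 then 1 else -1)"

definition bayes_rule :: "(real^'d \<Rightarrow> real) \<Rightarrow> real^'d \<Rightarrow> real" where
  "bayes_rule \<eta> x = (if \<eta> x \<ge> 1/2 then 1 else -1)"

definition misclass_risk :: "((real^'d) \<times> real) measure \<Rightarrow> (real^'d \<Rightarrow> real) \<Rightarrow> real" where
  "misclass_risk \<rho> C = measure \<rho> {z. C (fst z) \<noteq> snd z}"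

end

theory Submission
  imports Defs "HOL-Computational_Algebra.Polynomial"
begin

text \<open>
  Expanding \<open>exp (2 (x - z) \<bullet> (t - z) / \<sigma>\<^sup>2)\<close> into a power series gives explicit features of the Gaussian
  kernel around any point \<open>z\<close>, and truncating the series at order \<open>n\<close> costs a factor
  \<open>(sqrt 2 * norm (x - z) / \<sigma>) ^ n\<close>. On cells of side \<open>\<sigma> m powr (- \<kappa>)\<close> a fixed order suffices,
  so the ball of radius of order \<open>sqrt m\<close> has a net of accuracy \<open>1 / m\<close> whose logarithmic size is
  \<open>\<sigma> powr (- d)\<close> up to an arbitrarily small power of \<open>m\<close>. This is what the loss \<open>\<nu>\<close> in the exponent pays for.

  For the approximation error, \<open>f\<rho>\<close> is extended beyond the cube by polynomial extrapolation along rays and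
  then averaged against an alternating sum of dilated Gaussians, which reproduces polynomials.
  The average is an inner product with the square-integrable features of the kernel, so it is uniformly close
  to a finite kernel combination of squared norm \<open>O(\<sigma> powr (- d))\<close>, with error \<open>O(\<sigma> powr r)\<close>.

  With \<open>p = 1\<close> for the hinge loss and \<open>p = 2\<close> for smooth losses, the excess loss of a function
  at sup-distance \<open>\<epsilon>\<close> from \<open>f\<rho>\<close> is \<open>O(\<epsilon> ^ p)\<close>, the \<open>p\<close>-th power of the excess misclassification risk is
  bounded by the excess loss, and for \<open>p = 2\<close> so is the variance. An exponential moment
  bound with parameter \<open>s\<close> of order \<open>m powr (- (2 - p) r / (2 r + d))\<close> and a union bound over the net then
  give the rate in both cases.
\<close>

section \<open>Kernel combinations and power series features\<close>

type_synonym 'd kcomb = "(real \<times> (real^'d)) list"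

definition kcomb_centers :: "'d kcomb \<Rightarrow> (real^'d) set" where
  "kcomb_centers L = snd ` set L"

definition kcomb_pair :: "(real^'d \<Rightarrow> real) \<Rightarrow> 'd kcomb \<Rightarrow> real" where
  "kcomb_pair F L = (\<Sum>(a, t)\<leftarrow>L. a * F t)"

definition kcomb_scale :: "real \<Rightarrow> 'd kcomb \<Rightarrow> 'd kcomb" where
  "kcomb_scale c L = map (\<lambda>(a, t). (c * a, t)) L"

lemma kcomb_pair_simps [simp]:
  "kcomb_pair F [] = 0"
  "kcomb_pair F (p # L) = fst p * F (snd p) + kcomb_pair F L"
  by (simp_all add: kcomb_pair_def case_prod_unfold)

lemma kcomb_pair_append: "kcomb_pair F (L @ M) = kcomb_pair F L + kcomb_pair F M"
  by (induction L) auto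

lemma kcomb_pair_scale: "kcomb_pair F (kcomb_scale c L) = c * kcomb_pair F L"
  by (induction L) (auto simp: kcomb_scale_def algebra_simps)

lemma kcomb_pair_diff: "kcomb_pair F (kcomb_diff L M) = kcomb_pair F L - kcomb_pair F M"
proof -
  have "kcomb_diff L M = L @ kcomb_scale (- 1) M"
    by (simp add: kcomb_diff_def kcomb_scale_def)
  then show ?thesis by (simp add: kcomb_pair_append kcomb_pair_scale)
qed

lemma kcomb_pair_add: "kcomb_pair (\<lambda>x. F x + G x) L = kcomb_pair F L + kcomb_pair G L"
  by (induction L) (auto simp: algebra_simps)

lemma kcomb_pair_mult: "kcomb_pair (\<lambda>x. c * F x) L = c * kcomb_pair F L"
  by (induction L) (auto simp: algebra_simps)

lemma kcomb_pair_sum: "kcomb_pair (\<lambda>x. \<Sum>i\<in>I. F i x) L = (\<Sum>i\<in>I. kcomb_pair (F i) L)"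
  by (induction L) (auto simp: sum.distrib sum_distrib_left)

lemma kcomb_pair_swap:
  "kcomb_pair (\<lambda>s. kcomb_pair (\<lambda>t. F s t) L) M = kcomb_pair (\<lambda>t. kcomb_pair (\<lambda>s. F s t) M) L"
  by (induction M) (simp_all add: kcomb_pair_add kcomb_pair_mult, induction L, simp_all)

lemma kcomb_pair_sums:
  assumes "\<And>t. (\<lambda>k. F k t) sums G t"
  shows "(\<lambda>k. kcomb_pair (F k) L) sums kcomb_pair G L"
  by (induction L) (auto intro!: sums_add sums_mult assms)

lemma borel_measurable_kcomb_pair:
  assumes "\<And>t. F t \<in> borel_measurable M"
  shows "(\<lambda>v. kcomb_pair (\<lambda>t. F t v) L) \<in> borel_measurable M"
  by (induction L) (auto intro!: borel_measurable_add borel_measurable_times assms)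

lemma has_bochner_integral_kcomb_pair:
  fixes F :: "real^'d \<Rightarrow> 'a \<Rightarrow> real"
  assumes "\<And>t. has_bochner_integral M (F t) (G t)"
  shows "has_bochner_integral M (\<lambda>v. kcomb_pair (\<lambda>t. F t v) L) (kcomb_pair G L)"
  by (induction L)
    (auto intro!: has_bochner_integral_zero has_bochner_integral_add has_bochner_integral_mult_right assms)

lemma gauss_kernel_commute: "gauss_kernel \<sigma> x t = gauss_kernel \<sigma> t x"
  by (simp add: gauss_kernel_def norm_minus_commute)

lemma gauss_kernel_self [simp]: "gauss_kernel \<sigma> x x = 1"
  by (simp add: gauss_kernel_def)

lemma borel_measurable_gauss_kernel: "gauss_kernel \<sigma> t \<in> borel_measurable borel"
  unfolding gauss_kernel_def by measurable

lemma kcomb_eval_eq_pair: "kcomb_eval \<sigma> L x = kcomb_pair (gauss_kernel \<sigma> x) L"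
  by (simp add: kcomb_eval_def kcomb_pair_def)

lemma borel_measurable_kcomb_eval [measurable]: "kcomb_eval \<sigma> L \<in> borel_measurable borel"
proof -
  have "kcomb_eval \<sigma> L = (\<lambda>x. kcomb_pair (\<lambda>t. gauss_kernel \<sigma> t x) L)"
    by (simp add: fun_eq_iff kcomb_eval_eq_pair gauss_kernel_commute)
  then show ?thesis
    using borel_measurable_kcomb_pair[OF borel_measurable_gauss_kernel] by simp
qed

definition kcomb_inner :: "real \<Rightarrow> 'd::finite kcomb \<Rightarrow> 'd kcomb \<Rightarrow> real" where
  "kcomb_inner \<sigma> L M = kcomb_pair (kcomb_eval \<sigma> M) L"

lemma kcomb_inner_commute: "kcomb_inner \<sigma> L M = kcomb_inner \<sigma> M L"
  unfolding kcomb_inner_def kcomb_eval_eq_pair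
  by (subst kcomb_pair_swap) (simp add: gauss_kernel_commute)

lemma kcomb_norm2_eq_inner: "kcomb_norm2 \<sigma> L = kcomb_inner \<sigma> L L"
proof -
  have "(\<Sum>(b, s)\<leftarrow>L. a * b * gauss_kernel \<sigma> t s) = a * kcomb_eval \<sigma> L t" for a t
    by (simp add: kcomb_eval_def sum_list_const_mult case_prod_unfold mult.assoc)
  then show ?thesis by (simp add: kcomb_norm2_def kcomb_inner_def kcomb_pair_def)
qed

lemma kcomb_norm2_scale: "kcomb_norm2 \<sigma> (kcomb_scale c L) = c\<^sup>2 * kcomb_norm2 \<sigma> L"
proof -
  have "kcomb_inner \<sigma> (kcomb_scale c L) M = c * kcomb_inner \<sigma> L M" for L M
    by (simp add: kcomb_inner_def kcomb_pair_scale)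
  then show ?thesis
    by (metis kcomb_norm2_eq_inner kcomb_inner_commute mult.assoc power2_eq_square)
qed

lemma kcomb_norm2_diff:
  "kcomb_norm2 \<sigma> (kcomb_diff L M) = kcomb_norm2 \<sigma> L - 2 * kcomb_inner \<sigma> L M + kcomb_norm2 \<sigma> M"
proof -
  have left: "kcomb_inner \<sigma> (kcomb_diff L M) K = kcomb_inner \<sigma> L K - kcomb_inner \<sigma> M K" for K
    by (simp add: kcomb_inner_def kcomb_pair_diff)
  then have right: "kcomb_inner \<sigma> K (kcomb_diff L M) = kcomb_inner \<sigma> K L - kcomb_inner \<sigma> K M" for K
    by (metis kcomb_inner_commute)
  show ?thesis
    unfolding kcomb_norm2_eq_inner left right by (simp add: kcomb_inner_commute[of \<sigma> M L])
qed

lemma kcomb_norm2_Cons: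
  "kcomb_norm2 \<sigma> ((s, x) # L) = s\<^sup>2 + 2 * s * kcomb_eval \<sigma> L x + kcomb_norm2 \<sigma> L"
proof -
  have left: "kcomb_inner \<sigma> ((s, x) # L) M = s * kcomb_eval \<sigma> M x + kcomb_inner \<sigma> L M" for M
    by (simp add: kcomb_inner_def)
  have "kcomb_inner \<sigma> L ((s, x) # L) = s * kcomb_eval \<sigma> L x + kcomb_inner \<sigma> L L"
    by (subst kcomb_inner_commute) (rule left)
  moreover have "kcomb_eval \<sigma> ((s, x) # L) x = s + kcomb_eval \<sigma> L x"
    by (simp add: kcomb_eval_eq_pair)
  ultimately show ?thesis
    unfolding kcomb_norm2_eq_inner left by (simp add: power2_eq_square algebra_simps)
qed

lemma finite_lists_length_less [simp]: "finite {l :: 'd::finite list. length l < k}"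
  by (rule finite_subset[OF _ finite_lists_length_le[of "UNIV :: 'd set" k]]) auto

lemma finite_lists_length [simp]: "finite {l :: 'd::finite list. length l = k}"
  using finite_lists_length_eq[of "UNIV :: 'd set" k] by simp

lemma finite_lists_length_in:
  assumes "finite K"
  shows "finite {l :: 'd::finite list. length l \<in> K}"
proof -
  have "{l :: 'd list. length l \<in> K} = (\<Union>k\<in>K. {l. length l = k})" by auto
  then show ?thesis using assms by simp
qed

lemma sum_lists_length_in:
  fixes g :: "'d::finite list \<Rightarrow> 'b::comm_monoid_add"
  assumes "finite K"
  shows "(\<Sum>l | length l \<in> K. g l) = (\<Sum>k\<in>K. \<Sum>l | length l = k. g l)"
proof -
  have "(\<Sum>k\<in>K. \<Sum>l | length l = k. g l)
      = (\<Sum>k\<in>K. sum g {l \<in> {l. length l \<in> K}. length l = k})"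
    by (intro sum.cong) (auto intro!: arg_cong[where f="sum g"])
  also have "\<dots> = (\<Sum>l | length l \<in> K. g l)"
    using assms by (intro sum.group finite_lists_length_in) auto
  finally show ?thesis ..
qed

lemma sum_lists_length_less:
  fixes g :: "'d::finite list \<Rightarrow> 'b::comm_monoid_add"
  shows "(\<Sum>l | length l < n. g l) = (\<Sum>k<n. \<Sum>l | length l = k. g l)"
  using sum_lists_length_in[of "{..<n}" g] by simp

lemma sum_lists_length_Suc:
  fixes g :: "'d::finite list \<Rightarrow> 'b::comm_monoid_add"
  shows "(\<Sum>l | length l = Suc k. g l) = (\<Sum>i\<in>UNIV. \<Sum>l | length l = k. g (i # l))"
proof -
  have "{l :: 'd list. length l = Suc k} = (\<lambda>(i, l). i # l) ` (UNIV \<times> {l. length l = k})"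
    by (force simp: length_Suc_conv image_iff)
  moreover have "inj_on (\<lambda>(i, l). i # l) (UNIV \<times> {l :: 'd list. length l = k})"
    by (auto simp: inj_on_def)
  ultimately have "(\<Sum>l | length l = Suc k. g l) = (\<Sum>(i, l)\<in>UNIV \<times> {l. length l = k}. g (i # l))"
    by (simp add: sum.reindex case_prod_unfold)
  then show ?thesis by (simp add: sum.cartesian_product)
qed

definition coord_prod :: "'d list \<Rightarrow> real^'d \<Rightarrow> real" where
  "coord_prod l h = (\<Prod>i\<leftarrow>l. h $ i)"

lemma coord_prod_simps [simp]:
  "coord_prod [] h = 1" "coord_prod (i # l) h = h $ i * coord_prod l h"
  by (simp_all add: coord_prod_def)

lemma borel_measurable_coord_prod [measurable]: "coord_prod l \<in> borel_measurable borel"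
  by (induction l) (simp_all add: coord_prod_def fun_eq_iff[symmetric])

lemma inner_power_eq_sum_coord_prod:
  fixes x t :: "real^'d"
  shows "(x \<bullet> t) ^ k = (\<Sum>l | length l = k. coord_prod l x * coord_prod l t)"
proof (induction k)
  case (Suc k)
  have "(x \<bullet> t) ^ Suc k = (\<Sum>i\<in>UNIV. x $ i * t $ i) * (\<Sum>l | length l = k. coord_prod l x * coord_prod l t)"
    unfolding power_Suc Suc by (simp add: inner_vec_def)
  then show ?case
    unfolding sum_lists_length_Suc by (simp add: sum_product mult_ac)
qed simp

definition gauss_feature :: "real \<Rightarrow> 'd list \<Rightarrow> real^'d \<Rightarrow> real" where
  "gauss_feature \<sigma> l h =
     exp (- (norm h)\<^sup>2 / \<sigma>\<^sup>2) * sqrt ((2 / \<sigma>\<^sup>2) ^ length l / fact (length l)) * coord_prod l h"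

lemma borel_measurable_gauss_feature [measurable]: "gauss_feature \<sigma> l \<in> borel_measurable borel"
  unfolding gauss_feature_def by measurable

lemma sum_gauss_feature_length:
  "(\<Sum>l | length l = k. gauss_feature \<sigma> l h * gauss_feature \<sigma> l h') =
     exp (- (norm h)\<^sup>2 / \<sigma>\<^sup>2) * exp (- (norm h')\<^sup>2 / \<sigma>\<^sup>2) * ((2 / \<sigma>\<^sup>2 * (h \<bullet> h')) ^ k / fact k)"
proof -
  define E where "E = exp (- (norm h)\<^sup>2 / \<sigma>\<^sup>2) * exp (- (norm h')\<^sup>2 / \<sigma>\<^sup>2)"
  define c where "c = (2 / \<sigma>\<^sup>2) ^ k / (fact k :: real)"
  have "c \<ge> 0" by (simp add: c_def)
  have "(\<Sum>l | length l = k. gauss_feature \<sigma> l h * gauss_feature \<sigma> l h')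
      = (\<Sum>l | length l = k. (E * (sqrt c * sqrt c)) * (coord_prod l h * coord_prod l h'))"
    by (intro sum.cong) (auto simp: gauss_feature_def E_def c_def mult_ac)
  also have "\<dots> = E * c * (h \<bullet> h') ^ k"
    using \<open>c \<ge> 0\<close> by (simp add: sum_distrib_left[symmetric] inner_power_eq_sum_coord_prod)
  finally show ?thesis by (simp add: E_def c_def power_mult_distrib power_divide)
qed

lemma gauss_kernel_eq_exp_inner:
  "gauss_kernel \<sigma> x t = exp (- (norm (x - z))\<^sup>2 / \<sigma>\<^sup>2) * exp (- (norm (t - z))\<^sup>2 / \<sigma>\<^sup>2)
     * exp (2 / \<sigma>\<^sup>2 * ((x - z) \<bullet> (t - z)))"
proof -
  define h h' where "h = x - z" and "h' = t - z"
  have "x - t = h - h'" by (simp add: h_def h'_def)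
  then have "(norm (x - t))\<^sup>2 = (norm h)\<^sup>2 + (norm h')\<^sup>2 - 2 * (h \<bullet> h')"
    by (simp add: power2_norm_eq_inner inner_diff inner_commute)
  then have "- (norm (x - t))\<^sup>2 / \<sigma>\<^sup>2 = - (norm h)\<^sup>2 / \<sigma>\<^sup>2 + - (norm h')\<^sup>2 / \<sigma>\<^sup>2 + 2 / \<sigma>\<^sup>2 * (h \<bullet> h')"
    by (simp add: diff_divide_distrib add_divide_distrib)
  then show ?thesis unfolding gauss_kernel_def h_def h'_def by (simp only: exp_add)
qed

lemma gauss_feature_sums:
  "(\<lambda>k. \<Sum>l | length l = k. gauss_feature \<sigma> l (x - z) * gauss_feature \<sigma> l (t - z)) sums gauss_kernel \<sigma> x t"
proof -
  have "(\<lambda>k. (2 / \<sigma>\<^sup>2 * ((x - z) \<bullet> (t - z))) ^ k / fact k) sums exp (2 / \<sigma>\<^sup>2 * ((x - z) \<bullet> (t - z)))"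
    using exp_converges[of "2 / \<sigma>\<^sup>2 * ((x - z) \<bullet> (t - z))"] by (simp add: divide_inverse mult.commute)
  then show ?thesis
    unfolding sum_gauss_feature_length gauss_kernel_eq_exp_inner[of \<sigma> x t z] by (rule sums_mult)
qed

definition kcomb_coeff :: "real \<Rightarrow> real^'d \<Rightarrow> 'd kcomb \<Rightarrow> 'd list \<Rightarrow> real" where
  "kcomb_coeff \<sigma> z L l = kcomb_pair (\<lambda>t. gauss_feature \<sigma> l (t - z)) L"

lemma kcomb_eval_sums:
  "(\<lambda>k. \<Sum>l | length l = k. kcomb_coeff \<sigma> z L l * gauss_feature \<sigma> l (x - z)) sums kcomb_eval \<sigma> L x"
proof -
  have "(\<lambda>k. kcomb_pair (\<lambda>t. \<Sum>l | length l = k. gauss_feature \<sigma> l (x - z) * gauss_feature \<sigma> l (t - z)) L)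
      sums kcomb_eval \<sigma> L x"
    unfolding kcomb_eval_eq_pair by (intro kcomb_pair_sums gauss_feature_sums)
  then show ?thesis
    by (simp add: kcomb_pair_sum kcomb_pair_mult kcomb_coeff_def mult.commute[of "kcomb_pair _ _"])
qed

lemma kcomb_inner_sums:
  "(\<lambda>k. \<Sum>l | length l = k. kcomb_coeff \<sigma> z L l * kcomb_coeff \<sigma> z M l) sums kcomb_inner \<sigma> L M"
proof -
  have "(\<lambda>k. kcomb_pair (\<lambda>t. \<Sum>l | length l = k. kcomb_coeff \<sigma> z M l * gauss_feature \<sigma> l (t - z)) L)
      sums kcomb_inner \<sigma> L M"
    unfolding kcomb_inner_def by (intro kcomb_pair_sums kcomb_eval_sums)
  moreover have "kcomb_pair (\<lambda>t. \<Sum>l | length l = k. kcomb_coeff \<sigma> z M l * gauss_feature \<sigma> l (t - z)) L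
      = (\<Sum>l | length l = k. kcomb_coeff \<sigma> z L l * kcomb_coeff \<sigma> z M l)" for k
    by (simp add: kcomb_pair_sum kcomb_pair_mult kcomb_coeff_def[of \<sigma> z L] mult.commute)
  ultimately show ?thesis by simp
qed

lemma kcomb_norm2_sums:
  "(\<lambda>k. \<Sum>l | length l = k. (kcomb_coeff \<sigma> z L l)\<^sup>2) sums kcomb_norm2 \<sigma> L"
  using kcomb_inner_sums[of \<sigma> z L L] by (simp add: kcomb_norm2_eq_inner power2_eq_square)

lemma kcomb_norm2_nonneg: "kcomb_norm2 \<sigma> L \<ge> 0"
  by (rule sums_le[OF _ sums_zero kcomb_norm2_sums[of \<sigma> 0 L]]) (simp add: sum_nonneg)

lemma sum_kcomb_coeff_square_le:
  fixes L :: "'d::finite kcomb"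
  assumes "finite \<Lambda>"
  shows "(\<Sum>l\<in>\<Lambda>. (kcomb_coeff \<sigma> z L l)\<^sup>2) \<le> kcomb_norm2 \<sigma> L"
proof -
  define K where "K = length ` \<Lambda>"
  have "finite K" using assms by (simp add: K_def)
  have "(\<Sum>l\<in>\<Lambda>. (kcomb_coeff \<sigma> z L l)\<^sup>2) \<le> (\<Sum>l | length l \<in> K. (kcomb_coeff \<sigma> z L l)\<^sup>2)"
    using finite_lists_length_in[OF \<open>finite K\<close>] by (intro sum_mono2) (auto simp: K_def)
  also have "\<dots> = (\<Sum>k\<in>K. \<Sum>l | length l = k. (kcomb_coeff \<sigma> z L l)\<^sup>2)"
    by (rule sum_lists_length_in[OF \<open>finite K\<close>])
  also have "\<dots> \<le> kcomb_norm2 \<sigma> L"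
    unfolding sums_unique[OF kcomb_norm2_sums[of \<sigma> z L]]
    by (rule sum_le_suminf) (auto simp: sum_nonneg \<open>finite K\<close> sums_summable[OF kcomb_norm2_sums])
  finally show ?thesis .
qed

lemma abs_kcomb_coeff_le: "\<bar>kcomb_coeff \<sigma> z L l\<bar> \<le> sqrt (kcomb_norm2 \<sigma> L)"
  using sum_kcomb_coeff_square_le[of "{l}" \<sigma> z L] by (simp add: real_le_rsqrt)

lemma kcomb_norm2_singleton: "kcomb_norm2 \<sigma> [(a, x)] = a\<^sup>2"
  using kcomb_norm2_Cons[of \<sigma> a x "[]"] by (simp add: kcomb_eval_eq_pair kcomb_norm2_def)

lemma abs_gauss_feature_le_1: "\<bar>gauss_feature \<sigma> l h\<bar> \<le> 1"
  using abs_kcomb_coeff_le[of \<sigma> 0 "[(1, h)]" l] by (simp add: kcomb_coeff_def kcomb_norm2_singleton)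

lemma kcomb_Cauchy_Schwarz: "\<bar>kcomb_inner \<sigma> L M\<bar> \<le> sqrt (kcomb_norm2 \<sigma> L) * sqrt (kcomb_norm2 \<sigma> M)"
proof -
  define s where "s n = (\<Sum>l | length l < n. kcomb_coeff \<sigma> 0 L l * kcomb_coeff \<sigma> 0 M l)" for n
  have "s \<longlonglongrightarrow> kcomb_inner \<sigma> L M"
    using kcomb_inner_sums[of \<sigma> 0 L M] by (simp add: s_def[abs_def] sums_def sum_lists_length_less)
  then have "(\<lambda>n. (s n)\<^sup>2) \<longlonglongrightarrow> (kcomb_inner \<sigma> L M)\<^sup>2" by (rule tendsto_power)
  moreover have "(s n)\<^sup>2 \<le> kcomb_norm2 \<sigma> L * kcomb_norm2 \<sigma> M" for n
  proof -
    have "(s n)\<^sup>2 \<le> (\<Sum>l | length l < n. (kcomb_coeff \<sigma> 0 L l)\<^sup>2)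
        * (\<Sum>l | length l < n. (kcomb_coeff \<sigma> 0 M l)\<^sup>2)"
      unfolding s_def by (rule Cauchy_Schwarz_ineq_sum)
    also have "\<dots> \<le> kcomb_norm2 \<sigma> L * kcomb_norm2 \<sigma> M"
      by (intro mult_mono sum_kcomb_coeff_square_le kcomb_norm2_nonneg sum_nonneg) auto
    finally show ?thesis .
  qed
  ultimately have "(kcomb_inner \<sigma> L M)\<^sup>2 \<le> kcomb_norm2 \<sigma> L * kcomb_norm2 \<sigma> M"
    by (meson LIMSEQ_le_const2)
  then show ?thesis by (simp add: real_sqrt_mult[symmetric] real_le_rsqrt)
qed

lemma abs_kcomb_eval_le: "\<bar>kcomb_eval \<sigma> L x\<bar> \<le> sqrt (kcomb_norm2 \<sigma> L)"
  using kcomb_Cauchy_Schwarz[of \<sigma> "[(1, x)]" L] by (simp add: kcomb_inner_def kcomb_norm2_singleton)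

lemma kcomb_norm_diff_le:
  "\<bar>sqrt (kcomb_norm2 \<sigma> L) - sqrt (kcomb_norm2 \<sigma> M)\<bar> \<le> sqrt (kcomb_norm2 \<sigma> (kcomb_diff L M))"
proof -
  have "(sqrt (kcomb_norm2 \<sigma> L) - sqrt (kcomb_norm2 \<sigma> M))\<^sup>2 \<le> kcomb_norm2 \<sigma> (kcomb_diff L M)"
    using kcomb_Cauchy_Schwarz[of \<sigma> L M]
    by (simp add: kcomb_norm2_diff power2_diff kcomb_norm2_nonneg)
  then show ?thesis by (simp add: real_le_rsqrt)
qed

lemma power_over_fact_le_exp:
  fixes y :: real
  assumes "y \<ge> 0" and "finite K"
  shows "(\<Sum>k\<in>K. y ^ k / fact k) \<le> exp y"
proof -
  have "(\<Sum>k\<in>K. y ^ k /\<^sub>R fact k) \<le> exp y"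
    unfolding exp_def using assms summable_exp_generic[of y]
    by (intro sum_le_suminf) (auto simp del: real_scaleR_def intro!: scaleR_nonneg_nonneg)
  then show ?thesis by (simp add: divide_inverse mult.commute)
qed

lemma exp_series_tail_le:
  fixes y :: real
  assumes "y \<ge> 0"
  shows "(\<Sum>k=n..<N. y ^ k / fact k) \<le> y ^ n * exp y"
proof -
  have "(\<Sum>k=n..<N. y ^ k / fact k) = (\<Sum>j<N - n. y ^ (n + j) / fact (n + j))"
    by (rule sum.reindex_bij_witness[where i="\<lambda>j. n + j" and j="\<lambda>k. k - n"]) auto
  also have "\<dots> \<le> (\<Sum>j<N - n. y ^ n * (y ^ j / fact j))"
  proof (rule sum_mono)
    fix j
    have "y ^ (n + j) / fact (n + j) \<le> y ^ (n + j) / fact j"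
      using assms by (intro divide_left_mono) (auto simp: fact_mono)
    then show "y ^ (n + j) / fact (n + j) \<le> y ^ n * (y ^ j / fact j)"
      by (simp add: power_add)
  qed
  also have "\<dots> \<le> y ^ n * exp y"
    unfolding sum_distrib_left[symmetric] using assms
    by (intro mult_left_mono power_over_fact_le_exp) auto
  finally show ?thesis .
qed

lemma sum_gauss_feature_square_tail_le:
  fixes h :: "real^'d"
  shows "(\<Sum>l | length l \<in> {n..<N}. (gauss_feature \<sigma> l h)\<^sup>2) \<le> (2 * (norm h)\<^sup>2 / \<sigma>\<^sup>2) ^ n"
proof -
  define y where "y = 2 * (norm h)\<^sup>2 / \<sigma>\<^sup>2"
  have "y \<ge> 0" by (simp add: y_def)
  have "(\<Sum>l | length l = k. (gauss_feature \<sigma> l h)\<^sup>2) = exp (- y) * (y ^ k / fact k)" for k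
    using sum_gauss_feature_length[of \<sigma> h h k]
    by (simp add: power2_eq_square[of "gauss_feature \<sigma> _ _"] y_def power2_norm_eq_inner exp_add[symmetric])
  then have "(\<Sum>l | length l \<in> {n..<N}. (gauss_feature \<sigma> l h)\<^sup>2) = exp (- y) * (\<Sum>k=n..<N. y ^ k / fact k)"
    by (simp add: sum_lists_length_in sum_distrib_left del: atLeastLessThan_iff)
  also have "\<dots> \<le> exp (- y) * (y ^ n * exp y)"
    by (intro mult_left_mono exp_series_tail_le \<open>y \<ge> 0\<close>) auto
  also have "\<dots> = y ^ n" by (simp add: exp_minus)
  finally show ?thesis by (simp add: y_def)
qed

lemma kcomb_eval_truncation_le:
  fixes x z :: "real^'d"
  assumes "\<sigma> > 0"
  shows "\<bar>kcomb_eval \<sigma> L x - (\<Sum>l | length l < n. kcomb_coeff \<sigma> z L l * gauss_feature \<sigma> l (x - z))\<bar>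
           \<le> sqrt (kcomb_norm2 \<sigma> L) * (sqrt 2 * norm (x - z) / \<sigma>) ^ n"
proof -
  define y where "y = 2 * (norm (x - z))\<^sup>2 / \<sigma>\<^sup>2"
  define summand where "summand l = kcomb_coeff \<sigma> z L l * gauss_feature \<sigma> l (x - z)" for l
  have tail_le: "\<bar>\<Sum>l | length l \<in> {n..<N}. summand l\<bar> \<le> sqrt (kcomb_norm2 \<sigma> L * y ^ n)" for N
  proof -
    let ?\<Lambda> = "{l :: 'd list. length l \<in> {n..<N}}"
    have "(\<Sum>l\<in>?\<Lambda>. summand l)\<^sup>2 \<le> (\<Sum>l\<in>?\<Lambda>. (kcomb_coeff \<sigma> z L l)\<^sup>2) * (\<Sum>l\<in>?\<Lambda>. (gauss_feature \<sigma> l (x - z))\<^sup>2)"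
      unfolding summand_def by (rule Cauchy_Schwarz_ineq_sum)
    also have "\<dots> \<le> kcomb_norm2 \<sigma> L * y ^ n"
      unfolding y_def
      by (intro mult_mono sum_kcomb_coeff_square_le sum_gauss_feature_square_tail_le sum_nonneg
          kcomb_norm2_nonneg finite_lists_length_in) auto
    finally show ?thesis by (simp add: real_le_rsqrt)
  qed
  have "(\<lambda>N. \<bar>(\<Sum>l | length l < N. summand l) - (\<Sum>l | length l < n. summand l)\<bar>)
      \<longlonglongrightarrow> \<bar>kcomb_eval \<sigma> L x - (\<Sum>l | length l < n. summand l)\<bar>"
    using kcomb_eval_sums[of \<sigma> z L x]
    by (intro tendsto_intros) (simp add: sums_def sum_lists_length_less summand_def)
  moreover have "\<bar>(\<Sum>l | length l < N. summand l) - (\<Sum>l | length l < n. summand l)\<bar>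
      \<le> sqrt (kcomb_norm2 \<sigma> L * y ^ n)" if "N \<ge> n" for N
  proof -
    have "(\<Sum>l | length l < N. summand l) - (\<Sum>l | length l < n. summand l)
        = (\<Sum>l | length l \<in> {n..<N}. summand l)"
      using sum_diff_nat_ivl[of 0 n N "\<lambda>k. \<Sum>l | length l = k. summand l"] that
      by (simp add: sum_lists_length_less sum_lists_length_in atLeast0LessThan del: atLeastLessThan_iff)
    then show ?thesis using tail_le by simp
  qed
  ultimately have "\<bar>kcomb_eval \<sigma> L x - (\<Sum>l | length l < n. summand l)\<bar> \<le> sqrt (kcomb_norm2 \<sigma> L * y ^ n)"
    using Lim_bounded by blast
  also have "\<dots> = sqrt (kcomb_norm2 \<sigma> L) * (sqrt 2 * norm (x - z) / \<sigma>) ^ n"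
    using assms by (simp add: real_sqrt_power y_def real_sqrt_divide real_sqrt_mult)
  finally show ?thesis by (simp add: summand_def)
qed

section \<open>The reproducing kernel Hilbert space\<close>

lemma rkhs_approx_Cauchy:
  assumes "rkhs_approx \<sigma> g f" and "e > 0"
  shows "\<exists>N. \<forall>k\<ge>N. \<forall>l\<ge>N. sqrt (kcomb_norm2 \<sigma> (kcomb_diff (g k) (g l))) < e"
proof -
  have "\<exists>N. \<forall>k\<ge>N. \<forall>l\<ge>N. kcomb_norm2 \<sigma> (kcomb_diff (g k) (g l)) < e\<^sup>2"
    using assms unfolding rkhs_approx_def by (meson zero_less_power)
  then show ?thesis using \<open>e > 0\<close> by (meson less_imp_le real_less_lsqrt)
qed

lemma rkhs_approx_uniformly:
  assumes "rkhs_approx \<sigma> g f" and "e > 0"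
  shows "\<exists>N. \<forall>k\<ge>N. \<forall>x\<in>unit_cube. \<bar>f x - kcomb_eval \<sigma> (g k) x\<bar> \<le> e"
proof -
  obtain N where N: "\<And>k l. k \<ge> N \<Longrightarrow> l \<ge> N \<Longrightarrow> sqrt (kcomb_norm2 \<sigma> (kcomb_diff (g k) (g l))) < e"
    using rkhs_approx_Cauchy[OF assms] by blast
  have "\<bar>f x - kcomb_eval \<sigma> (g k) x\<bar> \<le> e" if "k \<ge> N" "x \<in> unit_cube" for k x
  proof (rule LIMSEQ_le_const2)
    show "(\<lambda>l. \<bar>kcomb_eval \<sigma> (g l) x - kcomb_eval \<sigma> (g k) x\<bar>) \<longlonglongrightarrow> \<bar>f x - kcomb_eval \<sigma> (g k) x\<bar>"
      using assms(1) that unfolding rkhs_approx_def by (intro tendsto_intros) auto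
    have "\<bar>kcomb_eval \<sigma> (g l) x - kcomb_eval \<sigma> (g k) x\<bar> \<le> e" if "l \<ge> N" for l
      using abs_kcomb_eval_le[of \<sigma> "kcomb_diff (g l) (g k)" x] N[OF that \<open>k \<ge> N\<close>]
      by (simp add: kcomb_eval_eq_pair kcomb_pair_diff)
    then show "\<exists>N. \<forall>l\<ge>N. \<bar>kcomb_eval \<sigma> (g l) x - kcomb_eval \<sigma> (g k) x\<bar> \<le> e" by blast
  qed
  then show ?thesis by blast
qed

definition rkhs_norm2_limits :: "real \<Rightarrow> (real^'d \<Rightarrow> real) \<Rightarrow> real set" where
  "rkhs_norm2_limits \<sigma> f = {c. \<exists>g. rkhs_approx \<sigma> g f \<and> (\<lambda>k. kcomb_norm2 \<sigma> (g k)) \<longlonglongrightarrow> c}"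

lemma rkhs_norm2_eq_Inf: "rkhs_norm2 \<sigma> f = Inf (rkhs_norm2_limits \<sigma> f)"
  by (simp add: rkhs_norm2_def rkhs_norm2_limits_def)

lemma rkhs_norm2_limits_nonneg: "c \<in> rkhs_norm2_limits \<sigma> f \<Longrightarrow> c \<ge> 0"
  unfolding rkhs_norm2_limits_def by (auto intro!: LIMSEQ_le_const simp: kcomb_norm2_nonneg)

lemma rkhs_norm2_limits_nonempty:
  assumes "in_rkhs \<sigma> f"
  shows "rkhs_norm2_limits \<sigma> f \<noteq> {}"
proof -
  obtain g where g: "rkhs_approx \<sigma> g f" using assms unfolding in_rkhs_def by blast
  have "Cauchy (\<lambda>k. sqrt (kcomb_norm2 \<sigma> (g k)))"
  proof (rule CauchyI)
    fix e :: real assume "e > 0"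
    then obtain N where "\<And>k l. k \<ge> N \<Longrightarrow> l \<ge> N \<Longrightarrow> sqrt (kcomb_norm2 \<sigma> (kcomb_diff (g k) (g l))) < e"
      using rkhs_approx_Cauchy[OF g] by blast
    then have "norm (sqrt (kcomb_norm2 \<sigma> (g k)) - sqrt (kcomb_norm2 \<sigma> (g l))) < e"
      if "k \<ge> N" "l \<ge> N" for k l
      using that kcomb_norm_diff_le[of \<sigma> "g k" "g l"] by fastforce
    then show "\<exists>N. \<forall>k\<ge>N. \<forall>l\<ge>N. norm (sqrt (kcomb_norm2 \<sigma> (g k)) - sqrt (kcomb_norm2 \<sigma> (g l))) < e"
      by blast
  qed
  then obtain c where "(\<lambda>k. sqrt (kcomb_norm2 \<sigma> (g k))) \<longlonglongrightarrow> c"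
    by (metis Cauchy_convergent_iff convergent_def)
  then have "(\<lambda>k. (sqrt (kcomb_norm2 \<sigma> (g k)))\<^sup>2) \<longlonglongrightarrow> c\<^sup>2" by (rule tendsto_power)
  then show ?thesis using g by (auto simp: rkhs_norm2_limits_def kcomb_norm2_nonneg)
qed

lemma rkhs_norm2_nonneg: "in_rkhs \<sigma> f \<Longrightarrow> rkhs_norm2 \<sigma> f \<ge> 0"
  unfolding rkhs_norm2_eq_Inf
  by (intro cInf_greatest rkhs_norm2_limits_nonempty rkhs_norm2_limits_nonneg)

lemma rkhs_kcomb_uniform_approx:
  assumes f: "in_rkhs \<sigma> f" and "rkhs_norm2 \<sigma> f < B" and "e > 0"
  obtains L where "kcomb_centers L \<subseteq> unit_cube" "kcomb_norm2 \<sigma> L < B"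
    "\<forall>x\<in>unit_cube. \<bar>f x - kcomb_eval \<sigma> L x\<bar> \<le> e"
proof -
  obtain g c where g: "rkhs_approx \<sigma> g f" and lim: "(\<lambda>k. kcomb_norm2 \<sigma> (g k)) \<longlonglongrightarrow> c" and "c < B"
    using cInf_lessD[OF rkhs_norm2_limits_nonempty[OF f] assms(2)[unfolded rkhs_norm2_eq_Inf]]
    unfolding rkhs_norm2_limits_def by blast
  obtain N where N: "\<And>k. k \<ge> N \<Longrightarrow> \<forall>x\<in>unit_cube. \<bar>f x - kcomb_eval \<sigma> (g k) x\<bar> \<le> e"
    using rkhs_approx_uniformly[OF g \<open>e > 0\<close>] by blast
  obtain N' where N': "\<And>k. k \<ge> N' \<Longrightarrow> kcomb_norm2 \<sigma> (g k) < B"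
    using order_tendstoD(2)[OF lim \<open>c < B\<close>] unfolding eventually_sequentially by blast
  have "kcomb_centers (g (max N N')) \<subseteq> unit_cube"
    using g unfolding rkhs_approx_def kcomb_centers_def by fastforce
  then show ?thesis using that[of "g (max N N')"] N[of "max N N'"] N'[of "max N N'"] by simp
qed

definition rkhs_of_kcomb :: "real \<Rightarrow> 'd kcomb \<Rightarrow> real^'d \<Rightarrow> real" where
  "rkhs_of_kcomb \<sigma> L x = (if x \<in> unit_cube then kcomb_eval \<sigma> L x else 0)"

lemma rkhs_approx_of_kcomb:
  assumes "kcomb_centers L \<subseteq> unit_cube"
  shows "rkhs_approx \<sigma> (\<lambda>_. L) (rkhs_of_kcomb \<sigma> L)"
proof -
  have "kcomb_norm2 \<sigma> (kcomb_diff L L) = 0"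
    by (simp add: kcomb_norm2_diff) (simp add: kcomb_norm2_eq_inner)
  then show ?thesis
    using assms unfolding rkhs_approx_def by (auto simp: rkhs_of_kcomb_def kcomb_centers_def)
qed

lemma in_rkhs_of_kcomb: "kcomb_centers L \<subseteq> unit_cube \<Longrightarrow> in_rkhs \<sigma> (rkhs_of_kcomb \<sigma> L)"
  using rkhs_approx_of_kcomb unfolding in_rkhs_def by (auto simp: rkhs_of_kcomb_def)

lemma rkhs_norm2_of_kcomb_le:
  assumes "kcomb_centers L \<subseteq> unit_cube"
  shows "rkhs_norm2 \<sigma> (rkhs_of_kcomb \<sigma> L) \<le> kcomb_norm2 \<sigma> L"
  unfolding rkhs_norm2_eq_Inf
proof (rule cInf_lower)
  show "kcomb_norm2 \<sigma> L \<in> rkhs_norm2_limits \<sigma> (rkhs_of_kcomb \<sigma> L)"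
    using rkhs_approx_of_kcomb[OF assms] by (force simp: rkhs_norm2_limits_def)
qed (use rkhs_norm2_limits_nonneg in \<open>auto intro!: bdd_belowI\<close>)

lemma unit_cube_eq_cbox: "unit_cube = cbox 0 (1 :: real^'d)"
  by (auto simp: unit_cube_def mem_box_cart)

lemma unit_cube_borel [measurable]: "(unit_cube :: (real^'d) set) \<in> sets borel"
  by (simp add: unit_cube_eq_cbox)

lemma borel_measurable_rkhs:
  assumes "in_rkhs \<sigma> f"
  shows "f \<in> borel_measurable borel"
proof -
  obtain g where g: "rkhs_approx \<sigma> g f" and outside: "\<And>x. x \<notin> unit_cube \<Longrightarrow> f x = 0"
    using assms unfolding in_rkhs_def by blast
  show ?thesis
  proof (rule borel_measurable_LIMSEQ_real)
    show "(\<lambda>k. indicator unit_cube x * kcomb_eval \<sigma> (g k) x) \<longlonglongrightarrow> f x" for x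
      using g outside[of x] unfolding rkhs_approx_def by (cases "x \<in> unit_cube") auto
    show "(\<lambda>x. indicator unit_cube x * kcomb_eval \<sigma> (g k) x) \<in> borel_measurable borel" for k
      by measurable
  qed
qed

section \<open>A net for balls of the RKHS\<close>

definition clip :: "real \<Rightarrow> real" where
  "clip t = max (- 1) (min 1 t)"

lemma abs_clip_le_1 [simp]: "\<bar>clip t\<bar> \<le> 1"
  by (simp add: clip_def)

lemma abs_clip_diff_le: "\<bar>clip s - clip t\<bar> \<le> \<bar>s - t\<bar>"
  by (simp add: clip_def)

lemma clip_nonneg_iff: "clip t \<ge> 0 \<longleftrightarrow> t \<ge> 0"
  by (auto simp: clip_def)

lemma borel_measurable_clip [measurable]: "clip \<in> borel_measurable borel"
  unfolding clip_def by measurable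

definition clip_net :: "(real^'d \<Rightarrow> real) set \<Rightarrow> (real^'d \<Rightarrow> real) set \<Rightarrow> real \<Rightarrow> bool" where
  "clip_net N \<F> \<epsilon> \<longleftrightarrow> finite N \<and> (\<forall>q\<in>N. q \<in> borel_measurable borel \<and> (\<forall>x. \<bar>q x\<bar> \<le> 1)) \<and>
     (\<forall>f\<in>\<F>. \<exists>q\<in>N. \<forall>x\<in>unit_cube. \<bar>clip (f x) - q x\<bar> \<le> \<epsilon>)"

lemma clip_net_mono: "clip_net N \<F> \<epsilon> \<Longrightarrow> \<epsilon> \<le> \<epsilon>' \<Longrightarrow> clip_net N \<F> \<epsilon>'"
  unfolding clip_net_def by (meson order.trans)

definition rkhs_ball :: "real \<Rightarrow> real \<Rightarrow> (real^'d \<Rightarrow> real) set" where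
  "rkhs_ball \<sigma> R = {f. in_rkhs \<sigma> f \<and> rkhs_norm2 \<sigma> f < R\<^sup>2}"

definition multiples_upto :: "real \<Rightarrow> real \<Rightarrow> real set" where
  "multiples_upto e R = (\<lambda>j::int. of_int j * e) ` {- \<lceil>R / e\<rceil>..\<lceil>R / e\<rceil>}"

lemma finite_multiples_upto: "finite (multiples_upto e R)"
  by (simp add: multiples_upto_def)

lemma card_multiples_upto_le:
  assumes "e > 0" "R \<ge> 0"
  shows "real (card (multiples_upto e R)) \<le> 2 * R / e + 3"
proof -
  define J where "J = \<lceil>R / e\<rceil>"
  have J: "J \<ge> 0" "real_of_int J \<le> R / e + 1"
    using divide_nonneg_pos[OF \<open>R \<ge> 0\<close> \<open>e > 0\<close>] unfolding J_def by linarith+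
  have "card (multiples_upto e R) \<le> card {- J..J}"
    unfolding multiples_upto_def J_def by (rule card_image_le) simp
  also have "\<dots> = nat (2 * J + 1)" by simp
  finally have "real (card (multiples_upto e R)) \<le> 2 * real_of_int J + 1" using J by linarith
  then show ?thesis using J by simp
qed

lemma multiples_upto_floor:
  assumes "e > 0" "\<bar>t\<bar> \<le> R"
  shows "of_int \<lfloor>t / e\<rfloor> * e \<in> multiples_upto e R"
proof -
  have "t / e \<le> R / e" using assms by (intro divide_right_mono) auto
  moreover have "- R / e \<le> t / e" using assms by (intro divide_right_mono) auto
  ultimately have "\<lfloor>t / e\<rfloor> \<in> {- \<lceil>R / e\<rceil>..\<lceil>R / e\<rceil>}"
    unfolding atLeastAtMost_iff minus_divide_left[symmetric] by linarith
  then show ?thesis unfolding multiples_upto_def by blast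
qed

lemma abs_floor_multiple_diff_le:
  fixes e t :: real
  assumes "e > 0"
  shows "\<bar>t - of_int \<lfloor>t / e\<rfloor> * e\<bar> \<le> e"
proof -
  have "t - of_int \<lfloor>t / e\<rfloor> * e = frac (t / e) * e"
    using assms by (simp add: frac_def left_diff_distrib)
  then show ?thesis
    using assms frac_lt_1[of "t / e"] by (simp add: abs_mult mult_left_le_one_le)
qed

definition grid_floor :: "nat \<Rightarrow> real^'d \<Rightarrow> real^'d" where
  "grid_floor k x = (\<chi> i. of_int \<lfloor>real k * x $ i\<rfloor> / real k)"

definition grid :: "nat \<Rightarrow> (real^'d) set" where
  "grid k = {z. \<forall>i. z $ i \<in> (\<lambda>j. real j / real k) ` {..k}}"

lemma grid_eq_image: "grid k = (\<lambda>w. \<chi> i. w i) ` (UNIV \<rightarrow>\<^sub>E (\<lambda>j. real j / real k) ` {..k})"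
proof (intro set_eqI iffI)
  fix z :: "real^'d" assume "z \<in> grid k"
  then show "z \<in> (\<lambda>w. \<chi> i. w i) ` (UNIV \<rightarrow>\<^sub>E (\<lambda>j. real j / real k) ` {..k})"
    by (intro image_eqI[of _ _ "\<lambda>i. z $ i"]) (auto simp: grid_def vec_eq_iff)
qed (auto simp: grid_def PiE_iff)

lemma finite_grid: "finite (grid k)"
  unfolding grid_eq_image by (intro finite_imageI finite_PiE) auto

lemma card_grid_le: "card (grid k :: (real^'d) set) \<le> (k + 1) ^ CARD('d)"
proof -
  define S where "S = (\<lambda>j. real j / real k) ` {..k}"
  have "card S \<le> k + 1" unfolding S_def using card_image_le[of "{..k}"] by simp
  have "card (grid k :: (real^'d) set) \<le> card ((UNIV :: 'd set) \<rightarrow>\<^sub>E S)"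
    unfolding grid_eq_image S_def by (intro card_image_le finite_PiE) auto
  also have "\<dots> = card S ^ CARD('d)" by (simp add: card_funcsetE)
  also have "\<dots> \<le> (k + 1) ^ CARD('d)" using \<open>card S \<le> k + 1\<close> by (rule power_mono) simp
  finally show ?thesis .
qed

lemma grid_floor_in_grid:
  assumes "x \<in> unit_cube" "k > 0"
  shows "grid_floor k x \<in> grid k"
proof -
  have "of_int \<lfloor>real k * x $ i\<rfloor> / real k \<in> (\<lambda>j. real j / real k) ` {..k}" for i
  proof (intro image_eqI[of _ _ "nat \<lfloor>real k * x $ i\<rfloor>"])
    have x: "0 \<le> x $ i" "x $ i \<le> 1" using assms by (auto simp: unit_cube_def)
    then show "of_int \<lfloor>real k * x $ i\<rfloor> / real k = real (nat \<lfloor>real k * x $ i\<rfloor>) / real k" by simp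
    have "real k * x $ i \<le> real k" using x mult_left_mono[of "x $ i" 1 "real k"] by simp
    then show "nat \<lfloor>real k * x $ i\<rfloor> \<in> {..k}" unfolding atMost_iff by linarith
  qed
  then show ?thesis by (simp add: grid_def grid_floor_def)
qed

lemma norm_diff_grid_floor_le:
  fixes x :: "real^'d"
  assumes "k > 0"
  shows "norm (x - grid_floor k x) \<le> sqrt (real CARD('d)) / real k"
proof -
  have component: "\<bar>(x - grid_floor k x) $ i\<bar> \<le> 1 / real k" for i
    using abs_floor_multiple_diff_le[of "1 / real k" "x $ i"] assms
    by (simp add: grid_floor_def mult.commute)
  have "infnorm (x - grid_floor k x) \<le> 1 / real k"
    unfolding infnorm_cart by (rule cSup_least) (use component in auto)
  then have "sqrt (real CARD('d)) * infnorm (x - grid_floor k x) \<le> sqrt (real CARD('d)) * (1 / real k)"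
    by (rule mult_left_mono) simp
  then show ?thesis using norm_le_infnorm[of "x - grid_floor k x"] by simp
qed

lemma measurable_grid_floor:
  "grid_floor k \<in> borel \<rightarrow>\<^sub>M count_space (range (grid_floor k :: real^'d \<Rightarrow> real^'d))"
proof -
  have "range (grid_floor k) \<subseteq> range (\<lambda>v :: 'd \<Rightarrow> int. \<chi> i. of_int (v i) / real k)"
    by (auto simp: grid_floor_def)
  then have "countable (range (grid_floor k :: real^'d \<Rightarrow> real^'d))"
    by (rule countable_subset) simp
  moreover have "grid_floor k -` {z} \<inter> space borel \<in> sets borel" for z :: "real^'d"
  proof -
    have "grid_floor k -` {z} \<inter> space borel = (\<Inter>i. {x. of_int \<lfloor>real k * x $ i\<rfloor> / real k = z $ i})"
      by (auto simp: grid_floor_def vec_eq_iff)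
    then show ?thesis by simp
  qed
  ultimately show ?thesis by (simp add: measurable_count_space_eq_countable)
qed

lemma borel_measurable_grid_floor_compose [measurable]:
  "(\<lambda>x :: real^'d. w (grid_floor k x)) \<in> borel_measurable borel"
  by (rule measurable_compose[OF measurable_grid_floor]) (simp add: measurable_count_space_eq1)

definition local_expansion :: "real \<Rightarrow> nat \<Rightarrow> nat \<Rightarrow> ((real^'d) \<times> 'd list \<Rightarrow> real) \<Rightarrow> real^'d \<Rightarrow> real" where
  "local_expansion \<sigma> n k w x =
     (\<Sum>l | length l < n. w (grid_floor k x, l) * gauss_feature \<sigma> l (x - grid_floor k x))"

lemma borel_measurable_local_expansion:
  fixes w :: "(real^'d) \<times> 'd list \<Rightarrow> real"
  shows "local_expansion \<sigma> n k w \<in> borel_measurable borel"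
proof -
  have [measurable]: "(\<lambda>x :: real^'d. w (grid_floor k x, l)) \<in> borel_measurable borel" for l
    by (rule borel_measurable_grid_floor_compose)
  show ?thesis unfolding local_expansion_def by measurable
qed

lemma kcomb_eval_local_expansion_le:
  fixes L :: "'d::finite kcomb"
  assumes "\<sigma> > 0" "k > 0"
  shows "\<bar>kcomb_eval \<sigma> L x - local_expansion \<sigma> n k (\<lambda>(z, l). kcomb_coeff \<sigma> z L l) x\<bar>
    \<le> sqrt (kcomb_norm2 \<sigma> L) * (sqrt (2 * real CARD('d)) / (real k * \<sigma>)) ^ n"
proof -
  define z where "z = grid_floor k x"
  have "sqrt 2 * norm (x - z) / \<sigma> \<le> sqrt 2 * (sqrt (real CARD('d)) / real k) / \<sigma>"
    using norm_diff_grid_floor_le[OF \<open>k > 0\<close>, of x] \<open>\<sigma> > 0\<close>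
    by (intro divide_right_mono mult_left_mono) (auto simp: z_def)
  also have "\<dots> = sqrt (2 * real CARD('d)) / (real k * \<sigma>)" by (simp add: real_sqrt_mult)
  finally have "(sqrt 2 * norm (x - z) / \<sigma>) ^ n \<le> (sqrt (2 * real CARD('d)) / (real k * \<sigma>)) ^ n"
    using \<open>\<sigma> > 0\<close> by (intro power_mono) auto
  then have "sqrt (kcomb_norm2 \<sigma> L) * (sqrt 2 * norm (x - z) / \<sigma>) ^ n
      \<le> sqrt (kcomb_norm2 \<sigma> L) * (sqrt (2 * real CARD('d)) / (real k * \<sigma>)) ^ n"
    by (rule mult_left_mono) (simp add: kcomb_norm2_nonneg)
  then show ?thesis
    using kcomb_eval_truncation_le[OF \<open>\<sigma> > 0\<close>, of L x z n] by (simp add: local_expansion_def z_def)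
qed

lemma local_expansion_diff_le:
  fixes w w' :: "(real^'d) \<times> 'd list \<Rightarrow> real"
  assumes "\<And>l. length l < n \<Longrightarrow> \<bar>w (grid_floor k x, l) - w' (grid_floor k x, l)\<bar> \<le> e"
  shows "\<bar>local_expansion \<sigma> n k w x - local_expansion \<sigma> n k w' x\<bar>
    \<le> real (card {l :: 'd list. length l < n}) * e"
proof -
  define z where "z = grid_floor k x"
  have "\<bar>local_expansion \<sigma> n k w x - local_expansion \<sigma> n k w' x\<bar>
      = \<bar>\<Sum>l | length l < n. (w (z, l) - w' (z, l)) * gauss_feature \<sigma> l (x - z)\<bar>"
    by (simp add: local_expansion_def z_def sum_subtractf left_diff_distrib)
  also have "\<dots> \<le> (\<Sum>l | length l < n. \<bar>w (z, l) - w' (z, l)\<bar> * \<bar>gauss_feature \<sigma> l (x - z)\<bar>)"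
    unfolding abs_mult[symmetric] by (rule sum_abs)
  also have "\<dots> \<le> (\<Sum>l :: 'd list | length l < n. e * 1)"
  proof (intro sum_mono mult_mono)
    fix l :: "'d list" assume "l \<in> {l. length l < n}"
    then show "\<bar>w (z, l) - w' (z, l)\<bar> \<le> e" using assms by (simp add: z_def)
    then show "0 \<le> e" by linarith
  qed (auto simp: abs_gauss_feature_le_1)
  finally show ?thesis by simp
qed

text \<open>Near each grid point an element of the ball is replaced by the first terms of its feature expansion
  around that point, with rounded coefficients.\<close>

lemma rkhs_rounded_local_expansion:
  fixes f :: "real^'d \<Rightarrow> real" and n k :: nat
  assumes "f \<in> rkhs_ball \<sigma> R" "\<sigma> > 0" "R \<ge> 0" "e > 0" "k > 0"
  defines "S \<equiv> card {l :: 'd list. length l < n}"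
  obtains w where "w \<in> grid k \<times> {l. length l < n} \<rightarrow>\<^sub>E multiples_upto e R"
    "\<And>x. x \<in> unit_cube \<Longrightarrow> \<bar>f x - local_expansion \<sigma> n k w x\<bar>
       \<le> R * (sqrt (2 * real CARD('d)) / (real k * \<sigma>)) ^ n + (1 + real S) * e"
proof -
  have "in_rkhs \<sigma> f" "rkhs_norm2 \<sigma> f < R\<^sup>2" using assms(1) by (simp_all add: rkhs_ball_def)
  then obtain L where L: "kcomb_norm2 \<sigma> L < R\<^sup>2" "\<And>x. x \<in> unit_cube \<Longrightarrow> \<bar>f x - kcomb_eval \<sigma> L x\<bar> \<le> e"
    using rkhs_kcomb_uniform_approx[OF _ _ \<open>e > 0\<close>] by metis
  have norm_le: "sqrt (kcomb_norm2 \<sigma> L) \<le> R" using L(1) \<open>R \<ge> 0\<close> by (simp add: real_le_lsqrt)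
  define c where "c = (\<lambda>(z, l). kcomb_coeff \<sigma> z L l)"
  define w where "w = restrict (\<lambda>zl. of_int \<lfloor>c zl / e\<rfloor> * e) (grid k \<times> {l. length l < n})"
  have "\<bar>c zl\<bar> \<le> R" for zl
    unfolding c_def using abs_kcomb_coeff_le norm_le order.trans by (simp add: case_prod_unfold) blast
  then have "w \<in> grid k \<times> {l. length l < n} \<rightarrow>\<^sub>E multiples_upto e R"
    unfolding w_def restrict_PiE_iff using \<open>e > 0\<close> by (blast intro: multiples_upto_floor)
  moreover have "\<bar>f x - local_expansion \<sigma> n k w x\<bar>
      \<le> R * (sqrt (2 * real CARD('d)) / (real k * \<sigma>)) ^ n + (1 + real S) * e" if x: "x \<in> unit_cube" for x
  proof -
    have "\<bar>kcomb_eval \<sigma> L x - local_expansion \<sigma> n k c x\<bar>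
        \<le> sqrt (kcomb_norm2 \<sigma> L) * (sqrt (2 * real CARD('d)) / (real k * \<sigma>)) ^ n"
      unfolding c_def by (rule kcomb_eval_local_expansion_le[OF \<open>\<sigma> > 0\<close> \<open>k > 0\<close>])
    also have "\<dots> \<le> R * (sqrt (2 * real CARD('d)) / (real k * \<sigma>)) ^ n"
      using norm_le \<open>\<sigma> > 0\<close> by (intro mult_right_mono) auto
    finally have "\<bar>kcomb_eval \<sigma> L x - local_expansion \<sigma> n k c x\<bar>
        \<le> R * (sqrt (2 * real CARD('d)) / (real k * \<sigma>)) ^ n" .
    moreover have "\<bar>local_expansion \<sigma> n k c x - local_expansion \<sigma> n k w x\<bar> \<le> real S * e"
      unfolding S_def using grid_floor_in_grid[OF x \<open>k > 0\<close>] \<open>e > 0\<close>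
      by (intro local_expansion_diff_le) (simp add: w_def abs_floor_multiple_diff_le)
    ultimately show ?thesis using L(2)[OF x] by (simp add: distrib_right)
  qed
  ultimately show ?thesis by (rule that)
qed

lemma card_coefficient_tables_le:
  fixes e R :: real and n k :: nat
  assumes "e > 0" "R \<ge> 0"
  defines "S \<equiv> card {l :: 'd::finite list. length l < n}"
    and "cells \<equiv> (grid k :: (real^'d) set) \<times> {l :: 'd list. length l < n}"
  shows "finite (cells \<rightarrow>\<^sub>E multiples_upto e R)"
    and "real (card (cells \<rightarrow>\<^sub>E multiples_upto e R)) \<le> (2 * R / e + 3) ^ ((k + 1) ^ CARD('d) * S)"
proof -
  have "finite cells" by (simp add: cells_def finite_grid)
  then show "finite (cells \<rightarrow>\<^sub>E multiples_upto e R)" by (intro finite_PiE finite_multiples_upto)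
  have "card cells \<le> (k + 1) ^ CARD('d) * S"
    using card_grid_le[of k, where 'd='d] by (simp add: cells_def card_cartesian_product S_def)
  have "real (card (cells \<rightarrow>\<^sub>E multiples_upto e R)) = real (card (multiples_upto e R)) ^ card cells"
    by (simp add: card_funcsetE \<open>finite cells\<close>)
  also have "\<dots> \<le> (2 * R / e + 3) ^ card cells"
    using assms by (intro power_mono card_multiples_upto_le) auto
  also have "\<dots> \<le> (2 * R / e + 3) ^ ((k + 1) ^ CARD('d) * S)"
    using assms \<open>card cells \<le> _\<close> by (intro power_increasing) auto
  finally show "real (card (cells \<rightarrow>\<^sub>E multiples_upto e R)) \<le> (2 * R / e + 3) ^ ((k + 1) ^ CARD('d) * S)" .
qed

lemma rkhs_ball_net:
  fixes \<sigma> R e :: real and n k :: nat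
  defines "S \<equiv> card {l :: 'd::finite list. length l < n}"
  assumes "\<sigma> > 0" "R \<ge> 0" "e > 0" "k > 0"
  obtains N :: "(real^'d \<Rightarrow> real) set"
  where "clip_net N (rkhs_ball \<sigma> R) (R * (sqrt (2 * real CARD('d)) / (real k * \<sigma>)) ^ n + (1 + real S) * e)"
    and "real (card N) \<le> (2 * R / e + 3) ^ ((k + 1) ^ CARD('d) * S)"
proof -
  define W where "W = (grid k :: (real^'d) set) \<times> {l :: 'd list. length l < n} \<rightarrow>\<^sub>E multiples_upto e R"
  define q where "q w x = clip (local_expansion \<sigma> n k w x)" for w and x :: "real^'d"
  have "finite W" unfolding W_def by (rule card_coefficient_tables_le(1)[OF \<open>e > 0\<close> \<open>R \<ge> 0\<close>])
  then have "real (card (q ` W)) \<le> real (card W)" by (simp add: card_image_le)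
  also have "\<dots> \<le> (2 * R / e + 3) ^ ((k + 1) ^ CARD('d) * S)"
    unfolding W_def S_def by (rule card_coefficient_tables_le(2)[OF \<open>e > 0\<close> \<open>R \<ge> 0\<close>])
  finally have card: "real (card (q ` W)) \<le> (2 * R / e + 3) ^ ((k + 1) ^ CARD('d) * S)" .
  have approx: "\<exists>w\<in>W. \<forall>x\<in>unit_cube. \<bar>clip (f x) - q w x\<bar>
      \<le> R * (sqrt (2 * real CARD('d)) / (real k * \<sigma>)) ^ n + (1 + real S) * e"
    if "f \<in> rkhs_ball \<sigma> R" for f
    using rkhs_rounded_local_expansion[OF that assms(2-5), of n] order.trans[OF abs_clip_diff_le]
    unfolding q_def W_def S_def by metis
  have "q w \<in> borel_measurable borel" for w
    unfolding q_def using borel_measurable_local_expansion[measurable] by measurable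
  then have "clip_net (q ` W) (rkhs_ball \<sigma> R)
      (R * (sqrt (2 * real CARD('d)) / (real k * \<sigma>)) ^ n + (1 + real S) * e)"
    using \<open>finite W\<close> approx by (auto simp: clip_net_def q_def)
  then show ?thesis using card by (rule that)
qed

lemma truncation_error_rate:
  fixes a w x \<kappa> \<tau> :: real
  assumes "x \<ge> 1" "a \<ge> 0" "w \<ge> 0" "3 / 2 \<le> \<kappa> * real n" "x powr (\<kappa> + \<tau>) \<le> y"
  shows "a * sqrt x * (w / (y * x powr (- \<tau>))) ^ n \<le> a * w ^ n / x"
proof -
  have "x powr \<kappa> = x powr (\<kappa> + \<tau>) * x powr (- \<tau>)" by (simp add: powr_add[symmetric])
  also have "\<dots> \<le> y * x powr (- \<tau>)" using assms by (intro mult_right_mono) auto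
  finally have "w / (y * x powr (- \<tau>)) \<le> w / x powr \<kappa>"
    using assms by (intro divide_left_mono mult_pos_pos) (auto intro: less_le_trans[of _ "x powr (\<kappa> + \<tau>)"])
  moreover have "y \<ge> 0" using order.trans[OF powr_ge_zero assms(5)] .
  ultimately have "(w / (y * x powr (- \<tau>))) ^ n \<le> (w / x powr \<kappa>) ^ n"
    using assms by (intro power_mono divide_nonneg_nonneg mult_nonneg_nonneg) auto
  also have "\<dots> = w ^ n * x powr (- (\<kappa> * real n))"
    using \<open>x \<ge> 1\<close> by (simp add: power_divide powr_power powr_minus_divide mult.commute)
  also have "\<dots> \<le> w ^ n * x powr (- (3 / 2))"
    using assms by (intro mult_left_mono powr_mono) auto
  finally have "a * sqrt x * (w / (y * x powr (- \<tau>))) ^ n \<le> a * sqrt x * (w ^ n * x powr (- (3 / 2)))"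
    using assms by (intro mult_left_mono) auto
  also have "\<dots> = a * w ^ n * (x powr (1 / 2) * x powr (- (3 / 2)))"
    using assms by (simp add: powr_half_sqrt)
  also have "x powr (1 / 2) * x powr (- (3 / 2)) = 1 / x"
    unfolding powr_add[symmetric] using assms by (simp add: powr_minus_divide)
  finally show ?thesis by simp
qed

lemma net_cardinality_rate:
  fixes a x \<kappa> \<tau> :: real
  assumes "x \<ge> 1" "a \<ge> 0" "\<kappa> > 0" "real k + 1 \<le> 3 * x powr (\<kappa> + \<tau>)"
  shows "(2 * (a * sqrt x) / (1 / x) + 3) ^ ((k + 1) ^ n * S)
    \<le> exp (3 ^ n * real S * (ln (2 * a + 3) + 3 / (2 * \<kappa>)) * x powr ((\<kappa> + \<tau>) * real n + \<kappa>))"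
proof -
  define B where "B = 2 * a + 3"
  have "B \<ge> 3" using \<open>a \<ge> 0\<close> by (simp add: B_def)
  have "sqrt x * x = x powr (1 / 2) * x powr 1" using \<open>x \<ge> 1\<close> by (simp add: powr_half_sqrt)
  also have "\<dots> = x powr (3 / 2)" unfolding powr_add[symmetric] by simp
  finally have base: "2 * (a * sqrt x) / (1 / x) + 3 \<le> B * x powr (3 / 2)"
    using ge_one_powr_ge_zero[OF \<open>x \<ge> 1\<close>, of "3 / 2"] by (simp add: B_def distrib_right mult.assoc)
  have "ln (B * x powr (3 / 2)) = ln B + 3 / 2 * ln x"
    using \<open>B \<ge> 3\<close> \<open>x \<ge> 1\<close> by (simp add: ln_mult ln_powr)
  also have "\<dots> \<le> ln B * x powr \<kappa> + 3 / 2 * (x powr \<kappa> / \<kappa>)"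
    using ln_powr_bound[OF \<open>x \<ge> 1\<close> \<open>\<kappa> > 0\<close>] ge_one_powr_ge_zero[OF \<open>x \<ge> 1\<close>, of \<kappa>] \<open>\<kappa> > 0\<close> \<open>B \<ge> 3\<close>
      mult_left_mono[of 1 "x powr \<kappa>" "ln B"]
    by (intro add_mono mult_left_mono) auto
  finally have ln_le: "ln (B * x powr (3 / 2)) \<le> (ln B + 3 / (2 * \<kappa>)) * x powr \<kappa>"
    by (simp add: distrib_right)
  have "real ((k + 1) ^ n * S) = (real k + 1) ^ n * real S" by (simp add: add.commute)
  also have "\<dots> \<le> (3 * x powr (\<kappa> + \<tau>)) ^ n * real S"
    using assms by (intro mult_right_mono power_mono) auto
  also have "\<dots> = 3 ^ n * real S * x powr ((\<kappa> + \<tau>) * real n)"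
    using \<open>x \<ge> 1\<close> by (simp add: power_mult_distrib powr_power mult.commute)
  finally have exponent_le: "real ((k + 1) ^ n * S) \<le> 3 ^ n * real S * x powr ((\<kappa> + \<tau>) * real n)" .
  have "(2 * (a * sqrt x) / (1 / x) + 3) ^ ((k + 1) ^ n * S) \<le> (B * x powr (3 / 2)) ^ ((k + 1) ^ n * S)"
    using base assms by (intro power_mono) auto
  also have "\<dots> = exp (real ((k + 1) ^ n * S) * ln (B * x powr (3 / 2)))"
    using \<open>B \<ge> 3\<close> \<open>x \<ge> 1\<close> by (subst exp_of_nat_mult) simp
  also have "\<dots> \<le> exp ((3 ^ n * real S * x powr ((\<kappa> + \<tau>) * real n)) * ((ln B + 3 / (2 * \<kappa>)) * x powr \<kappa>))"
    using exponent_le ln_le \<open>B \<ge> 3\<close> ge_one_powr_ge_zero[OF \<open>x \<ge> 1\<close>, of "3 / 2"]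
      mult_mono[of 1 B 1 "x powr (3 / 2)"]
    unfolding exp_le_cancel_iff by (intro mult_mono) auto
  finally show ?thesis by (simp add: B_def powr_add mult_ac)
qed

lemma rkhs_ball_net_rate:
  fixes a \<nu> \<tau> :: real
  assumes "a \<ge> 0" "\<nu> > 0" "\<tau> \<ge> 0"
  shows "\<exists>c>0. \<exists>b>0. \<forall>x\<ge>1. \<exists>N :: (real^'d \<Rightarrow> real) set.
    clip_net N (rkhs_ball (x powr (- \<tau>)) (a * sqrt x)) (c / x) \<and>
    real (card N) \<le> exp (b * x powr (\<nu> + \<tau> * real CARD('d)))"
proof -
  define \<kappa> where "\<kappa> = \<nu> / (real CARD('d) + 1)"
  have "\<kappa> > 0" using \<open>\<nu> > 0\<close> by (simp add: \<kappa>_def add_nonneg_pos)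
  have exponent: "(\<kappa> + \<tau>) * real CARD('d) + \<kappa> = \<nu> + \<tau> * real CARD('d)"
    by (simp add: \<kappa>_def add_divide_distrib[symmetric] field_simps)
  define n where "n = nat \<lceil>3 / (2 * \<kappa>)\<rceil>"
  have "3 / (2 * \<kappa>) \<le> real n" unfolding n_def by linarith
  then have \<kappa>n: "3 / 2 \<le> \<kappa> * real n" using \<open>\<kappa> > 0\<close> by (simp add: field_simps)
  define S where "S = card {l :: 'd list. length l < n}"
  define w where "w = sqrt (2 * real CARD('d))"
  define c where "c = a * w ^ n + (1 + real S)"
  define b where "b = 3 ^ CARD('d) * real S * (ln (2 * a + 3) + 3 / (2 * \<kappa>)) + 1"
  have "c > 0" using \<open>a \<ge> 0\<close> by (simp add: c_def w_def add_nonneg_pos)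
  moreover have "b > 0" using \<open>a \<ge> 0\<close> \<open>\<kappa> > 0\<close> by (simp add: b_def add_nonneg_pos)
  moreover have "\<exists>N :: (real^'d \<Rightarrow> real) set. clip_net N (rkhs_ball (x powr (- \<tau>)) (a * sqrt x)) (c / x) \<and>
      real (card N) \<le> exp (b * x powr (\<nu> + \<tau> * real CARD('d)))" if "x \<ge> 1" for x
  proof -
    define k where "k = nat \<lceil>x powr (\<kappa> + \<tau>)\<rceil>"
    have "x powr (\<kappa> + \<tau>) \<ge> 1" using \<open>x \<ge> 1\<close> \<open>\<kappa> > 0\<close> \<open>\<tau> \<ge> 0\<close> by (intro ge_one_powr_ge_zero) auto
    then have k: "k > 0" "x powr (\<kappa> + \<tau>) \<le> real k" "real k + 1 \<le> 3 * x powr (\<kappa> + \<tau>)"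
      unfolding k_def by linarith+
    have "x powr (- \<tau>) > 0" "a * sqrt x \<ge> 0" "1 / x > 0" using \<open>x \<ge> 1\<close> \<open>a \<ge> 0\<close> by auto
    from rkhs_ball_net[OF this k(1), of n, where 'd='d] obtain N :: "(real^'d \<Rightarrow> real) set"
      where N: "clip_net N (rkhs_ball (x powr (- \<tau>)) (a * sqrt x))
          (a * sqrt x * (w / (real k * x powr (- \<tau>))) ^ n + (1 + real S) * (1 / x))"
        and card: "real (card N) \<le> (2 * (a * sqrt x) / (1 / x) + 3) ^ ((k + 1) ^ CARD('d) * S)"
      unfolding S_def w_def by blast
    have "a * sqrt x * (w / (real k * x powr (- \<tau>))) ^ n + (1 + real S) * (1 / x) \<le> c / x"
      using truncation_error_rate[OF \<open>x \<ge> 1\<close> \<open>a \<ge> 0\<close> _ \<kappa>n k(2), of w]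
      by (simp add: c_def w_def add_divide_distrib)
    with N have "clip_net N (rkhs_ball (x powr (- \<tau>)) (a * sqrt x)) (c / x)" by (rule clip_net_mono)
    moreover have "real (card N) \<le> exp (b * x powr (\<nu> + \<tau> * real CARD('d)))"
      using card net_cardinality_rate[OF \<open>x \<ge> 1\<close> \<open>a \<ge> 0\<close> \<open>\<kappa> > 0\<close> k(3), of "CARD('d)" S]
      unfolding exponent by (rule order.trans[OF order.trans]) (simp add: b_def distrib_right)
    ultimately show ?thesis by blast
  qed
  ultimately show ?thesis by blast
qed

section \<open>Approximation by Gaussian averages\<close>

text \<open>For a function given by an inner product with the features, the right-hand side below is a
  squared distance in feature space. The condition thus says that the function lies in the
  RKHS with squared norm at most \<open>B\<close>.\<close>

definition dual_norm2_le :: "real \<Rightarrow> (real^'d \<Rightarrow> real) \<Rightarrow> real \<Rightarrow> bool" where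
  "dual_norm2_le \<sigma> F B \<longleftrightarrow> (\<forall>L. 0 \<le> B - 2 * kcomb_pair F L + kcomb_norm2 \<sigma> L)"

lemma dual_norm2_le_mono: "dual_norm2_le \<sigma> F B \<Longrightarrow> B \<le> B' \<Longrightarrow> dual_norm2_le \<sigma> F B'"
  unfolding dual_norm2_le_def by (meson add_right_mono diff_right_mono order.trans)

lemma dual_norm2_le_scaled:
  assumes "dual_norm2_le \<sigma> F B" "s > 0"
  shows "2 * c * kcomb_pair F L \<le> s * c\<^sup>2 * B + kcomb_norm2 \<sigma> L / s"
proof (cases "c = 0")
  case False
  have "0 \<le> B - 2 * (1 / (s * c) * kcomb_pair F L) + (1 / (s * c))\<^sup>2 * kcomb_norm2 \<sigma> L"
    using assms(1)[unfolded dual_norm2_le_def, rule_format, of "kcomb_scale (1 / (s * c)) L"]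
    by (simp add: kcomb_pair_scale kcomb_norm2_scale)
  then have "0 \<le> s * c\<^sup>2 * (B - 2 * (1 / (s * c) * kcomb_pair F L) + (1 / (s * c))\<^sup>2 * kcomb_norm2 \<sigma> L)"
    using \<open>s > 0\<close> by simp
  also have "\<dots> = s * c\<^sup>2 * B - 2 * c * kcomb_pair F L + kcomb_norm2 \<sigma> L / s"
    using \<open>s > 0\<close> False by (simp add: field_simps power2_eq_square)
  finally show ?thesis by simp
qed (use assms kcomb_norm2_nonneg[of \<sigma> L] in simp)

lemma dual_norm2_le_mult:
  assumes "dual_norm2_le \<sigma> F B"
  shows "dual_norm2_le \<sigma> (\<lambda>x. c * F x) (c\<^sup>2 * B)"
  using dual_norm2_le_scaled[OF assms, of 1 c]
  by (simp add: dual_norm2_le_def kcomb_pair_mult algebra_simps)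

lemma dual_norm2_le_sum:
  assumes "finite I" "I \<noteq> {}" "\<And>i. i \<in> I \<Longrightarrow> dual_norm2_le \<sigma> (F i) (B i)"
  shows "dual_norm2_le \<sigma> (\<lambda>x. \<Sum>i\<in>I. c i * F i x) (\<Sum>i\<in>I. real (card I) * (c i)\<^sup>2 * B i)"
  unfolding dual_norm2_le_def
proof
  fix L
  have "real (card I) > 0" using assms by (simp add: card_gt_0_iff)
  have "2 * kcomb_pair (\<lambda>x. \<Sum>i\<in>I. c i * F i x) L = (\<Sum>i\<in>I. 2 * c i * kcomb_pair (F i) L)"
    by (simp add: kcomb_pair_sum kcomb_pair_mult sum_distrib_left mult.assoc)
  also have "\<dots> \<le> (\<Sum>i\<in>I. real (card I) * (c i)\<^sup>2 * B i + kcomb_norm2 \<sigma> L / real (card I))"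
    by (intro sum_mono dual_norm2_le_scaled assms \<open>real (card I) > 0\<close>)
  also have "\<dots> = (\<Sum>i\<in>I. real (card I) * (c i)\<^sup>2 * B i) + kcomb_norm2 \<sigma> L"
    using \<open>real (card I) > 0\<close> by (simp add: sum.distrib)
  finally show "0 \<le> (\<Sum>i\<in>I. real (card I) * (c i)\<^sup>2 * B i)
      - 2 * kcomb_pair (\<lambda>x. \<Sum>i\<in>I. c i * F i x) L + kcomb_norm2 \<sigma> L" by simp
qed

text \<open>A combination that almost minimises the distance to \<open>F\<close> is almost orthogonal to the kernel
  sections, hence close to \<open>F\<close> uniformly.\<close>

lemma dual_norm2_le_kcomb_approx:
  assumes F: "dual_norm2_le \<sigma> F B" and "e > 0"
  obtains L where "kcomb_centers L \<subseteq> X" "kcomb_norm2 \<sigma> L \<le> 4 * B + 2 * e\<^sup>2"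
    "\<forall>x\<in>X. \<bar>kcomb_eval \<sigma> L x - F x\<bar> \<le> e"
proof -
  define dist2 where "dist2 L = B - 2 * kcomb_pair F L + kcomb_norm2 \<sigma> L" for L
  define \<L> where "\<L> = {L. kcomb_centers L \<subseteq> X}"
  have "dist2 L \<ge> 0" for L using F by (simp add: dual_norm2_le_def dist2_def)
  then have bdd: "bdd_below (dist2 ` \<L>)" by (intro bdd_belowI[of _ 0]) auto
  have "[] \<in> \<L>" by (simp add: \<L>_def kcomb_centers_def)
  then obtain L where L: "L \<in> \<L>" "dist2 L < Inf (dist2 ` \<L>) + e\<^sup>2"
    using cInf_lessD[of "dist2 ` \<L>" "Inf (dist2 ` \<L>) + e\<^sup>2"] \<open>e > 0\<close> by auto
  have "Inf (dist2 ` \<L>) \<le> dist2 []" using \<open>[] \<in> \<L>\<close> bdd by (intro cInf_lower) auto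
  then have "dist2 L \<le> B + e\<^sup>2" using L by (simp add: dist2_def kcomb_norm2_def)
  moreover have "2 * 1 * kcomb_pair F L \<le> 2 * 1\<^sup>2 * B + kcomb_norm2 \<sigma> L / 2"
    by (rule dual_norm2_le_scaled[OF F]) simp
  ultimately have "kcomb_norm2 \<sigma> L \<le> 4 * B + 2 * e\<^sup>2" by (simp add: dist2_def)
  moreover have "\<bar>kcomb_eval \<sigma> L x - F x\<bar> \<le> e" if "x \<in> X" for x
  proof -
    define s where "s = F x - kcomb_eval \<sigma> L x"
    have "(s, x) # L \<in> \<L>" using L \<open>x \<in> X\<close> by (auto simp: \<L>_def kcomb_centers_def)
    then have "Inf (dist2 ` \<L>) \<le> dist2 ((s, x) # L)" using bdd by (intro cInf_lower) auto
    also have "dist2 ((s, x) # L) = dist2 L - s\<^sup>2"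
      by (simp add: dist2_def kcomb_norm2_Cons s_def power2_eq_square algebra_simps)
    finally have "s\<^sup>2 \<le> e\<^sup>2" using L by simp
    then have "\<bar>s\<bar> \<le> e" using \<open>e > 0\<close> by (simp add: abs_le_square_iff[symmetric])
    then show ?thesis by (simp add: s_def abs_minus_commute)
  qed
  ultimately show ?thesis using that L by (auto simp: \<L>_def)
qed

lemma nn_integral_gauss_real:
  fixes \<mu> :: real
  assumes "c > 0"
  shows "(\<integral>\<^sup>+y. ennreal (exp (- c * (y - \<mu>)\<^sup>2)) \<partial>lborel) = ennreal (sqrt (pi / c))"
proof -
  define s where "s = 1 / sqrt (2 * c)"
  have s: "s > 0" "2 * s\<^sup>2 = 1 / c" using assms by (auto simp: s_def power_divide)
  have density: "exp (- c * (y - \<mu>)\<^sup>2) = sqrt (pi / c) * normal_density \<mu> s y" for y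
  proof -
    have "2 * pi * s\<^sup>2 = pi / c" "- (y - \<mu>)\<^sup>2 / (2 * s\<^sup>2) = - c * (y - \<mu>)\<^sup>2"
      using s(2) by (simp_all add: mult.assoc mult.left_commute[of 2 pi])
    then show ?thesis using assms by (simp add: normal_density_def)
  qed
  have "(\<integral>\<^sup>+y. ennreal (normal_density \<mu> s y) \<partial>lborel) = 1"
    using prob_space.emeasure_space_1[OF prob_space_normal_density[OF s(1), of \<mu>]]
    by (simp add: emeasure_density)
  then show ?thesis
    unfolding density using assms s by (simp add: ennreal_mult nn_integral_cmult)
qed

lemma nn_integral_gauss:
  fixes x :: "real^'d"
  assumes "c > 0"
  shows "(\<integral>\<^sup>+v. ennreal (exp (- c * (norm (v - x))\<^sup>2)) \<partial>lborel) = ennreal (sqrt (pi / c) ^ CARD('d))"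
proof -
  have "exp (- c * (norm (v - x))\<^sup>2) = (\<Prod>b\<in>Basis. exp (- c * (v \<bullet> b - x \<bullet> b)\<^sup>2))" for v
  proof -
    have "(norm (v - x))\<^sup>2 = (\<Sum>b\<in>Basis. (v \<bullet> b - x \<bullet> b)\<^sup>2)"
      unfolding power2_norm_eq_inner euclidean_inner[of "v - x" "v - x"]
      by (simp add: power2_eq_square inner_diff_left)
    then show ?thesis by (simp add: exp_sum[symmetric] sum_negf sum_distrib_left)
  qed
  then have "(\<integral>\<^sup>+v. ennreal (exp (- c * (norm (v - x))\<^sup>2)) \<partial>lborel)
      = (\<integral>\<^sup>+v. (\<Prod>b\<in>Basis. ennreal (exp (- c * (v \<bullet> b - x \<bullet> b)\<^sup>2))) \<partial>lborel)"
    by (simp add: prod_ennreal)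
  also have "\<dots> = (\<Prod>b\<in>(Basis :: (real^'d) set). (\<integral>\<^sup>+y. ennreal (exp (- c * (y - x \<bullet> b)\<^sup>2)) \<partial>lborel))"
    by (intro nn_integral_lborel_prod) auto
  also have "\<dots> = ennreal (sqrt (pi / c)) ^ CARD('d)" unfolding nn_integral_gauss_real[OF assms] by simp
  finally show ?thesis using assms by (simp add: ennreal_power)
qed

lemma has_integral_gauss:
  fixes x :: "real^'d"
  assumes "c > 0"
  shows "has_bochner_integral lborel (\<lambda>v. exp (- c * (norm (v - x))\<^sup>2)) (sqrt (pi / c) ^ CARD('d))"
  using assms by (intro has_bochner_integral_nn_integral nn_integral_gauss) auto

lemma complete_square_norm:
  fixes x u v :: "'a::real_inner"
  assumes "a + b \<noteq> 0"
  defines "p \<equiv> (1 / (a + b)) *\<^sub>R (a *\<^sub>R x + b *\<^sub>R u)"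
  shows "a * (norm (v - x))\<^sup>2 + b * (norm (v - u))\<^sup>2
    = (a + b) * (norm (v - p))\<^sup>2 + (a * b / (a + b)) * (norm (x - u))\<^sup>2"
proof -
  have p: "(a + b) *\<^sub>R p = a *\<^sub>R x + b *\<^sub>R u" using assms by (simp add: p_def)
  then have vp: "(a + b) * (v \<bullet> p) = a * (v \<bullet> x) + b * (v \<bullet> u)"
    by (metis inner_add_right inner_scaleR_right)
  have "(a + b) * ((a + b) * (p \<bullet> p)) = ((a + b) *\<^sub>R p) \<bullet> ((a + b) *\<^sub>R p)" by simp
  then have pp: "(a + b) * ((a + b) * (p \<bullet> p)) = a * a * (x \<bullet> x) + 2 * a * b * (x \<bullet> u) + b * b * (u \<bullet> u)"
    unfolding p by (simp add: inner_add inner_commute algebra_simps)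
  have "(a + b) * ((a + b) * (norm (v - p))\<^sup>2) + a * b * (norm (x - u))\<^sup>2
      = (a + b) * ((a + b) * (v \<bullet> v)) - 2 * (a + b) * ((a + b) * (v \<bullet> p)) + (a + b) * ((a + b) * (p \<bullet> p))
        + a * b * (x \<bullet> x - 2 * (x \<bullet> u) + u \<bullet> u)"
    unfolding power2_norm_eq_inner by (simp add: inner_diff inner_commute algebra_simps)
  also have "\<dots> = (a + b) * (a * (norm (v - x))\<^sup>2 + b * (norm (v - u))\<^sup>2)"
    unfolding vp pp power2_norm_eq_inner by (simp add: inner_diff inner_commute algebra_simps)
  finally have "a * (norm (v - x))\<^sup>2 + b * (norm (v - u))\<^sup>2
      = ((a + b) * ((a + b) * (norm (v - p))\<^sup>2) + a * b * (norm (x - u))\<^sup>2) / (a + b)"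
    using assms by (simp add: nonzero_eq_divide_eq mult.commute)
  then show ?thesis using assms by (simp add: add_divide_distrib)
qed

lemma has_integral_gauss_mult_gauss:
  fixes x u :: "real^'d"
  assumes "a > 0" "b > 0"
  shows "has_bochner_integral lborel (\<lambda>v. exp (- a * (norm (v - x))\<^sup>2) * exp (- b * (norm (v - u))\<^sup>2))
    (sqrt (pi / (a + b)) ^ CARD('d) * exp (- (a * b / (a + b)) * (norm (x - u))\<^sup>2))"
proof -
  define p where "p = (1 / (a + b)) *\<^sub>R (a *\<^sub>R x + b *\<^sub>R u)"
  have "- a * (norm (v - x))\<^sup>2 + - b * (norm (v - u))\<^sup>2
      = - (a + b) * (norm (v - p))\<^sup>2 + - (a * b / (a + b)) * (norm (x - u))\<^sup>2" for v
    using complete_square_norm[of a b v x u] assms unfolding p_def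
    by (metis (no_types) add_pos_pos less_irrefl minus_add_distrib mult_minus_left)
  then have "exp (- a * (norm (v - x))\<^sup>2) * exp (- b * (norm (v - u))\<^sup>2)
      = exp (- (a + b) * (norm (v - p))\<^sup>2) * exp (- (a * b / (a + b)) * (norm (x - u))\<^sup>2)" for v
    unfolding exp_add[symmetric] by (simp only:)
  then show ?thesis
    using has_bochner_integral_mult_left[OF has_integral_gauss[of "a + b" p]] assms by simp
qed

lemma gauss_kernel_has_integral:
  fixes s t :: "real^'d"
  assumes "\<sigma> > 0"
  defines "a \<equiv> 2 / \<sigma>\<^sup>2"
  shows "has_bochner_integral lborel (\<lambda>v. exp (- a * (norm (v - s))\<^sup>2) * exp (- a * (norm (v - t))\<^sup>2))
    ((\<sigma> * sqrt (pi / 4)) ^ CARD('d) * gauss_kernel \<sigma> s t)"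
proof -
  have "a > 0" using assms by (simp add: a_def)
  have width: "a * a / (a + a) = 1 / \<sigma>\<^sup>2" using assms by (simp add: a_def field_simps)
  have "pi / (a + a) = \<sigma>\<^sup>2 * (pi / 4)" using assms by (simp add: a_def)
  then have mass: "sqrt (pi / (a + a)) = \<sigma> * sqrt (pi / 4)"
    using \<open>\<sigma> > 0\<close> by (simp only: real_sqrt_mult real_sqrt_abs abs_of_pos)
  show ?thesis
    using has_integral_gauss_mult_gauss[OF \<open>a > 0\<close> \<open>a > 0\<close>, of s t] unfolding width mass
    by (simp add: gauss_kernel_def)
qed

definition gauss_comb :: "real \<Rightarrow> 'd::finite kcomb \<Rightarrow> real^'d \<Rightarrow> real" where
  "gauss_comb a L v = kcomb_pair (\<lambda>t. exp (- a * (norm (v - t))\<^sup>2)) L"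

lemma has_integral_gauss_comb_mult:
  assumes "\<And>t. has_bochner_integral lborel (\<lambda>v. exp (- a * (norm (v - t))\<^sup>2) * h v) (F t)"
  shows "has_bochner_integral lborel (\<lambda>v. gauss_comb a L v * h v) (kcomb_pair F L)"
proof -
  have "gauss_comb a L v * h v = kcomb_pair (\<lambda>t. exp (- a * (norm (v - t))\<^sup>2) * h v) L" for v
    by (simp add: gauss_comb_def kcomb_pair_mult mult.commute[of _ "h v"])
  then show ?thesis using has_bochner_integral_kcomb_pair[OF assms] by simp
qed

lemma has_integral_gauss_comb_square:
  fixes L :: "'d::finite kcomb"
  assumes "\<sigma> > 0"
  shows "has_bochner_integral lborel (\<lambda>v. (gauss_comb (2 / \<sigma>\<^sup>2) L v)\<^sup>2)
    ((\<sigma> * sqrt (pi / 4)) ^ CARD('d) * kcomb_norm2 \<sigma> L)"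
proof -
  define a \<gamma> where "a = 2 / \<sigma>\<^sup>2" and "\<gamma> = (\<sigma> * sqrt (pi / 4)) ^ CARD('d)"
  have "has_bochner_integral lborel (\<lambda>v. gauss_comb a L v * exp (- a * (norm (v - s))\<^sup>2))
      (kcomb_pair (\<lambda>t. \<gamma> * gauss_kernel \<sigma> t s) L)" for s
    unfolding a_def \<gamma>_def by (intro has_integral_gauss_comb_mult gauss_kernel_has_integral assms)
  moreover have "kcomb_pair (\<lambda>t. \<gamma> * gauss_kernel \<sigma> t s) L = \<gamma> * kcomb_eval \<sigma> L s" for s
    by (simp add: kcomb_pair_mult kcomb_eval_eq_pair gauss_kernel_commute[of \<sigma> _ s])
  ultimately have "has_bochner_integral lborel (\<lambda>v. exp (- a * (norm (v - s))\<^sup>2) * gauss_comb a L v)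
      (\<gamma> * kcomb_eval \<sigma> L s)" for s
    by (simp add: mult.commute)
  from has_integral_gauss_comb_mult[OF this, of L] show ?thesis
    by (simp add: kcomb_pair_mult kcomb_norm2_eq_inner kcomb_inner_def power2_eq_square a_def \<gamma>_def)
qed

lemma dual_norm2_le_feature:
  fixes h :: "real^'d \<Rightarrow> real"
  assumes "\<sigma> > 0" and h_square: "has_bochner_integral lborel (\<lambda>v. (h v)\<^sup>2) H"
    and F: "\<And>t. has_bochner_integral lborel (\<lambda>v. exp (- (2 / \<sigma>\<^sup>2) * (norm (v - t))\<^sup>2) * h v) (F t)"
  shows "dual_norm2_le \<sigma> F ((\<sigma> * sqrt (pi / 4)) ^ CARD('d) * H)"
  unfolding dual_norm2_le_def
proof
  fix L :: "'d kcomb"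
  define \<gamma> where "\<gamma> = (\<sigma> * sqrt (pi / 4)) ^ CARD('d)"
  have "\<gamma> > 0" using assms by (simp add: \<gamma>_def)
  define G where "G = gauss_comb (2 / \<sigma>\<^sup>2) L"
  have "has_bochner_integral lborel (\<lambda>v. \<gamma> * (h v)\<^sup>2 - 2 * (G v * h v) + 1 / \<gamma> * (G v)\<^sup>2)
      (\<gamma> * H - 2 * kcomb_pair F L + 1 / \<gamma> * (\<gamma> * kcomb_norm2 \<sigma> L))"
    unfolding G_def \<gamma>_def
    by (intro has_bochner_integral_add has_bochner_integral_diff has_bochner_integral_mult_right
        h_square has_integral_gauss_comb_mult F has_integral_gauss_comb_square \<open>\<sigma> > 0\<close>)
  moreover have "\<gamma> * (h v)\<^sup>2 - 2 * (G v * h v) + 1 / \<gamma> * (G v)\<^sup>2 = (\<gamma> * h v - G v)\<^sup>2 / \<gamma>" for v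
    using \<open>\<gamma> > 0\<close> by (simp add: field_simps power2_eq_square)
  ultimately have "has_bochner_integral lborel (\<lambda>v. (\<gamma> * h v - G v)\<^sup>2 / \<gamma>)
      (\<gamma> * H - 2 * kcomb_pair F L + kcomb_norm2 \<sigma> L)"
    using \<open>\<gamma> > 0\<close> by simp
  then have "\<gamma> * H - 2 * kcomb_pair F L + kcomb_norm2 \<sigma> L = (\<integral>v. (\<gamma> * h v - G v)\<^sup>2 / \<gamma> \<partial>lborel)"
    by (rule has_bochner_integral_integral_eq[symmetric])
  also have "\<dots> \<ge> 0" using \<open>\<gamma> > 0\<close> by simp
  finally show "0 \<le> (\<sigma> * sqrt (pi / 4)) ^ CARD('d) * H - 2 * kcomb_pair F L + kcomb_norm2 \<sigma> L"
    unfolding \<gamma>_def .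
qed

definition gauss_conv :: "real \<Rightarrow> (real^'d \<Rightarrow> real) \<Rightarrow> real^'d \<Rightarrow> real" where
  "gauss_conv c g x = (\<integral>u. exp (- c * (norm (u - x))\<^sup>2) * g u \<partial>lborel)"

locale bounded_integrable =
  fixes g :: "real^'d \<Rightarrow> real" and M :: real
  assumes g_measurable [measurable]: "g \<in> borel_measurable borel"
    and g_bound: "\<bar>g u\<bar> \<le> M"
    and g_integrable: "integrable lborel g"
begin

lemma bound_nonneg: "M \<ge> 0"
  using order.trans[OF abs_ge_zero g_bound] .

lemma integrable_gauss_mult:
  assumes "c > 0"
  shows "integrable lborel (\<lambda>u. exp (- c * (norm (u - x))\<^sup>2) * g u)"
  using g_integrable by (rule Bochner_Integration.integrable_bound)
    (use assms in \<open>auto intro!: mult_left_le_one_le simp: abs_mult\<close>)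

lemma bounded_integrable_abs: "bounded_integrable (\<lambda>u. \<bar>g u\<bar>) M"
  using g_bound g_integrable by unfold_locales auto

lemma borel_measurable_gauss_conv [measurable]: "gauss_conv c g \<in> borel_measurable lborel"
  unfolding gauss_conv_def by (intro lborel.borel_measurable_lebesgue_integral) simp

lemma abs_gauss_conv_le_gauss_conv_abs: "\<bar>gauss_conv c g x\<bar> \<le> gauss_conv c (\<lambda>u. \<bar>g u\<bar>) x"
  unfolding gauss_conv_def using integral_abs_bound[of lborel "\<lambda>u. exp (- c * (norm (u - x))\<^sup>2) * g u"]
  by (simp add: abs_mult)

lemma gauss_conv_abs_le:
  assumes "c > 0"
  shows "gauss_conv c (\<lambda>u. \<bar>g u\<bar>) x \<le> M * sqrt (pi / c) ^ CARD('d)"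
proof -
  have gauss: "integrable lborel (\<lambda>u. exp (- c * (norm (u - x))\<^sup>2))"
    "(\<integral>u. exp (- c * (norm (u - x))\<^sup>2) \<partial>lborel) = sqrt (pi / c) ^ CARD('d)"
    using has_integral_gauss[OF assms, of x] by (simp_all add: has_bochner_integral_iff)
  have "gauss_conv c (\<lambda>u. \<bar>g u\<bar>) x \<le> (\<integral>u. exp (- c * (norm (u - x))\<^sup>2) * M \<partial>lborel)"
    unfolding gauss_conv_def
    by (intro integral_mono bounded_integrable.integrable_gauss_mult[OF bounded_integrable_abs assms]
        integrable_mult_left gauss(1) mult_left_mono g_bound) auto
  then show ?thesis using gauss(2) by (simp add: mult.commute)
qed

lemma abs_gauss_conv_le: "c > 0 \<Longrightarrow> \<bar>gauss_conv c g x\<bar> \<le> M * sqrt (pi / c) ^ CARD('d)"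
  using abs_gauss_conv_le_gauss_conv_abs gauss_conv_abs_le order.trans by blast

lemma nn_integral_abs_gauss_conv_le:
  assumes "c > 0"
  shows "(\<integral>\<^sup>+x. ennreal \<bar>gauss_conv c g x\<bar> \<partial>lborel)
    \<le> ennreal (sqrt (pi / c) ^ CARD('d) * (\<integral>u. \<bar>g u\<bar> \<partial>lborel))"
proof -
  have "ennreal \<bar>gauss_conv c g x\<bar>
      \<le> (\<integral>\<^sup>+u. ennreal (exp (- c * (norm (u - x))\<^sup>2)) * ennreal \<bar>g u\<bar> \<partial>lborel)" for x
  proof -
    have "ennreal \<bar>gauss_conv c g x\<bar> \<le> ennreal (\<integral>u. exp (- c * (norm (u - x))\<^sup>2) * \<bar>g u\<bar> \<partial>lborel)"
      using abs_gauss_conv_le_gauss_conv_abs[of c x] by (intro ennreal_leI) (simp add: gauss_conv_def)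
    also have "\<dots> = (\<integral>\<^sup>+u. ennreal (exp (- c * (norm (u - x))\<^sup>2) * \<bar>g u\<bar>) \<partial>lborel)"
      by (intro nn_integral_eq_integral[symmetric] AE_I2
          bounded_integrable.integrable_gauss_mult[OF bounded_integrable_abs assms]) auto
    finally show ?thesis by (simp add: ennreal_mult)
  qed
  then have "(\<integral>\<^sup>+x. ennreal \<bar>gauss_conv c g x\<bar> \<partial>lborel)
      \<le> (\<integral>\<^sup>+x. \<integral>\<^sup>+u. ennreal (exp (- c * (norm (u - x))\<^sup>2)) * ennreal \<bar>g u\<bar> \<partial>lborel \<partial>lborel)"
    by (rule nn_integral_mono)
  also have "\<dots> = (\<integral>\<^sup>+u. \<integral>\<^sup>+x. ennreal (exp (- c * (norm (x - u))\<^sup>2)) * ennreal \<bar>g u\<bar> \<partial>lborel \<partial>lborel)"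
    by (subst lborel_pair.Fubini') (simp_all add: norm_minus_commute)
  also have "\<dots> = (\<integral>\<^sup>+u. ennreal (sqrt (pi / c) ^ CARD('d)) * ennreal \<bar>g u\<bar> \<partial>lborel)"
    by (simp add: nn_integral_multc nn_integral_gauss[OF assms, simplified])
  also have "\<dots> = ennreal (sqrt (pi / c) ^ CARD('d) * (\<integral>u. \<bar>g u\<bar> \<partial>lborel))"
    using g_integrable assms by (simp add: nn_integral_cmult nn_integral_eq_integral ennreal_mult)
  finally show ?thesis .
qed

lemma integrable_gauss_conv: "c > 0 \<Longrightarrow> integrable lborel (gauss_conv c g)"
  by (rule integrableI_bounded) (use nn_integral_abs_gauss_conv_le le_less_trans in fastforce)+

lemma integral_abs_gauss_conv_le:
  assumes "c > 0"
  shows "(\<integral>x. \<bar>gauss_conv c g x\<bar> \<partial>lborel) \<le> sqrt (pi / c) ^ CARD('d) * (\<integral>u. \<bar>g u\<bar> \<partial>lborel)"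
  using nn_integral_abs_gauss_conv_le[OF assms] integrable_gauss_conv[OF assms] assms
  by (simp add: nn_integral_eq_integral)

lemma gauss_conv_square:
  assumes "c > 0"
  shows "integrable lborel (\<lambda>x. (gauss_conv c g x)\<^sup>2)"
    and "(\<integral>x. (gauss_conv c g x)\<^sup>2 \<partial>lborel)
      \<le> M * sqrt (pi / c) ^ CARD('d) * (sqrt (pi / c) ^ CARD('d) * (\<integral>u. \<bar>g u\<bar> \<partial>lborel))"
proof -
  define B where "B = M * sqrt (pi / c) ^ CARD('d)"
  have "B \<ge> 0" using bound_nonneg assms by (simp add: B_def)
  have square_le: "(gauss_conv c g x)\<^sup>2 \<le> B * \<bar>gauss_conv c g x\<bar>" for x
    using mult_right_mono[OF abs_gauss_conv_le[OF assms] abs_ge_zero[of "gauss_conv c g x"], of x]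
    by (simp add: B_def power2_eq_square)
  show square_integrable: "integrable lborel (\<lambda>x. (gauss_conv c g x)\<^sup>2)"
    by (rule Bochner_Integration.integrable_bound[of _ "\<lambda>x. B * \<bar>gauss_conv c g x\<bar>"])
      (use integrable_gauss_conv[OF assms] square_le in \<open>auto intro: order.trans[OF _ abs_ge_self]\<close>)
  have "(\<integral>x. (gauss_conv c g x)\<^sup>2 \<partial>lborel) \<le> (\<integral>x. B * \<bar>gauss_conv c g x\<bar> \<partial>lborel)"
    using integrable_gauss_conv[OF assms] square_integrable by (intro integral_mono square_le) auto
  also have "\<dots> \<le> B * (sqrt (pi / c) ^ CARD('d) * (\<integral>u. \<bar>g u\<bar> \<partial>lborel))"
    using integral_abs_gauss_conv_le[OF assms] \<open>B \<ge> 0\<close> by (simp add: mult_left_mono)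
  finally show "(\<integral>x. (gauss_conv c g x)\<^sup>2 \<partial>lborel)
      \<le> M * sqrt (pi / c) ^ CARD('d) * (sqrt (pi / c) ^ CARD('d) * (\<integral>u. \<bar>g u\<bar> \<partial>lborel))"
    by (simp add: B_def)
qed

lemma integrable_gauss_mult_gauss_mult:
  assumes "a > 0" "b > 0"
  shows "integrable (lborel \<Otimes>\<^sub>M lborel)
    (\<lambda>(v, u). exp (- a * (norm (v - t))\<^sup>2) * (exp (- b * (norm (u - v))\<^sup>2) * g u))"
proof (rule lborel_pair.Fubini_integrable)
  interpret abs: bounded_integrable "\<lambda>u. \<bar>g u\<bar>" M by (rule bounded_integrable_abs)
  define B where "B = M * sqrt (pi / b) ^ CARD('d)"
  have "integrable lborel (\<lambda>v. exp (- a * (norm (v - t))\<^sup>2) * B)"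
    using has_integral_gauss[OF \<open>a > 0\<close>, of t]
    by (intro integrable_mult_left) (simp add: has_bochner_integral_iff)
  then have "integrable lborel (\<lambda>v. exp (- a * (norm (v - t))\<^sup>2) * gauss_conv b (\<lambda>u. \<bar>g u\<bar>) v)"
  proof (rule Bochner_Integration.integrable_bound)
    show "AE v in lborel. norm (exp (- a * (norm (v - t))\<^sup>2) * gauss_conv b (\<lambda>u. \<bar>g u\<bar>) v)
        \<le> norm (exp (- a * (norm (v - t))\<^sup>2) * B)"
      unfolding norm_mult using order.trans[OF abs.abs_gauss_conv_le[OF \<open>b > 0\<close>] abs_ge_self]
      by (intro AE_I2 mult_left_mono) (auto simp: B_def)
  qed simp
  then show "integrable lborel (\<lambda>v. \<integral>u. norm (case (v, u) of (v, u) \<Rightarrow>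
      exp (- a * (norm (v - t))\<^sup>2) * (exp (- b * (norm (u - v))\<^sup>2) * g u)) \<partial>lborel)"
    by (simp add: abs_mult gauss_conv_def)
  show "AE v in lborel. integrable lborel (\<lambda>u. case (v, u) of (v, u) \<Rightarrow>
      exp (- a * (norm (v - t))\<^sup>2) * (exp (- b * (norm (u - v))\<^sup>2) * g u))"
    using integrable_gauss_mult[OF \<open>b > 0\<close>] by simp
qed simp

lemma has_integral_gauss_mult_gauss_conv:
  assumes "a > 0" "b > 0"
  shows "has_bochner_integral lborel (\<lambda>v. exp (- a * (norm (v - t))\<^sup>2) * gauss_conv b g v)
    (sqrt (pi / (a + b)) ^ CARD('d) * gauss_conv (a * b / (a + b)) g t)"
proof -
  define f where "f v u = exp (- a * (norm (v - t))\<^sup>2) * (exp (- b * (norm (u - v))\<^sup>2) * g u)" for v u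
  have f_integrable: "integrable (lborel \<Otimes>\<^sub>M lborel) (\<lambda>(v, u). f v u)"
    unfolding f_def by (rule integrable_gauss_mult_gauss_mult[OF assms])
  have integral_u: "(\<integral>u. f v u \<partial>lborel) = exp (- a * (norm (v - t))\<^sup>2) * gauss_conv b g v" for v
    by (simp add: f_def gauss_conv_def)
  have integral_v: "(\<integral>v. f v u \<partial>lborel)
      = sqrt (pi / (a + b)) ^ CARD('d) * (exp (- (a * b / (a + b)) * (norm (u - t))\<^sup>2) * g u)" for u
    using has_bochner_integral_mult_left[OF has_integral_gauss_mult_gauss[OF assms, of t u], of "g u"]
    by (simp add: has_bochner_integral_iff f_def mult.assoc norm_minus_commute)
  have "integrable lborel (\<lambda>v. \<integral>u. f v u \<partial>lborel)"
    using lborel_pair.integrable_fst'[OF f_integrable] by simp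
  moreover have "(\<integral>v. \<integral>u. f v u \<partial>lborel \<partial>lborel)
      = sqrt (pi / (a + b)) ^ CARD('d) * gauss_conv (a * b / (a + b)) g t"
    using lborel_pair.Fubini_integral[OF f_integrable] unfolding integral_v by (simp add: gauss_conv_def)
  ultimately show ?thesis unfolding integral_u by (simp add: has_bochner_integral_iff)
qed

text \<open>By the semigroup property, a Gaussian convolution narrower than the features is the inner product of
  a feature with another convolution of \<open>g\<close>.\<close>

lemma dual_norm2_le_gauss_conv:
  assumes "\<sigma> > 0" "0 < c" "c < 2 / \<sigma>\<^sup>2"
  defines "b \<equiv> 2 / \<sigma>\<^sup>2 * c / (2 / \<sigma>\<^sup>2 - c)"
  shows "dual_norm2_le \<sigma> (gauss_conv c g)
    ((1 / sqrt (pi / (2 / \<sigma>\<^sup>2 + b)) ^ CARD('d))\<^sup>2 * ((\<sigma> * sqrt (pi / 4)) ^ CARD('d) *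
       (M * sqrt (pi / b) ^ CARD('d) * (sqrt (pi / b) ^ CARD('d) * (\<integral>u. \<bar>g u\<bar> \<partial>lborel)))))"
proof -
  define a where "a = 2 / \<sigma>\<^sup>2"
  have "a > 0" "a - c > 0" using assms by (auto simp: a_def)
  have b: "b = a * c / (a - c)" by (simp add: b_def a_def)
  have "b > 0" unfolding b using \<open>a > 0\<close> \<open>a - c > 0\<close> \<open>c > 0\<close> by simp
  have "a + b = a * a / (a - c)" using \<open>a - c > 0\<close> by (simp add: b field_simps)
  then have ab: "a * b / (a + b) = c" using \<open>a > 0\<close> \<open>a - c > 0\<close> by (simp add: b)
  define G where "G = sqrt (pi / (a + b)) ^ CARD('d)"
  have "G > 0" using \<open>a > 0\<close> \<open>b > 0\<close> by (simp add: G_def)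
  have "dual_norm2_le \<sigma> (\<lambda>t. G * gauss_conv c g t)
      ((\<sigma> * sqrt (pi / 4)) ^ CARD('d) * (\<integral>v. (gauss_conv b g v)\<^sup>2 \<partial>lborel))"
  proof (rule dual_norm2_le_feature[OF \<open>\<sigma> > 0\<close>, folded a_def])
    show "has_bochner_integral lborel (\<lambda>v. (gauss_conv b g v)\<^sup>2) (\<integral>v. (gauss_conv b g v)\<^sup>2 \<partial>lborel)"
      using gauss_conv_square(1)[OF \<open>b > 0\<close>] by (rule has_bochner_integral_integrable)
    show "has_bochner_integral lborel (\<lambda>v. exp (- a * (norm (v - t))\<^sup>2) * gauss_conv b g v)
        (G * gauss_conv c g t)" for t
      using has_integral_gauss_mult_gauss_conv[OF \<open>a > 0\<close> \<open>b > 0\<close>, of t] unfolding ab G_def .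
  qed
  then have "dual_norm2_le \<sigma> (\<lambda>t. G * gauss_conv c g t) ((\<sigma> * sqrt (pi / 4)) ^ CARD('d) *
      (M * sqrt (pi / b) ^ CARD('d) * (sqrt (pi / b) ^ CARD('d) * (\<integral>u. \<bar>g u\<bar> \<partial>lborel))))"
    by (rule dual_norm2_le_mono)
      (use gauss_conv_square(2)[OF \<open>b > 0\<close>] \<open>\<sigma> > 0\<close> in \<open>intro mult_left_mono, auto\<close>)
  from dual_norm2_le_mult[OF this, of "1 / G"] show ?thesis
    unfolding a_def[symmetric] G_def[symmetric] using \<open>G > 0\<close> by simp
qed

end

definition gauss_average :: "real \<Rightarrow> (real^'d \<Rightarrow> real) \<Rightarrow> real^'d \<Rightarrow> real" where
  "gauss_average \<tau> g x = (\<integral>y. exp (- (norm y)\<^sup>2) * g (x + \<tau> *\<^sub>R y) \<partial>lborel)"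

lemma lborel_integral_affine:
  fixes f :: "'a::euclidean_space \<Rightarrow> real"
  assumes "s > 0" and [measurable]: "f \<in> borel_measurable borel"
  shows "(\<integral>u. f u \<partial>lborel) = s ^ DIM('a) * (\<integral>y. f (x + s *\<^sub>R y) \<partial>lborel)"
proof -
  have "(\<integral>u. f u \<partial>lborel)
      = (\<integral>u. f u \<partial>density (distr lborel borel (\<lambda>y. x + s *\<^sub>R y)) (\<lambda>_. ennreal (\<bar>s\<bar> ^ DIM('a))))"
    using lborel_affine[of s x] assms by simp
  also have "\<dots> = (\<integral>u. s ^ DIM('a) * f u \<partial>distr lborel borel (\<lambda>y. x + s *\<^sub>R y))"
    using assms by (subst integral_density) auto
  also have "\<dots> = (\<integral>y. s ^ DIM('a) * f (x + s *\<^sub>R y) \<partial>lborel)"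
    by (subst integral_distr) auto
  finally show ?thesis by simp
qed

lemma gauss_average_eq_gauss_conv:
  fixes g :: "real^'d \<Rightarrow> real"
  assumes "\<tau> > 0" and [measurable]: "g \<in> borel_measurable borel"
  shows "gauss_average \<tau> g x = 1 / \<tau> ^ CARD('d) * gauss_conv (1 / \<tau>\<^sup>2) g x"
proof -
  have "exp (- (1 / \<tau>\<^sup>2) * (norm (x + \<tau> *\<^sub>R y - x))\<^sup>2) = exp (- (norm y)\<^sup>2)" for y
    using assms by (simp add: power_mult_distrib)
  then have "gauss_conv (1 / \<tau>\<^sup>2) g x = \<tau> ^ CARD('d) * gauss_average \<tau> g x"
    unfolding gauss_conv_def gauss_average_def using assms(1)
    by (subst lborel_integral_affine[of \<tau> _ x]) simp_all
  then show ?thesis using assms by simp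
qed

lemma (in bounded_integrable) dual_norm2_le_gauss_average:
  assumes "j \<ge> 1"
  shows "\<exists>K\<ge>0. \<forall>\<sigma>>0. dual_norm2_le \<sigma> (gauss_average (j * \<sigma>) g) (K / \<sigma> ^ CARD('d))"
proof -
  define \<beta> where "\<beta> = 2 / (2 * j\<^sup>2 - 1)"
  have "j\<^sup>2 \<ge> 1" using \<open>j \<ge> 1\<close> by simp
  then have "2 * j\<^sup>2 - 1 > 0" by linarith
  then have "\<beta> > 0" by (simp add: \<beta>_def)
  define I where "I = (\<integral>u. \<bar>g u\<bar> \<partial>lborel)"
  define bound where "bound \<sigma> = (1 / (\<sigma> * sqrt (pi / (2 + \<beta>))) ^ CARD('d))\<^sup>2 *
    ((\<sigma> * sqrt (pi / 4)) ^ CARD('d) * (M * (\<sigma> * sqrt (pi / \<beta>)) ^ CARD('d) *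
       ((\<sigma> * sqrt (pi / \<beta>)) ^ CARD('d) * I)))" for \<sigma>
  define K where "K = (1 / j ^ CARD('d))\<^sup>2 * bound 1"
  have "K \<ge> 0" using bound_nonneg \<open>\<beta> > 0\<close> by (simp add: K_def bound_def I_def)
  moreover have "dual_norm2_le \<sigma> (gauss_average (j * \<sigma>) g) (K / \<sigma> ^ CARD('d))" if "\<sigma> > 0" for \<sigma>
  proof -
    define c where "c = 1 / (j * \<sigma>)\<^sup>2"
    have c: "c > 0" "c < 2 / \<sigma>\<^sup>2"
      using \<open>\<sigma> > 0\<close> \<open>j \<ge> 1\<close> \<open>2 * j\<^sup>2 - 1 > 0\<close> by (auto simp: c_def power_mult_distrib field_simps)
    have "2 / \<sigma>\<^sup>2 - c = (2 * j\<^sup>2 - 1) / (j\<^sup>2 * \<sigma>\<^sup>2)"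
      using \<open>\<sigma> > 0\<close> \<open>j \<ge> 1\<close> by (simp add: c_def power_mult_distrib field_simps)
    then have width: "2 / \<sigma>\<^sup>2 * c / (2 / \<sigma>\<^sup>2 - c) = \<beta> / \<sigma>\<^sup>2"
      using \<open>\<sigma> > 0\<close> \<open>j \<ge> 1\<close> by (simp add: \<beta>_def c_def power_mult_distrib)
    have rescale: "sqrt (pi / (t / \<sigma>\<^sup>2)) = \<sigma> * sqrt (pi / t)" for t
      using \<open>\<sigma> > 0\<close> by (simp add: real_sqrt_divide real_sqrt_mult)
    have "2 / \<sigma>\<^sup>2 + \<beta> / \<sigma>\<^sup>2 = (2 + \<beta>) / \<sigma>\<^sup>2" by (simp add: add_divide_distrib)
    then have "dual_norm2_le \<sigma> (gauss_conv c g) (bound \<sigma>)"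
      using dual_norm2_le_gauss_conv[OF \<open>\<sigma> > 0\<close> c] unfolding width by (simp only: rescale bound_def I_def)
    then have "dual_norm2_le \<sigma> (\<lambda>x. 1 / (j * \<sigma>) ^ CARD('d) * gauss_conv c g x)
        ((1 / (j * \<sigma>) ^ CARD('d))\<^sup>2 * bound \<sigma>)"
      by (rule dual_norm2_le_mult)
    moreover have "(1 / (j * \<sigma>) ^ CARD('d))\<^sup>2 * bound \<sigma> = K / \<sigma> ^ CARD('d)"
      using \<open>\<sigma> > 0\<close> unfolding K_def bound_def power_mult_distrib
      by (simp add: field_simps power2_eq_square)
    moreover have "gauss_average (j * \<sigma>) g = (\<lambda>x. 1 / (j * \<sigma>) ^ CARD('d) * gauss_conv c g x)"
      using gauss_average_eq_gauss_conv[of "j * \<sigma>" g] \<open>\<sigma> > 0\<close> \<open>j \<ge> 1\<close> by (simp add: fun_eq_iff c_def)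
    ultimately show ?thesis by simp
  qed
  ultimately show ?thesis by blast
qed

lemma powr_le_exp_square:
  fixes r :: real
  assumes "r \<ge> 0"
  obtains C where "C > 0" "\<And>t. t \<ge> 0 \<Longrightarrow> t powr r \<le> C * exp (t\<^sup>2 / 2)"
proof -
  define n where "n = nat \<lceil>r\<rceil>"
  have n: "r \<le> real n" unfolding n_def by linarith
  define C :: real where "C = 2 ^ n * fact n + 1"
  have "t powr r \<le> C * exp (t\<^sup>2 / 2)" if "t \<ge> 0" for t :: real
  proof (cases "t \<le> 1")
    case True
    have "t powr r \<le> 1 * 1"
      using powr_mono2[of r t 1] True that \<open>r \<ge> 0\<close> by simp
    also have "\<dots> \<le> C * exp (t\<^sup>2 / 2)" by (intro mult_mono) (auto simp: C_def)
    finally show ?thesis .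
  next
    case False
    have "t powr r \<le> t powr real (2 * n)" using False n by (intro powr_mono) auto
    also have "\<dots> = t ^ (2 * n)" using False by (subst powr_realpow) auto
    also have "\<dots> = 2 ^ n * fact n * ((t\<^sup>2 / 2) ^ n / fact n)"
      by (simp add: power_divide power_mult)
    also have "\<dots> \<le> 2 ^ n * fact n * exp (t\<^sup>2 / 2)"
      using power_over_fact_le_exp[of "t\<^sup>2 / 2" "{n}"] by (intro mult_left_mono) auto
    also have "\<dots> \<le> C * exp (t\<^sup>2 / 2)" by (intro mult_right_mono) (auto simp: C_def)
    finally show ?thesis .
  qed
  moreover have "C > 0" unfolding C_def by (intro add_nonneg_pos) auto
  ultimately show ?thesis using that by blast
qed

lemma integrable_gauss_powr:
  assumes "r \<ge> 0"
  shows "integrable lborel (\<lambda>y :: real^'d. exp (- (norm y)\<^sup>2) * norm y powr r)"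
proof -
  obtain C where C: "C > 0" "\<And>t. t \<ge> 0 \<Longrightarrow> t powr r \<le> C * exp (t\<^sup>2 / 2)"
    using powr_le_exp_square[OF assms] by blast
  have "integrable lborel (\<lambda>y :: real^'d. C * exp (- (1 / 2) * (norm (y - 0))\<^sup>2))"
    using has_integral_gauss[of "1 / 2" "0 :: real^'d"]
    by (intro integrable_mult_right) (simp add: has_bochner_integral_iff)
  then show ?thesis
  proof (rule Bochner_Integration.integrable_bound)
    have "exp (- (norm y)\<^sup>2) * norm y powr r \<le> C * exp (- (1 / 2) * (norm (y - 0))\<^sup>2)" for y :: "real^'d"
    proof -
      have "exp (- (norm y)\<^sup>2) * norm y powr r \<le> exp (- (norm y)\<^sup>2) * (C * exp ((norm y)\<^sup>2 / 2))"
        by (intro mult_left_mono C) auto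
      also have "\<dots> = C * exp (- (1 / 2) * (norm (y - 0))\<^sup>2)" by (simp add: exp_add[symmetric])
      finally show ?thesis .
    qed
    then show "AE y in lborel. norm (exp (- (norm y)\<^sup>2) * norm y powr r)
        \<le> norm (C * exp (- (1 / 2) * (norm (y - 0 :: real^'d))\<^sup>2))"
      using C by (intro AE_I2) (simp add: abs_mult)
  qed simp
qed

lemma (in bounded_integrable) integrable_gauss_average:
  "integrable lborel (\<lambda>y. exp (- (norm y)\<^sup>2) * g (x + \<tau> *\<^sub>R y))"
proof (rule Bochner_Integration.integrable_bound)
  show "integrable lborel (\<lambda>y :: real^'d. M * exp (- 1 * (norm (y - 0))\<^sup>2))"
    using has_integral_gauss[of 1 "0 :: real^'d"]
    by (intro integrable_mult_right) (simp add: has_bochner_integral_iff)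
  show "AE y in lborel. norm (exp (- (norm y)\<^sup>2) * g (x + \<tau> *\<^sub>R y))
      \<le> norm (M * exp (- 1 * (norm (y - 0))\<^sup>2))"
    using g_bound bound_nonneg by (intro AE_I2) (auto simp: abs_mult mult.commute intro!: mult_right_mono)
qed simp

lemma (in bounded_integrable) gauss_average_approx_le:
  fixes c :: "nat \<Rightarrow> real"
  assumes "\<sigma> > 0" "r \<ge> 0"
    and diff: "\<And>y. \<bar>(\<Sum>j\<in>J. c j * g (x + real j *\<^sub>R y)) - fx\<bar> \<le> C * norm y powr r"
  defines "\<gamma> \<equiv> sqrt pi ^ CARD('d)"
    and "\<mu> \<equiv> (\<integral>y. exp (- (norm (y :: real^'d))\<^sup>2) * norm y powr r \<partial>lborel)"
  shows "\<bar>(\<Sum>j\<in>J. c j / \<gamma> * gauss_average (real j * \<sigma>) g x) - fx\<bar> \<le> C * \<mu> / \<gamma> * \<sigma> powr r"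
proof -
  have "\<gamma> > 0" by (simp add: \<gamma>_def)
  have gauss: "integrable lborel (\<lambda>y :: real^'d. exp (- (norm y)\<^sup>2))"
    "(\<integral>y. exp (- (norm (y :: real^'d))\<^sup>2) \<partial>lborel) = \<gamma>"
    using has_integral_gauss[of 1 "0 :: real^'d"] by (auto simp: has_bochner_integral_iff \<gamma>_def)
  define G where "G = (\<Sum>j\<in>J. c j / \<gamma> * gauss_average (real j * \<sigma>) g x)"
  define E where "E y = (\<Sum>j\<in>J. c j * g (x + real j *\<^sub>R (\<sigma> *\<^sub>R y))) - fx" for y
  have "(\<integral>y. exp (- (norm y)\<^sup>2) * E y \<partial>lborel)
      = (\<integral>y. (\<Sum>j\<in>J. c j * (exp (- (norm y)\<^sup>2) * g (x + (real j * \<sigma>) *\<^sub>R y)))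
        - exp (- (norm y)\<^sup>2) * fx \<partial>lborel)"
    by (simp add: E_def right_diff_distrib sum_distrib_left mult_ac)
  also have "\<dots> = (\<Sum>j\<in>J. c j * gauss_average (real j * \<sigma>) g x) - \<gamma> * fx"
    using gauss integrable_gauss_average
    by (simp add: Bochner_Integration.integral_diff Bochner_Integration.integral_sum gauss_average_def)
  also have "\<dots> = \<gamma> * (G - fx)"
    using \<open>\<gamma> > 0\<close> by (simp add: G_def right_diff_distrib sum_distrib_left)
  finally have "\<gamma> * \<bar>G - fx\<bar> = \<bar>\<integral>y. exp (- (norm y)\<^sup>2) * E y \<partial>lborel\<bar>"
    using \<open>\<gamma> > 0\<close> by (simp add: abs_mult)
  also have "\<dots> \<le> (\<integral>y. \<bar>exp (- (norm y)\<^sup>2) * E y\<bar> \<partial>lborel)" by (rule integral_abs_bound)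
  also have "\<dots> \<le> (\<integral>y. C * \<sigma> powr r * (exp (- (norm (y :: real^'d))\<^sup>2) * norm y powr r) \<partial>lborel)"
  proof (rule integral_mono')
    show "integrable lborel (\<lambda>y :: real^'d. C * \<sigma> powr r * (exp (- (norm y)\<^sup>2) * norm y powr r))"
      using \<open>r \<ge> 0\<close> by (intro integrable_mult_right integrable_gauss_powr)
    fix y
    have "\<bar>E y\<bar> \<le> C * \<sigma> powr r * norm y powr r"
      using diff[of "\<sigma> *\<^sub>R y"] \<open>\<sigma> > 0\<close> by (simp add: E_def powr_mult)
    from mult_left_mono[OF this, of "exp (- (norm y)\<^sup>2)"]
    show "\<bar>exp (- (norm y)\<^sup>2) * E y\<bar> \<le> C * \<sigma> powr r * (exp (- (norm y)\<^sup>2) * norm y powr r)"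
      by (simp add: abs_mult mult_ac)
    then show "0 \<le> C * \<sigma> powr r * (exp (- (norm y)\<^sup>2) * norm y powr r)" by linarith
  qed
  also have "\<dots> = C * \<sigma> powr r * \<mu>" by (simp add: \<mu>_def)
  finally show ?thesis using \<open>\<gamma> > 0\<close> by (simp add: G_def field_simps)
qed

definition kcomb_approximable :: "real \<Rightarrow> real \<Rightarrow> (real^'d \<Rightarrow> real) \<Rightarrow> bool" where
  "kcomb_approximable r K f \<longleftrightarrow> (\<forall>\<sigma>. 0 < \<sigma> \<and> \<sigma> \<le> 1 \<longrightarrow> (\<exists>L. kcomb_centers L \<subseteq> unit_cube \<and>
     kcomb_norm2 \<sigma> L \<le> K / \<sigma> ^ CARD('d) \<and> (\<forall>x\<in>unit_cube. \<bar>kcomb_eval \<sigma> L x - f x\<bar> \<le> K * \<sigma> powr r)))"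

lemma kcomb_approximable_of_dual_norm2_le:
  fixes f :: "real^'d \<Rightarrow> real"
  assumes "r \<ge> 0" "B \<ge> 0" "C \<ge> 0"
    and dual: "\<And>\<sigma>. \<sigma> > 0 \<Longrightarrow> dual_norm2_le \<sigma> (G \<sigma>) (B / \<sigma> ^ CARD('d))"
    and close: "\<And>\<sigma> x. \<sigma> > 0 \<Longrightarrow> x \<in> unit_cube \<Longrightarrow> \<bar>G \<sigma> x - f x\<bar> \<le> C * \<sigma> powr r"
  shows "kcomb_approximable r (4 * B + C + 2) f"
  unfolding kcomb_approximable_def
proof (intro allI impI)
  fix \<sigma> :: real assume "0 < \<sigma> \<and> \<sigma> \<le> 1"
  then have \<sigma>: "0 < \<sigma>" "\<sigma> \<le> 1" "\<sigma> powr r > 0" by simp_all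
  obtain L where L: "kcomb_centers L \<subseteq> unit_cube"
    and norm2: "kcomb_norm2 \<sigma> L \<le> 4 * (B / \<sigma> ^ CARD('d)) + 2 * (\<sigma> powr r)\<^sup>2"
    and eval: "\<forall>x\<in>unit_cube. \<bar>kcomb_eval \<sigma> L x - G \<sigma> x\<bar> \<le> \<sigma> powr r"
    using dual_norm2_le_kcomb_approx[OF dual[OF \<sigma>(1)] \<sigma>(3)] by blast
  have "\<sigma> powr r \<le> 1" using \<sigma> \<open>r \<ge> 0\<close> powr_mono2[of r \<sigma> 1] by simp
  then have "(\<sigma> powr r)\<^sup>2 \<le> 1" by (simp add: power_le_one)
  also have "1 \<le> 1 / \<sigma> ^ CARD('d)" using \<sigma> by (simp add: power_le_one)
  finally have "kcomb_norm2 \<sigma> L \<le> (4 * B + 2) / \<sigma> ^ CARD('d)"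
    using norm2 by (simp add: add_divide_distrib)
  also have "\<dots> \<le> (4 * B + C + 2) / \<sigma> ^ CARD('d)"
    using \<open>C \<ge> 0\<close> \<sigma> by (intro divide_right_mono) auto
  finally have "kcomb_norm2 \<sigma> L \<le> (4 * B + C + 2) / \<sigma> ^ CARD('d)" .
  moreover have "\<bar>kcomb_eval \<sigma> L x - f x\<bar> \<le> (4 * B + C + 2) * \<sigma> powr r" if "x \<in> unit_cube" for x
  proof -
    have "\<bar>kcomb_eval \<sigma> L x - f x\<bar> \<le> (C + 1) * \<sigma> powr r"
      using bspec[OF eval that] close[OF \<sigma>(1) that] by (simp add: distrib_right)
    also have "\<dots> \<le> (4 * B + C + 2) * \<sigma> powr r"
      using \<open>B \<ge> 0\<close> by (intro mult_right_mono) auto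
    finally show ?thesis .
  qed
  ultimately show "\<exists>L. kcomb_centers L \<subseteq> unit_cube \<and> kcomb_norm2 \<sigma> L \<le> (4 * B + C + 2) / \<sigma> ^ CARD('d) \<and>
      (\<forall>x\<in>unit_cube. \<bar>kcomb_eval \<sigma> L x - f x\<bar> \<le> (4 * B + C + 2) * \<sigma> powr r)"
    using L by blast
qed

lemma (in bounded_integrable) kcomb_approximable_of_difference_bound:
  fixes f :: "real^'d \<Rightarrow> real" and c :: "nat \<Rightarrow> real"
  assumes "s \<ge> 1" "r \<ge> 0" "C \<ge> 0"
    and diff: "\<And>x y. x \<in> unit_cube \<Longrightarrow> \<bar>(\<Sum>j=1..s. c j * g (x + real j *\<^sub>R y)) - f x\<bar> \<le> C * norm y powr r"
  shows "\<exists>K>0. kcomb_approximable r K f"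
proof -
  define \<gamma> where "\<gamma> = sqrt pi ^ CARD('d)"
  define \<mu> where "\<mu> = (\<integral>y. exp (- (norm (y :: real^'d))\<^sup>2) * norm y powr r \<partial>lborel)"
  have "C * \<mu> / \<gamma> \<ge> 0" using \<open>C \<ge> 0\<close> by (simp add: \<mu>_def \<gamma>_def)
  have "\<exists>k\<ge>0. \<forall>\<sigma>>0. dual_norm2_le \<sigma> (gauss_average (real j * \<sigma>) g) (k / \<sigma> ^ CARD('d))" if "j \<in> {1..s}" for j
    using that by (intro dual_norm2_le_gauss_average) auto
  then obtain k where k_nonneg: "\<And>j. j \<in> {1..s} \<Longrightarrow> k j \<ge> 0"
    and k: "\<And>j \<sigma>. j \<in> {1..s} \<Longrightarrow> \<sigma> > 0 \<Longrightarrow> dual_norm2_le \<sigma> (gauss_average (real j * \<sigma>) g) (k j / \<sigma> ^ CARD('d))"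
    by metis
  define B where "B = (\<Sum>j=1..s. real s * (c j / \<gamma>)\<^sup>2 * k j)"
  have "B \<ge> 0" unfolding B_def using k_nonneg by (intro sum_nonneg) auto
  have "dual_norm2_le \<sigma> (\<lambda>x. \<Sum>j=1..s. c j / \<gamma> * gauss_average (real j * \<sigma>) g x) (B / \<sigma> ^ CARD('d))"
    if "\<sigma> > 0" for \<sigma>
  proof -
    have "dual_norm2_le \<sigma> (\<lambda>x. \<Sum>j=1..s. c j / \<gamma> * gauss_average (real j * \<sigma>) g x)
        (\<Sum>j=1..s. real (card {1..s}) * (c j / \<gamma>)\<^sup>2 * (k j / \<sigma> ^ CARD('d)))"
      using \<open>s \<ge> 1\<close> k that by (intro dual_norm2_le_sum) auto
    then show ?thesis by (simp add: B_def sum_divide_distrib)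
  qed
  moreover have "\<bar>(\<Sum>j=1..s. c j / \<gamma> * gauss_average (real j * \<sigma>) g x) - f x\<bar> \<le> C * \<mu> / \<gamma> * \<sigma> powr r"
    if "\<sigma> > 0" "x \<in> unit_cube" for \<sigma> x
    unfolding \<gamma>_def \<mu>_def by (intro gauss_average_approx_le that \<open>r \<ge> 0\<close> diff)
  ultimately have "kcomb_approximable r (4 * B + C * \<mu> / \<gamma> + 2) f"
    by (rule kcomb_approximable_of_dual_norm2_le[OF \<open>r \<ge> 0\<close> \<open>B \<ge> 0\<close> \<open>C * \<mu> / \<gamma> \<ge> 0\<close>])
  moreover have "4 * B + C * \<mu> / \<gamma> + 2 > 0" using \<open>B \<ge> 0\<close> \<open>C * \<mu> / \<gamma> \<ge> 0\<close> by linarith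
  ultimately show ?thesis by blast
qed

section \<open>Taylor expansion on the cube\<close>

definition has_partial_on :: "(real^'d \<Rightarrow> real) \<Rightarrow> 'd \<Rightarrow> (real^'d \<Rightarrow> real) \<Rightarrow> (real^'d) set \<Rightarrow> bool" where
  "has_partial_on G i G' A \<longleftrightarrow> (\<forall>x\<in>A. ((\<lambda>t. G (x + t *\<^sub>R axis i 1)) has_real_derivative G' x)
     (at 0 within {t. x + t *\<^sub>R axis i 1 \<in> A}))"

lemma has_partial_on_path:
  assumes "has_partial_on G i G' A" and path: "\<And>t. t \<in> S \<Longrightarrow> w + t *\<^sub>R axis i 1 \<in> A" and "t \<in> S"
  shows "((\<lambda>t. G (w + t *\<^sub>R axis i 1)) has_real_derivative G' (w + t *\<^sub>R axis i 1)) (at t within S)"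
proof -
  define w' where "w' = w + t *\<^sub>R axis i 1"
  have shift: "w + s *\<^sub>R axis i 1 = w' + (s - t) *\<^sub>R axis i 1" for s
    by (simp add: w'_def algebra_simps)
  have "w' \<in> A" using path[OF \<open>t \<in> S\<close>] by (simp add: w'_def)
  then have "((\<lambda>s. G (w' + s *\<^sub>R axis i 1)) has_real_derivative G' w')
      (at 0 within {s. w' + s *\<^sub>R axis i 1 \<in> A})"
    using assms(1) by (simp add: has_partial_on_def)
  then have "((\<lambda>s. G (w' + s *\<^sub>R axis i 1)) has_real_derivative G' w')
      (at ((\<lambda>s. s - t) t) within (\<lambda>s. s - t) ` S)"
    unfolding diff_self by (rule has_field_derivative_subset) (use path shift in auto)
  then have "((\<lambda>s. G (w' + s *\<^sub>R axis i 1)) \<circ> (\<lambda>s. s - t) has_real_derivative G' w' * 1) (at t within S)"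
    by (rule DERIV_image_chain) (auto intro!: derivative_eq_intros)
  then show ?thesis unfolding shift by (simp add: o_def)
qed

definition coord_box :: "real^'d \<Rightarrow> real^'d \<Rightarrow> (real^'d) set" where
  "coord_box x y = {p. \<forall>j. p $ j \<in> closed_segment (x $ j) (y $ j)}"

lemma coord_box_subset_cbox:
  fixes a b :: "real^'d"
  assumes "x \<in> cbox a b" "y \<in> cbox a b"
  shows "coord_box x y \<subseteq> cbox a b"
proof
  fix p assume p: "p \<in> coord_box x y"
  have "a $ j \<le> p $ j \<and> p $ j \<le> b $ j" for j
  proof -
    have "p $ j \<in> closed_segment (x $ j) (y $ j)" using p by (simp add: coord_box_def)
    also have "\<dots> \<subseteq> {a $ j..b $ j}"
      using assms by (intro closed_segment_subset) (auto simp: mem_box_cart)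
    finally show ?thesis by simp
  qed
  then show "p \<in> cbox a b" by (simp add: mem_box_cart)
qed

lemma norm_diff_le_coord_box:
  assumes "p \<in> coord_box x y"
  shows "norm (p - x) \<le> norm (y - x)"
proof (rule norm_le_componentwise_cart)
  fix j
  have "p $ j \<in> closed_segment (x $ j) (y $ j)" using assms by (simp add: coord_box_def)
  then show "norm ((p - x) $ j) \<le> norm ((y - x) $ j)"
    using segment_bound(1) by fastforce
qed

definition coord_mix :: "'d set \<Rightarrow> real^'d \<Rightarrow> real^'d \<Rightarrow> real^'d" where
  "coord_mix S x y = (\<chi> i. if i \<in> S then y $ i else x $ i)"

lemma coord_increment_step:
  fixes G :: "real^'d \<Rightarrow> real"
  assumes partial: "has_partial_on G i G' A" and "coord_box x y \<subseteq> A"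
    and close: "\<And>p. p \<in> coord_box x y \<Longrightarrow> \<bar>G' p - c\<bar> \<le> e" and "i \<notin> S"
  shows "\<bar>G (coord_mix (insert i S) x y) - G (coord_mix S x y) - c * (y - x) $ i\<bar> \<le> e * \<bar>(y - x) $ i\<bar>"
proof -
  define \<tau> where "\<tau> = (y - x) $ i"
  define T where "T = closed_segment 0 \<tau>"
  define path where "path t = coord_mix S x y + t *\<^sub>R axis i 1" for t
  have path_\<tau>: "path \<tau> = coord_mix (insert i S) x y"
    using \<open>i \<notin> S\<close> by (auto simp: path_def coord_mix_def vec_eq_iff axis_def \<tau>_def)
  have path_in_box: "path t \<in> coord_box x y" if "t \<in> T" for t
  proof -
    have "x $ i + t \<in> closed_segment (x $ i) (y $ i)"
      using that by (auto simp: T_def \<tau>_def closed_segment_eq_real_ivl split: if_splits)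
    then show ?thesis
      using \<open>i \<notin> S\<close> by (auto simp: coord_box_def path_def coord_mix_def axis_def)
  qed
  define p where "p t = G (path t) - c * t" for t
  have "norm (p \<tau> - p 0) \<le> e * norm (\<tau> - 0)"
  proof (rule field_differentiable_bound[of T])
    show "(p has_field_derivative G' (path t) - c) (at t within T)" if "t \<in> T" for t
    proof -
      have "((\<lambda>t. G (path t)) has_real_derivative G' (path t)) (at t within T)"
        unfolding path_def using path_in_box assms(2) that
        by (intro has_partial_on_path[OF partial]) (auto simp: path_def)
      then show ?thesis unfolding p_def by (auto intro!: derivative_eq_intros)
    qed
    show "norm (G' (path t) - c) \<le> e" if "t \<in> T" for t
      using close[OF path_in_box[OF that]] by simp
  qed (auto simp: T_def)
  then show ?thesis unfolding path_\<tau>[symmetric] by (simp add: p_def path_def \<tau>_def algebra_simps)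
qed

lemma coord_increment_le:
  fixes G :: "real^'d \<Rightarrow> real"
  assumes partial: "\<And>i. has_partial_on G i (G' i) A" and box: "coord_box x y \<subseteq> A"
    and close: "\<And>i p. p \<in> coord_box x y \<Longrightarrow> \<bar>G' i p - c i\<bar> \<le> e"
  shows "\<bar>G y - G x - (\<Sum>i\<in>UNIV. c i * (y - x) $ i)\<bar> \<le> e * (\<Sum>i\<in>UNIV. \<bar>(y - x) $ i\<bar>)"
proof -
  have "\<bar>G (coord_mix S x y) - G x - (\<Sum>i\<in>S. c i * (y - x) $ i)\<bar> \<le> e * (\<Sum>i\<in>S. \<bar>(y - x) $ i\<bar>)"
    if "finite S" for S
    using that
  proof (induction S)
    case empty
    have "coord_mix {} x y = x" by (simp add: coord_mix_def vec_eq_iff)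
    then show ?case by simp
  next
    case (insert i S)
    then show ?case
      using coord_increment_step[OF partial[of i] box close[of _ i] \<open>i \<notin> S\<close>] by (simp add: distrib_left)
  qed
  from this[of UNIV] show ?thesis by (simp add: coord_mix_def)
qed

lemma has_derivative_of_continuous_partials:
  fixes G :: "real^'d \<Rightarrow> real" and G' :: "'d \<Rightarrow> real^'d \<Rightarrow> real"
  assumes partial: "\<And>i. has_partial_on G i (G' i) (cbox a b)"
    and cont: "\<And>i. continuous_on (cbox a b) (G' i)" and x: "x \<in> cbox a b"
  shows "(G has_derivative (\<lambda>h. \<Sum>i\<in>UNIV. G' i x * h $ i)) (at x within cbox a b)"
  unfolding has_derivative_within_alt
proof (intro conjI allI impI)
  show "bounded_linear (\<lambda>h :: real^'d. \<Sum>i\<in>UNIV. G' i x * h $ i)"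
    by (intro bounded_linear_sum bounded_linear_const_mult bounded_linear_vec_nth)
  fix e :: real assume "e > 0"
  define e' where "e' = e / real CARD('d)"
  have "e' > 0" using \<open>e > 0\<close> by (simp add: e'_def)
  have "\<exists>\<delta>>0. \<forall>y\<in>cbox a b. dist y x < \<delta> \<longrightarrow> dist (G' i y) (G' i x) < e'" for i
    using cont[of i] x \<open>e' > 0\<close> unfolding continuous_on_iff by blast
  then obtain \<delta> where \<delta>: "\<And>i. \<delta> i > 0"
    "\<And>i y. y \<in> cbox a b \<Longrightarrow> dist y x < \<delta> i \<Longrightarrow> dist (G' i y) (G' i x) < e'" by metis
  have "norm (G y - G x - (\<Sum>i\<in>UNIV. G' i x * (y - x) $ i)) \<le> e * norm (y - x)"
    if y: "y \<in> cbox a b" "norm (y - x) < Min (range \<delta>)" for y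
  proof -
    have box: "coord_box x y \<subseteq> cbox a b" using coord_box_subset_cbox[OF x y(1)] .
    have close: "\<bar>G' i p - G' i x\<bar> \<le> e'" if "p \<in> coord_box x y" for i p
    proof -
      have "dist p x < Min (range \<delta>)"
        unfolding dist_norm using norm_diff_le_coord_box[OF that] y(2) by (rule le_less_trans)
      then have "dist p x < \<delta> i" by simp
      then show ?thesis using \<delta>(2)[of p i] that box by (auto simp: dist_norm)
    qed
    have "(\<Sum>i\<in>UNIV. \<bar>(y - x) $ i\<bar>) \<le> (\<Sum>i\<in>(UNIV :: 'd set). norm (y - x))"
      by (intro sum_mono component_le_norm_cart)
    then have "e' * (\<Sum>i\<in>UNIV. \<bar>(y - x) $ i\<bar>) \<le> e' * (real CARD('d) * norm (y - x))"
      using \<open>e' > 0\<close> by (intro mult_left_mono) auto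
    also have "\<dots> = e * norm (y - x)" by (simp add: e'_def)
    finally show ?thesis using coord_increment_le[OF partial box close] by simp
  qed
  moreover have "Min (range \<delta>) > 0" using \<delta>(1) by simp
  ultimately show "\<exists>d>0. \<forall>y\<in>cbox a b. norm (y - x) < d \<longrightarrow>
      norm (G y - G x - (\<Sum>i\<in>UNIV. G' i x * (y - x) $ i)) \<le> e * norm (y - x)"
    by blast
qed

lemma holder_imp_continuous_on:
  fixes G :: "'a::real_normed_vector \<Rightarrow> real"
  assumes "\<And>x y. x \<in> S \<Longrightarrow> y \<in> S \<Longrightarrow> \<bar>G x - G y\<bar> \<le> c * norm (x - y) powr v" "v > 0"
  shows "continuous_on S G"
  unfolding continuous_on_def
proof
  fix x assume x: "x \<in> S"
  have "((\<lambda>y. norm (y - x)) \<longlongrightarrow> 0) (at x within S)"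
    by (rule tendsto_norm_zero[OF LIM_zero[OF tendsto_ident_at]])
  then have "((\<lambda>y. norm (y - x) powr v) \<longlongrightarrow> 0) (at x within S)"
    by (rule tendsto_zero_powrI) (use \<open>v > 0\<close> in auto)
  then have "((\<lambda>y. c * norm (y - x) powr v) \<longlongrightarrow> 0) (at x within S)"
    by (rule tendsto_mult_right_zero)
  then have "((\<lambda>y. G y - G x) \<longlongrightarrow> 0) (at x within S)"
    by (rule Lim_null_comparison[rotated]) (use assms(1) x in \<open>auto simp: eventually_at_filter\<close>)
  then show "(G \<longlongrightarrow> G x) (at x within S)" by (rule LIM_zero_cancel)
qed

lemma taylor_le_top_oscillation:
  fixes \<phi> :: "nat \<Rightarrow> real \<Rightarrow> real"
  assumes deriv: "\<And>k t. k < u \<Longrightarrow> t \<in> {0..1} \<Longrightarrow> (\<phi> k has_real_derivative \<phi> (Suc k) t) (at t within {0..1})"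
    and oscillation: "\<And>t. t \<in> {0..1} \<Longrightarrow> \<bar>\<phi> u t - \<phi> u 0\<bar> \<le> \<omega>"
  shows "\<bar>\<phi> 0 1 - (\<Sum>k<Suc u. \<phi> k 0 / fact k)\<bar> \<le> \<omega>"
proof (cases u)
  case 0
  then show ?thesis using oscillation[of 1] by simp
next
  case (Suc n)
  \<comment> \<open>Subtracting the top Taylor term leaves a function whose last derivative is the oscillation.\<close>
  define p where "p k t = \<phi> k t - \<phi> u 0 * t ^ (u - k) / fact (u - k)" for k t
  have "norm (p 0 1 - (\<Sum>k\<le>n. p k 0 * (1 - 0) ^ k / fact k)) \<le> \<omega> * norm (1 - 0 :: real) ^ Suc n / fact n"
  proof (rule field_Taylor[of "{0..1}"])
    show "(p k has_field_derivative p (Suc k) t) (at t within {0..1})" if "t \<in> {0..1}" "k \<le> n" for k t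
    proof -
      define q where "q = u - Suc k"
      have q: "u - k = Suc q" using Suc that by (simp add: q_def)
      have "((\<lambda>t. t ^ Suc q) has_real_derivative real (Suc q) * t ^ q) (at t within {0..1})"
        by (auto intro!: derivative_eq_intros simp del: power_Suc)
      from DERIV_cmult[OF this, of "\<phi> u 0 / fact (Suc q)"]
      have "((\<lambda>t. \<phi> u 0 * t ^ (u - k) / fact (u - k))
          has_real_derivative \<phi> u 0 * t ^ (u - Suc k) / fact (u - Suc k))
          (at t within {0..1})"
        unfolding q q_def[symmetric] by (simp del: power_Suc of_nat_Suc)
      then show ?thesis unfolding p_def
        using deriv[of k t] that Suc by (intro DERIV_diff) auto
    qed
    show "norm (p (Suc n) t) \<le> \<omega>" if "t \<in> {0..1}" for t
      using oscillation[OF that] Suc by (simp add: p_def)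
  qed auto
  also have "\<dots> \<le> \<omega>"
  proof -
    have "\<omega> \<ge> 0" using oscillation[of 0] by simp
    then show ?thesis using divide_left_mono[OF fact_ge_1, of \<omega> n] by simp
  qed
  also have "(\<Sum>k\<le>n. p k 0 * (1 - 0) ^ k / fact k) = (\<Sum>k<u. \<phi> k 0 / fact k)"
    unfolding Suc lessThan_Suc_atMost by (intro sum.cong) (auto simp: p_def Suc)
  finally show ?thesis by (simp add: p_def algebra_simps)
qed

lemma compact_unit_cube: "compact (unit_cube :: (real^'d) set)"
  by (simp add: unit_cube_eq_cbox)

lemma continuous_on_unit_cube_bounded:
  fixes f :: "real^'d \<Rightarrow> real"
  assumes "continuous_on unit_cube f"
  obtains b where "b \<ge> 0" "\<And>x. x \<in> unit_cube \<Longrightarrow> \<bar>f x\<bar> \<le> b"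
proof -
  have "bounded (f ` unit_cube)"
    using assms compact_unit_cube by (intro compact_imp_bounded compact_continuous_image)
  then obtain b where "b > 0" "\<forall>y\<in>f ` unit_cube. norm y \<le> b" unfolding bounded_pos by blast
  then show ?thesis using that[of b] by simp
qed

lemma abs_coord_prod_le: "\<bar>coord_prod l h\<bar> \<le> norm h ^ length l"
  by (induction l) (auto simp: abs_mult intro!: mult_mono component_le_norm_cart)

definition coord_poly :: "nat \<Rightarrow> ('d list \<Rightarrow> real) \<Rightarrow> real^'d \<Rightarrow> real^'d \<Rightarrow> real" where
  "coord_poly n a z x = (\<Sum>l | length l < n. a l * coord_prod l (x - z))"

definition locally_poly_approx :: "nat \<Rightarrow> real \<Rightarrow> real \<Rightarrow> real \<Rightarrow> (real^'d \<Rightarrow> real) \<Rightarrow> bool" where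
  "locally_poly_approx n B C r f \<longleftrightarrow> (\<forall>z\<in>unit_cube. \<exists>a. (\<forall>l. length l < n \<longrightarrow> \<bar>a l\<bar> \<le> B) \<and> a [] = f z \<and>
     (\<forall>x\<in>unit_cube. \<bar>f x - coord_poly n a z x\<bar> \<le> C * norm (x - z) powr r))"

locale iterated_partials =
  fixes F :: "'d::finite list \<Rightarrow> real^'d \<Rightarrow> real" and u :: nat and c v :: real
  assumes partial: "length ds < u \<Longrightarrow> has_partial_on (F ds) i (F (i # ds)) unit_cube"
    and holder: "length ds = u \<Longrightarrow> x \<in> unit_cube \<Longrightarrow> x' \<in> unit_cube \<Longrightarrow>
      \<bar>F ds x - F ds x'\<bar> \<le> c * norm (x - x') powr v"
    and c_nonneg: "c \<ge> 0" and v_pos: "v > 0"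
begin

lemma continuous_on_partial: "length ds \<le> u \<Longrightarrow> continuous_on unit_cube (F ds)"
proof (induction "u - length ds" arbitrary: ds)
  case 0
  then show ?case by (intro holder_imp_continuous_on[OF holder v_pos]) auto
next
  case (Suc k)
  have "(F ds has_derivative (\<lambda>h. \<Sum>i\<in>UNIV. F (i # ds) x * h $ i)) (at x within unit_cube)"
    if "x \<in> unit_cube" for x
    using Suc that partial unfolding unit_cube_eq_cbox by (intro has_derivative_of_continuous_partials) auto
  then show ?case by (rule has_derivative_continuous_on)
qed

lemma has_derivative_partial:
  assumes "length ds < u" "x \<in> unit_cube"
  shows "(F ds has_derivative (\<lambda>h. \<Sum>i\<in>UNIV. F (i # ds) x * h $ i)) (at x within unit_cube)"
  using assms partial continuous_on_partial unfolding unit_cube_eq_cbox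
  by (intro has_derivative_of_continuous_partials) auto

lemma partials_bounded:
  obtains B where "B \<ge> 0" "\<And>ds x. length ds \<le> u \<Longrightarrow> x \<in> unit_cube \<Longrightarrow> \<bar>F ds x\<bar> \<le> B"
proof -
  have "\<exists>b\<ge>0. \<forall>x\<in>unit_cube. \<bar>F ds x\<bar> \<le> b" if "length ds \<le> u" for ds
    using continuous_on_unit_cube_bounded[OF continuous_on_partial[OF that]] by metis
  then obtain b where b: "\<And>ds. length ds \<le> u \<Longrightarrow> b ds \<ge> 0"
    "\<And>ds x. length ds \<le> u \<Longrightarrow> x \<in> unit_cube \<Longrightarrow> \<bar>F ds x\<bar> \<le> b ds" by metis
  define B where "B = (\<Sum>ds | length ds < Suc u. b ds)"
  have "b ds \<le> B" if "length ds \<le> u" for ds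
    unfolding B_def using b that by (intro member_le_sum) auto
  moreover have "B \<ge> 0" unfolding B_def using b by (intro sum_nonneg) auto
  ultimately show ?thesis using that b(2) order.trans by metis
qed

definition line_deriv :: "real^'d \<Rightarrow> real^'d \<Rightarrow> nat \<Rightarrow> real \<Rightarrow> real" where
  "line_deriv z h k t = (\<Sum>l | length l = k. F l (z + t *\<^sub>R h) * coord_prod l h)"

lemma partial_along_line_has_derivative:
  assumes "length ds < u" and line: "\<And>t. t \<in> {0..1} \<Longrightarrow> z + t *\<^sub>R h \<in> unit_cube" and "t \<in> {0..1}"
  shows "((\<lambda>t. F ds (z + t *\<^sub>R h)) has_real_derivative (\<Sum>i\<in>UNIV. F (i # ds) (z + t *\<^sub>R h) * h $ i))
    (at t within {0..1})"
proof -
  have "((\<lambda>t. z + t *\<^sub>R h) has_derivative (\<lambda>s. s *\<^sub>R h)) (at t within {0..1})"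
    by (auto intro!: derivative_eq_intros)
  moreover have "(F ds has_derivative (\<lambda>y. \<Sum>i\<in>UNIV. F (i # ds) (z + t *\<^sub>R h) * y $ i))
      (at (z + t *\<^sub>R h) within (\<lambda>t. z + t *\<^sub>R h) ` {0..1})"
    using has_derivative_partial[OF assms(1) line[OF assms(3)]] line by (blast intro: has_derivative_subset)
  ultimately have "((\<lambda>t. F ds (z + t *\<^sub>R h)) has_derivative
      (\<lambda>s. \<Sum>i\<in>UNIV. F (i # ds) (z + t *\<^sub>R h) * (s *\<^sub>R h) $ i)) (at t within {0..1})"
    using diff_chain_within by (fastforce simp: o_def)
  then show ?thesis
    unfolding has_field_derivative_def
    by (rule has_derivative_eq_rhs) (auto simp: fun_eq_iff sum_distrib_left mult_ac)
qed

lemma line_deriv_has_derivative: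
  assumes "k < u" "\<And>t. t \<in> {0..1} \<Longrightarrow> z + t *\<^sub>R h \<in> unit_cube" "t \<in> {0..1}"
  shows "(line_deriv z h k has_real_derivative line_deriv z h (Suc k) t) (at t within {0..1})"
proof -
  have "(line_deriv z h k has_real_derivative
      (\<Sum>l | length l = k. (\<Sum>i\<in>UNIV. F (i # l) (z + t *\<^sub>R h) * h $ i) * coord_prod l h))
      (at t within {0..1})"
    unfolding line_deriv_def[abs_def] using assms
    by (intro DERIV_sum DERIV_cmult_right partial_along_line_has_derivative) auto
  moreover have "(\<Sum>l | length l = k. (\<Sum>i\<in>UNIV. F (i # l) (z + t *\<^sub>R h) * h $ i) * coord_prod l h)
      = line_deriv z h (Suc k) t"
    unfolding line_deriv_def sum_lists_length_Suc sum_distrib_right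
    by (subst sum.swap) (simp add: mult_ac)
  ultimately show ?thesis by simp
qed

lemma line_deriv_top_oscillation:
  assumes line: "\<And>t. t \<in> {0..1} \<Longrightarrow> z + t *\<^sub>R h \<in> unit_cube" and t: "t \<in> {0..1}"
  shows "\<bar>line_deriv z h u t - line_deriv z h u 0\<bar>
    \<le> real (card {l :: 'd list. length l = u}) * c * norm h powr (v + real u)"
proof -
  have z: "z \<in> unit_cube" using line[of 0] by simp
  have "\<bar>line_deriv z h u t - line_deriv z h u 0\<bar>
      = \<bar>\<Sum>l | length l = u. (F l (z + t *\<^sub>R h) - F l z) * coord_prod l h\<bar>"
    by (simp add: line_deriv_def sum_subtractf left_diff_distrib)
  also have "\<dots> \<le> (\<Sum>l | length l = u. \<bar>(F l (z + t *\<^sub>R h) - F l z) * coord_prod l h\<bar>)" by (rule sum_abs)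
  also have "\<dots> \<le> (\<Sum>l :: 'd list | length l = u. c * norm h powr v * norm h ^ u)"
  proof (rule sum_mono)
    fix l :: "'d list" assume "l \<in> {l. length l = u}"
    then have l: "length l = u" by simp
    have "\<bar>F l (z + t *\<^sub>R h) - F l z\<bar> \<le> c * norm (z + t *\<^sub>R h - z) powr v"
      by (rule holder[OF l line[OF t] z])
    also have "\<dots> \<le> c * norm h powr v"
      using t c_nonneg v_pos by (intro mult_left_mono powr_mono2) (auto intro!: mult_left_le_one_le)
    finally show "\<bar>(F l (z + t *\<^sub>R h) - F l z) * coord_prod l h\<bar> \<le> c * norm h powr v * norm h ^ u"
      unfolding abs_mult using abs_coord_prod_le[of l h] c_nonneg l by (intro mult_mono) auto
  qed
  also have "\<dots> = real (card {l :: 'd list. length l = u}) * c * (norm h powr v * norm h ^ u)" by simp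
  also have "norm h powr v * norm h ^ u = norm h powr (v + real u)"
    using v_pos by (cases "h = 0") (simp_all add: powr_add powr_realpow)
  finally show ?thesis .
qed

lemma taylor_le:
  assumes z: "z \<in> unit_cube" and x: "x \<in> unit_cube"
  shows "\<bar>F [] x - coord_poly (Suc u) (\<lambda>l. F l z / fact (length l)) z x\<bar>
    \<le> real (card {l :: 'd list. length l = u}) * c * norm (x - z) powr (v + real u)"
proof -
  define h where "h = x - z"
  have line: "z + t *\<^sub>R h \<in> unit_cube" if "t \<in> {0..1}" for t
  proof -
    have "z + t *\<^sub>R h = (1 - t) *\<^sub>R z + t *\<^sub>R x" by (simp add: h_def algebra_simps)
    then show ?thesis
      using convexD_alt[OF convex_box(1) z[unfolded unit_cube_eq_cbox]
          x[unfolded unit_cube_eq_cbox], of t] that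
      by (simp add: unit_cube_eq_cbox)
  qed
  have "\<bar>line_deriv z h 0 1 - (\<Sum>k<Suc u. line_deriv z h k 0 / fact k)\<bar>
      \<le> real (card {l :: 'd list. length l = u}) * c * norm h powr (v + real u)"
    by (intro taylor_le_top_oscillation line_deriv_has_derivative line_deriv_top_oscillation line)
  moreover have "line_deriv z h 0 1 = F [] x" by (simp add: line_deriv_def h_def)
  moreover have "(\<Sum>k<Suc u. line_deriv z h k 0 / fact k)
      = coord_poly (Suc u) (\<lambda>l. F l z / fact (length l)) z x"
    unfolding coord_poly_def sum_lists_length_less
    by (intro sum.cong) (auto simp: line_deriv_def h_def sum_divide_distrib)
  ultimately show ?thesis by (simp add: h_def)
qed

lemma locally_poly_approx_partials:
  obtains B C where "B \<ge> 0" "C \<ge> 0" "locally_poly_approx (Suc u) B C (v + real u) (F [])"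
proof -
  obtain B where "B \<ge> 0" and B: "\<And>ds x. length ds \<le> u \<Longrightarrow> x \<in> unit_cube \<Longrightarrow> \<bar>F ds x\<bar> \<le> B"
    using partials_bounded by blast
  define C where "C = real (card {l :: 'd list. length l = u}) * c"
  have "\<exists>a. (\<forall>l. length l < Suc u \<longrightarrow> \<bar>a l\<bar> \<le> B) \<and> a [] = F [] z \<and>
      (\<forall>x\<in>unit_cube. \<bar>F [] x - coord_poly (Suc u) a z x\<bar> \<le> C * norm (x - z) powr (v + real u))"
    if z: "z \<in> unit_cube" for z
  proof (intro exI[of _ "\<lambda>l. F l z / fact (length l)"] conjI allI impI ballI)
    show "\<bar>F l z / fact (length l)\<bar> \<le> B" if "length l < Suc u" for l
    proof -
      have "\<bar>F l z / fact (length l)\<bar> \<le> \<bar>F l z\<bar> / 1"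
        unfolding abs_divide by (intro divide_left_mono) (auto simp: fact_ge_1)
      then show ?thesis using B[OF _ z, of l] that by simp
    qed
    show "\<bar>F [] x - coord_poly (Suc u) (\<lambda>l. F l z / fact (length l)) z x\<bar>
        \<le> C * norm (x - z) powr (v + real u)"
      if "x \<in> unit_cube" for x
      unfolding C_def by (rule taylor_le[OF z that])
  qed simp
  then have "locally_poly_approx (Suc u) B C (v + real u) (F [])" by (simp add: locally_poly_approx_def)
  moreover have "C \<ge> 0" using c_nonneg by (simp add: C_def)
  ultimately show ?thesis using that \<open>B \<ge> 0\<close> by blast
qed

end

lemma lip_class_iterated_partials:
  assumes "lip_class r c f" "r > 0" "c > 0"
  obtains F u where "real u < r" "iterated_partials F u c (r - real u)" "\<And>x. x \<in> unit_cube \<Longrightarrow> F [] x = f x"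
proof -
  define u where "u = nat (\<lceil>r\<rceil> - 1)"
  have "\<lceil>r\<rceil> \<ge> 1" using \<open>r > 0\<close> by simp
  then have "real u < r" unfolding u_def by (simp add: of_nat_nat) linarith
  moreover obtain F where "\<And>x. x \<in> unit_cube \<Longrightarrow> F [] x = f x" "iterated_partials F u c (r - real u)"
  proof -
    obtain F where F: "\<forall>x\<in>unit_cube. F [] x = f x"
      "\<forall>ds i. length ds < u \<longrightarrow> has_partial_on (F ds) i (F (i # ds)) unit_cube"
      "\<forall>ds. length ds = u \<longrightarrow> (\<forall>x\<in>unit_cube. \<forall>x'\<in>unit_cube.
         \<bar>F ds x - F ds x'\<bar> \<le> c * norm (x - x') powr (r - real u))"
      using assms(1) unfolding lip_class_def Let_def u_def[symmetric] has_partial_on_def[symmetric] by blast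
    then have "iterated_partials F u c (r - real u)"
      using \<open>real u < r\<close> \<open>c > 0\<close> by unfold_locales auto
    then show ?thesis using that F(1) by blast
  qed
  ultimately show ?thesis using that by blast
qed

lemma lip_class_continuous_on:
  assumes "lip_class r c f" "r > 0" "c > 0"
  shows "continuous_on unit_cube f"
proof -
  obtain F u where F: "iterated_partials F u c (r - real u)" "\<And>x. x \<in> unit_cube \<Longrightarrow> F [] x = f x"
    using lip_class_iterated_partials[OF assms] by metis
  show ?thesis
    using iterated_partials.continuous_on_partial[OF F(1), of "[]"] F(2)
      continuous_on_cong[of unit_cube unit_cube "F []" f] by simp
qed

lemma lip_class_locally_poly_approx:
  assumes "lip_class r c f" "r > 0" "c > 0"
  obtains n B C where "n > 0" "real n < r + 1" "B \<ge> 0" "C \<ge> 0" "locally_poly_approx n B C r f"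
proof -
  obtain F u where "real u < r" and F: "iterated_partials F u c (r - real u)"
    "\<And>x. x \<in> unit_cube \<Longrightarrow> F [] x = f x"
    using lip_class_iterated_partials[OF assms] by metis
  obtain B C where "B \<ge> 0" "C \<ge> 0" "locally_poly_approx (Suc u) B C r (F [])"
    using iterated_partials.locally_poly_approx_partials[OF F(1)] by (metis diff_add_cancel)
  moreover from this(3) have "locally_poly_approx (Suc u) B C r f"
    by (simp add: locally_poly_approx_def F(2))
  ultimately show ?thesis using that[of "Suc u" B C] \<open>real u < r\<close> by simp
qed

section \<open>Extension from the cube\<close>

lemma alternating_binomial_sum_Suc:
  fixes P :: "nat \<Rightarrow> 'a::comm_ring_1"
  shows "(\<Sum>k\<le>Suc s. (- 1) ^ k * of_nat (Suc s choose k) * P k)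
    = (\<Sum>k\<le>s. (- 1) ^ k * of_nat (s choose k) * (P k - P (Suc k)))"
proof -
  have "(\<Sum>k\<le>Suc s. (- 1) ^ k * of_nat (Suc s choose k) * P k)
      = P 0 + (\<Sum>k\<le>s. (- 1) ^ Suc k * of_nat (Suc s choose Suc k) * P (Suc k))"
    by (subst sum.atMost_Suc_shift) simp
  also have "(\<Sum>k\<le>s. (- 1) ^ Suc k * of_nat (Suc s choose Suc k) * P (Suc k))
      = (\<Sum>k\<le>s. (- 1) ^ Suc k * of_nat (s choose Suc k) * P (Suc k))
        - (\<Sum>k\<le>s. (- 1) ^ k * of_nat (s choose k) * P (Suc k))"
    unfolding sum_subtractf[symmetric] by (intro sum.cong refl) (simp add: algebra_simps)
  also have "P 0 + \<dots> = (\<Sum>k\<le>Suc s. (- 1) ^ k * of_nat (s choose k) * P k)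
      - (\<Sum>k\<le>s. (- 1) ^ k * of_nat (s choose k) * P (Suc k))"
    by (subst sum.atMost_Suc_shift) simp
  also have "\<dots> = (\<Sum>k\<le>s. (- 1) ^ k * of_nat (s choose k) * (P k - P (Suc k)))"
    by (simp add: binomial_eq_0 sum_subtractf right_diff_distrib)
  finally show ?thesis .
qed

lemma degree_diff_shift_less:
  fixes p :: "'a::idom poly"
  assumes "p - pcompose p [:1, 1:] \<noteq> 0"
  shows "degree (p - pcompose p [:1, 1:]) < degree p"
proof -
  have deg: "degree (pcompose p [:1, 1:]) = degree p" by (simp add: degree_pcompose)
  have "lead_coeff (pcompose p [:1, 1:]) = lead_coeff p"
    using lead_coeff_comp[of "[:1, 1:]" p] by simp
  then have "coeff (p - pcompose p [:1, 1:]) (degree p) = 0" by (simp add: deg)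
  then have "degree (p - pcompose p [:1, 1:]) \<noteq> degree p" using assms by (metis leading_coeff_0_iff)
  moreover have "degree (p - pcompose p [:1, 1:]) \<le> degree p" by (rule degree_diff_le) (auto simp: deg)
  ultimately show ?thesis by simp
qed

lemma alternating_binomial_sum_poly:
  fixes p :: "'a::idom poly"
  assumes "degree p < s"
  shows "(\<Sum>k\<le>s. (- 1) ^ k * of_nat (s choose k) * poly p (of_nat k)) = 0"
  using assms
proof (induction s arbitrary: p)
  case (Suc s)
  define q where "q = p - pcompose p [:1, 1:]"
  have "(\<Sum>k\<le>Suc s. (- 1) ^ k * of_nat (Suc s choose k) * poly p (of_nat k))
      = (\<Sum>k\<le>s. (- 1) ^ k * of_nat (s choose k) * poly q (of_nat k))"
    unfolding alternating_binomial_sum_Suc by (simp add: q_def poly_pcompose)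
  also have "\<dots> = 0"
  proof (cases "q = 0")
    case False
    then show ?thesis using degree_diff_shift_less[of p] Suc by (intro Suc.IH) (auto simp: q_def)
  qed simp
  finally show ?case .
qed simp

lemma coord_prod_line_eq_poly:
  fixes w h :: "real^'d"
  obtains p where "degree p \<le> length l" "\<And>t. poly p t = coord_prod l (w + t *\<^sub>R h)"
proof (induction l arbitrary: thesis)
  case Nil
  show ?case by (rule Nil[of 1]) auto
next
  case (Cons i l)
  obtain p where p: "degree p \<le> length l" "\<And>t. poly p t = coord_prod l (w + t *\<^sub>R h)" using Cons.IH by blast
  show ?case
  proof (rule Cons.prems[of "[:w $ i, h $ i:] * p"])
    have "degree ([:w $ i, h $ i:] * p) \<le> degree [:w $ i, h $ i:] + degree p" by (rule degree_mult_le)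
    also have "degree [:w $ i, h $ i:] \<le> 1" by simp
    finally show "degree ([:w $ i, h $ i:] * p) \<le> length (i # l)" using p by simp
  qed (simp add: p algebra_simps)
qed

definition fd_weight :: "nat \<Rightarrow> nat \<Rightarrow> real" where
  "fd_weight s k = (- 1) ^ Suc k * real (s choose k)"

lemma sum_fd_weight_coord_prod:
  fixes w h :: "real^'d"
  assumes "length l < s"
  shows "(\<Sum>k=1..s. fd_weight s k * coord_prod l (w + real k *\<^sub>R h)) = coord_prod l w"
proof -
  obtain p where p: "degree p \<le> length l" "\<And>t. poly p t = coord_prod l (w + t *\<^sub>R h)"
    using coord_prod_line_eq_poly[of l w h] by blast
  have "0 = (\<Sum>k\<le>s. (- 1) ^ k * real (s choose k) * poly p (real k))"
    using p assms by (intro alternating_binomial_sum_poly[symmetric]) simp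
  also have "\<dots> = poly p 0 - (\<Sum>k=1..s. fd_weight s k * poly p (real k))"
    unfolding atMost_atLeast0 by (subst sum.atLeast_Suc_atMost) (auto simp: fd_weight_def sum_negf)
  finally show ?thesis using p(2)[of 0] by (simp add: p(2))
qed

lemma sum_fd_weight_coord_poly:
  "(\<Sum>k=1..n. fd_weight n k * coord_poly n a z (w + real k *\<^sub>R h)) = coord_poly n a z w"
proof -
  have "(\<Sum>k=1..n. fd_weight n k * coord_poly n a z (w + real k *\<^sub>R h))
      = (\<Sum>l | length l < n. a l * (\<Sum>k=1..n. fd_weight n k * coord_prod l ((w - z) + real k *\<^sub>R h)))"
    unfolding coord_poly_def sum_distrib_left by (subst sum.swap) (simp add: algebra_simps)
  also have "\<dots> = coord_poly n a z w"
    unfolding coord_poly_def by (intro sum.cong) (auto simp: sum_fd_weight_coord_prod simp del: One_nat_def)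
  finally show ?thesis .
qed

lemma abs_sum_fd_weight_le:
  assumes "\<And>k. k \<in> {1..n} \<Longrightarrow> \<bar>f k\<bar> \<le> e"
  shows "\<bar>\<Sum>k=1..n. fd_weight n k * f k\<bar> \<le> (\<Sum>k=1..n. \<bar>fd_weight n k\<bar>) * e"
proof -
  have "\<bar>\<Sum>k=1..n. fd_weight n k * f k\<bar> \<le> (\<Sum>k=1..n. \<bar>fd_weight n k\<bar> * \<bar>f k\<bar>)"
    unfolding abs_mult[symmetric] by (rule sum_abs)
  also have "\<dots> \<le> (\<Sum>k=1..n. \<bar>fd_weight n k\<bar> * e)"
    using assms by (intro sum_mono mult_left_mono) auto
  finally show ?thesis by (simp add: sum_distrib_right)
qed

definition cube_proj :: "real^'d \<Rightarrow> real^'d" where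
  "cube_proj w = (\<chi> i. max 0 (min 1 (w $ i)))"

lemma norm_cube_proj_diff_le:
  assumes "x \<in> unit_cube"
  shows "norm (cube_proj w - w) \<le> norm (w - x)"
proof (rule norm_le_componentwise_cart)
  fix i
  have "0 \<le> x $ i" "x $ i \<le> 1" using assms by (auto simp: unit_cube_def)
  then show "norm ((cube_proj w - w) $ i) \<le> norm ((w - x) $ i)" by (auto simp: cube_proj_def)
qed

lemma borel_measurable_cube_proj [measurable]: "(cube_proj :: real^'d \<Rightarrow> real^'d) \<in> borel_measurable borel"
  unfolding cube_proj_def by (intro borel_measurable_continuous_onI continuous_intros)

definition ray_node :: "real^'d \<Rightarrow> nat \<Rightarrow> real^'d" where
  "ray_node w k = w + real k *\<^sub>R (cube_proj w - w)"

lemma borel_measurable_ray_node [measurable]: "(\<lambda>w :: real^'d. ray_node w k) \<in> borel_measurable borel"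
  unfolding ray_node_def by measurable

definition cube_collar :: "nat \<Rightarrow> (real^'d) set" where
  "cube_collar n = {w. \<forall>i. - 1 / real n \<le> w $ i \<and> w $ i \<le> 1 + 1 / real n}"

lemma cube_collar_eq_cbox: "cube_collar n = cbox (\<chi> i. - 1 / real n) (\<chi> i. 1 + 1 / real n)"
  by (auto simp: cube_collar_def mem_box_cart)

lemma borel_cube_collar [measurable]: "cube_collar n \<in> sets borel"
  by (simp add: cube_collar_eq_cbox)

lemma ray_node_component:
  "ray_node w k $ i = w $ i + real k * (max 0 (min 1 (w $ i)) - w $ i)"
  by (simp add: ray_node_def cube_proj_def)

lemma ray_node_in_unit_cube:
  assumes "w \<in> cube_collar n" and k: "k \<in> {1..n}"
  shows "ray_node w k \<in> unit_cube"
proof -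
  have "0 \<le> ray_node w k $ i \<and> ray_node w k $ i \<le> 1" for i
  proof -
    have collar: "- 1 / real n \<le> w $ i" "w $ i \<le> 1 + 1 / real n"
      using assms(1) by (auto simp: cube_collar_def)
    have overshoot: "0 \<le> (real k - 1) * t \<and> (real k - 1) * t \<le> 1" if "0 \<le> t" "t \<le> 1 / real n" for t
    proof -
      have "(real k - 1) * t \<le> real n * (1 / real n)" using that k by (intro mult_mono) auto
      then show ?thesis using that k by auto
    qed
    consider "w $ i < 0" | "0 \<le> w $ i" "w $ i \<le> 1" | "w $ i > 1" by linarith
    then show ?thesis
    proof cases
      assume "w $ i < 0"
      then have "ray_node w k $ i = (real k - 1) * (- w $ i)"
        by (simp add: ray_node_component algebra_simps)
      then show ?thesis using overshoot[of "- w $ i"] collar \<open>w $ i < 0\<close> by simp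
    next
      assume "w $ i > 1"
      then have "ray_node w k $ i = 1 - (real k - 1) * (w $ i - 1)"
        by (simp add: ray_node_component algebra_simps)
      then show ?thesis using overshoot[of "w $ i - 1"] collar \<open>w $ i > 1\<close> by simp
    qed (simp add: ray_node_component)
  qed
  then show ?thesis by (simp add: unit_cube_def)
qed

lemma norm_ray_node_diff_le:
  assumes "x \<in> unit_cube" "k \<le> n"
  shows "norm (ray_node w k - x) \<le> (1 + real n) * norm (w - x)"
proof -
  have "ray_node w k - x = (w - x) + real k *\<^sub>R (cube_proj w - w)" by (simp add: ray_node_def)
  then have "norm (ray_node w k - x) \<le> norm (w - x) + real k * norm (cube_proj w - w)"
    by (metis abs_of_nat norm_scaleR norm_triangle_ineq)
  also have "\<dots> \<le> norm (w - x) + real n * norm (w - x)"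
    using assms norm_cube_proj_diff_le by (intro add_left_mono mult_mono) auto
  finally show ?thesis by (simp add: distrib_right)
qed

text \<open>The extension extrapolates \<open>f\<close> along the ray from \<open>w\<close> through its projection to the cube. This
  reproduces polynomials, so it inherits the local polynomial approximation of \<open>f\<close>.\<close>

definition cube_ext :: "nat \<Rightarrow> (real^'d \<Rightarrow> real) \<Rightarrow> real^'d \<Rightarrow> real" where
  "cube_ext n f w = indicator (cube_collar n) w * (\<Sum>k=1..n. fd_weight n k * f (ray_node w k))"

lemma borel_measurable_cube_ext:
  fixes f :: "real^'d \<Rightarrow> real"
  assumes "continuous_on unit_cube f"
  shows "cube_ext n f \<in> borel_measurable borel"
proof -
  define f0 where "f0 x = indicator unit_cube x *\<^sub>R f x" for x
  have [measurable]: "f0 \<in> borel_measurable borel"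
    unfolding f0_def using assms by (intro borel_measurable_continuous_on_indicator) auto
  have "cube_ext n f w = indicator (cube_collar n) w * (\<Sum>k=1..n. fd_weight n k * f0 (ray_node w k))" for w
  proof (cases "w \<in> cube_collar n")
    case True
    then show ?thesis
      unfolding cube_ext_def f0_def
      by (intro arg_cong2[where f=times] sum.cong refl) (simp add: ray_node_in_unit_cube)
  qed (simp add: cube_ext_def)
  moreover have "(\<lambda>w. indicator (cube_collar n) w * (\<Sum>k=1..n. fd_weight n k * f0 (ray_node w k)))
      \<in> borel_measurable borel" by measurable
  ultimately show ?thesis by (simp cong: measurable_cong)
qed

lemma bounded_integrable_cube_ext:
  fixes f :: "real^'d \<Rightarrow> real"
  assumes "continuous_on unit_cube f"
  obtains M where "bounded_integrable (cube_ext n f) M"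
proof -
  obtain b where "b \<ge> 0" and b: "\<And>x. x \<in> unit_cube \<Longrightarrow> \<bar>f x\<bar> \<le> b"
    using continuous_on_unit_cube_bounded[OF assms] by blast
  define M where "M = (\<Sum>k=1..n. \<bar>fd_weight n k\<bar>) * b"
  have bound: "\<bar>cube_ext n f w\<bar> \<le> indicator (cube_collar n) w * M" for w
    using abs_sum_fd_weight_le[of n "\<lambda>k. f (ray_node w k)" b] b[OF ray_node_in_unit_cube]
    by (cases "w \<in> cube_collar n") (auto simp: cube_ext_def M_def)
  have "integrable lborel (\<lambda>w :: real^'d. indicator (cube_collar n) w * M)"
    unfolding cube_collar_eq_cbox
    by (intro integrable_mult_left integrable_real_indicator)
      (use emeasure_lborel_cbox_finite in \<open>auto simp: less_top[symmetric]\<close>)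
  then have "integrable lborel (cube_ext n f)"
    by (rule Bochner_Integration.integrable_bound)
      (use borel_measurable_cube_ext[OF assms] bound in \<open>auto intro: order.trans[OF _ abs_ge_self]\<close>)
  moreover have "\<bar>cube_ext n f w\<bar> \<le> M" for w
  proof -
    have "indicator (cube_collar n) w * M \<le> 1 * M"
      using \<open>b \<ge> 0\<close> by (intro mult_right_mono) (auto simp: M_def sum_nonneg)
    then show ?thesis using bound[of w] by simp
  qed
  ultimately have "bounded_integrable (cube_ext n f) M"
    using borel_measurable_cube_ext[OF assms] by unfold_locales
  then show ?thesis using that by blast
qed

lemma cube_ext_coord_poly_diff_le:
  fixes x w :: "real^'d"
  assumes x: "x \<in> unit_cube" and w: "w \<in> cube_collar n" and "r \<ge> 0" "C \<ge> 0"
    and approx: "\<And>y. y \<in> unit_cube \<Longrightarrow> \<bar>f y - coord_poly n a x y\<bar> \<le> C * norm (y - x) powr r"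
  shows "\<bar>cube_ext n f w - coord_poly n a x w\<bar>
    \<le> (\<Sum>k=1..n. \<bar>fd_weight n k\<bar>) * (C * (1 + real n) powr r) * norm (w - x) powr r"
proof -
  have "cube_ext n f w - coord_poly n a x w
      = (\<Sum>k=1..n. fd_weight n k * (f (ray_node w k) - coord_poly n a x (ray_node w k)))"
    unfolding sum_fd_weight_coord_poly[of n a x w "cube_proj w - w", symmetric] ray_node_def[symmetric]
    using w by (simp add: cube_ext_def sum_subtractf right_diff_distrib)
  moreover have "\<bar>f (ray_node w k) - coord_poly n a x (ray_node w k)\<bar>
      \<le> C * ((1 + real n) powr r * norm (w - x) powr r)" if "k \<in> {1..n}" for k
  proof -
    have "norm (ray_node w k - x) powr r \<le> ((1 + real n) * norm (w - x)) powr r"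
      using norm_ray_node_diff_le[OF x, of k n w] that \<open>r \<ge> 0\<close> by (intro powr_mono2) auto
    then have "C * norm (ray_node w k - x) powr r \<le> C * ((1 + real n) powr r * norm (w - x) powr r)"
      using \<open>C \<ge> 0\<close> by (intro mult_left_mono) (simp_all add: powr_mult)
    then show ?thesis using approx[OF ray_node_in_unit_cube[OF w that]] by linarith
  qed
  ultimately show ?thesis
    using abs_sum_fd_weight_le[of n "\<lambda>k. f (ray_node w k) - coord_poly n a x (ray_node w k)"]
    by (simp add: mult.assoc)
qed

lemma one_le_norm_diff_outside_collar:
  assumes "x \<in> unit_cube" "w \<notin> cube_collar n" "n > 0"
  shows "1 \<le> real n * norm (w - x)"
proof -
  obtain i where i: "w $ i < - 1 / real n \<or> w $ i > 1 + 1 / real n"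
    using assms(2) unfolding cube_collar_def by (auto simp: not_le)
  have "0 \<le> x $ i" "x $ i \<le> 1" using assms(1) by (auto simp: unit_cube_def)
  then have "1 / real n \<le> \<bar>(w - x) $ i\<bar>" using i by auto
  also have "\<dots> \<le> norm (w - x)" by (rule component_le_norm_cart)
  finally show ?thesis using \<open>n > 0\<close> by (simp add: field_simps)
qed

lemma coord_poly_le_outside_collar:
  fixes x w :: "real^'d"
  assumes "x \<in> unit_cube" "w \<notin> cube_collar n" and "n > 0" "real n < r + 1"
    and a: "\<And>l. length l < n \<Longrightarrow> \<bar>a l\<bar> \<le> B" and "B \<ge> 0"
  shows "\<bar>coord_poly n a x w\<bar>
    \<le> real (card {l :: 'd list. length l < n}) * B * real n powr r * norm (w - x) powr r"
proof -
  define y where "y = real n * norm (w - x)"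
  have "y \<ge> 1" unfolding y_def by (rule one_le_norm_diff_outside_collar[OF assms(1-3)])
  have "\<bar>coord_poly n a x w\<bar> \<le> (\<Sum>l | length l < n. \<bar>a l * coord_prod l (w - x)\<bar>)"
    unfolding coord_poly_def by (rule sum_abs)
  also have "\<dots> \<le> (\<Sum>l :: 'd list | length l < n. B * y powr r)"
  proof (rule sum_mono)
    fix l :: "'d list" assume "l \<in> {l. length l < n}"
    then have l: "length l < n" by simp
    have "\<bar>coord_prod l (w - x)\<bar> \<le> norm (w - x) ^ length l" by (rule abs_coord_prod_le)
    also have "\<dots> \<le> y ^ length l"
      using \<open>n > 0\<close> by (intro power_mono) (auto simp: y_def mult_le_cancel_right1)
    also have "\<dots> = y powr real (length l)" using \<open>y \<ge> 1\<close> by (subst powr_realpow) auto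
    also have "\<dots> \<le> y powr r" using \<open>y \<ge> 1\<close> l \<open>real n < r + 1\<close> by (intro powr_mono) linarith+
    finally show "\<bar>a l * coord_prod l (w - x)\<bar> \<le> B * y powr r"
      unfolding abs_mult using a[OF l] \<open>B \<ge> 0\<close> by (intro mult_mono) auto
  qed
  also have "\<dots> = real (card {l :: 'd list. length l < n}) * B * real n powr r * norm (w - x) powr r"
    by (simp add: y_def powr_mult)
  finally show ?thesis .
qed

lemma coord_poly_center:
  assumes "n > 0"
  shows "coord_poly n a z z = a []"
proof -
  have "coord_poly n a z z = (\<Sum>l :: 'a list | length l < n. if l = [] then a [] else 0)"
    unfolding coord_poly_def
  proof (intro sum.cong refl)
    show "a l * coord_prod l (z - z) = (if l = [] then a [] else 0)" for l by (cases l) auto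
  qed
  then show ?thesis using assms by simp
qed

lemma cube_ext_close_to_coord_poly:
  fixes f :: "real^'d \<Rightarrow> real"
  assumes "n > 0" "real n < r + 1" "r > 0" "B \<ge> 0" "C \<ge> 0"
  obtains K where "K \<ge> 0" "\<And>x a w. x \<in> unit_cube \<Longrightarrow> \<forall>l. length l < n \<longrightarrow> \<bar>a l\<bar> \<le> B \<Longrightarrow>
    \<forall>y\<in>unit_cube. \<bar>f y - coord_poly n a x y\<bar> \<le> C * norm (y - x) powr r \<Longrightarrow>
    \<bar>cube_ext n f w - coord_poly n a x w\<bar> \<le> K * norm (w - x) powr r"
proof -
  define Kin where "Kin = (\<Sum>k=1..n. \<bar>fd_weight n k\<bar>) * (C * (1 + real n) powr r)"
  define Kout where "Kout = real (card {l :: 'd list. length l < n}) * B * real n powr r"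
  have nonneg: "Kin \<ge> 0" "Kout \<ge> 0" using assms by (simp_all add: Kin_def Kout_def sum_nonneg)
  have "\<bar>cube_ext n f w - coord_poly n a x w\<bar> \<le> (Kin + Kout) * norm (w - x) powr r"
    if x: "x \<in> unit_cube" and a: "\<forall>l. length l < n \<longrightarrow> \<bar>a l\<bar> \<le> B"
      and approx: "\<forall>y\<in>unit_cube. \<bar>f y - coord_poly n a x y\<bar> \<le> C * norm (y - x) powr r" for x a w
  proof (cases "w \<in> cube_collar n")
    case True
    have "\<bar>cube_ext n f w - coord_poly n a x w\<bar> \<le> Kin * norm (w - x) powr r"
      unfolding Kin_def using assms approx by (intro cube_ext_coord_poly_diff_le x True) auto
    also have "\<dots> \<le> (Kin + Kout) * norm (w - x) powr r" using nonneg by (intro mult_right_mono) auto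
    finally show ?thesis .
  next
    case False
    then have "\<bar>cube_ext n f w - coord_poly n a x w\<bar> = \<bar>coord_poly n a x w\<bar>" by (simp add: cube_ext_def)
    also have "\<dots> \<le> Kout * norm (w - x) powr r"
      unfolding Kout_def using assms a by (intro coord_poly_le_outside_collar x False) auto
    also have "\<dots> \<le> (Kin + Kout) * norm (w - x) powr r" using nonneg by (intro mult_right_mono) auto
    finally show ?thesis .
  qed
  moreover have "Kin + Kout \<ge> 0" using nonneg by simp
  ultimately show ?thesis using that by blast
qed

lemma cube_ext_difference_bound:
  fixes f :: "real^'d \<Rightarrow> real"
  assumes approx: "locally_poly_approx n B C r f"
    and "n > 0" "real n < r + 1" "r > 0" "B \<ge> 0" "C \<ge> 0"
  obtains K where "K \<ge> 0" "\<And>x y. x \<in> unit_cube \<Longrightarrow>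
    \<bar>(\<Sum>j=1..n. fd_weight n j * cube_ext n f (x + real j *\<^sub>R y)) - f x\<bar> \<le> K * norm y powr r"
proof -
  obtain K where "K \<ge> 0" and K: "\<And>x a w. x \<in> unit_cube \<Longrightarrow> \<forall>l. length l < n \<longrightarrow> \<bar>a l\<bar> \<le> B \<Longrightarrow>
      \<forall>y\<in>unit_cube. \<bar>f y - coord_poly n a x y\<bar> \<le> C * norm (y - x) powr r \<Longrightarrow>
      \<bar>cube_ext n f w - coord_poly n a x w\<bar> \<le> K * norm (w - x) powr r"
    using cube_ext_close_to_coord_poly[OF assms(2-6)] by blast
  define W where "W = (\<Sum>k=1..n. \<bar>fd_weight n k\<bar>)"
  have "W \<ge> 0" by (simp add: W_def sum_nonneg)
  have "\<bar>(\<Sum>j=1..n. fd_weight n j * cube_ext n f (x + real j *\<^sub>R y)) - f x\<bar>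
      \<le> W * (K * real n powr r) * norm y powr r" if x: "x \<in> unit_cube" for x y
  proof -
    obtain a where a: "\<forall>l. length l < n \<longrightarrow> \<bar>a l\<bar> \<le> B" "a [] = f x"
      "\<forall>w\<in>unit_cube. \<bar>f w - coord_poly n a x w\<bar> \<le> C * norm (w - x) powr r"
      using approx x unfolding locally_poly_approx_def by blast
    have close: "\<bar>cube_ext n f (x + real j *\<^sub>R y) - coord_poly n a x (x + real j *\<^sub>R y)\<bar>
        \<le> K * (real n powr r * norm y powr r)" if "j \<in> {1..n}" for j
    proof -
      have "norm (x + real j *\<^sub>R y - x) powr r \<le> (real n * norm y) powr r"
        using that \<open>r > 0\<close> by (intro powr_mono2) (auto intro!: mult_right_mono)
      from mult_left_mono[OF this \<open>K \<ge> 0\<close>] show ?thesis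
        using K[OF x a(1,3), of "x + real j *\<^sub>R y"] by (simp add: powr_mult)
    qed
    have "f x = (\<Sum>j=1..n. fd_weight n j * coord_poly n a x (x + real j *\<^sub>R y))"
      by (simp add: sum_fd_weight_coord_poly coord_poly_center[OF \<open>n > 0\<close>] a(2) del: One_nat_def)
    then have "(\<Sum>j=1..n. fd_weight n j * cube_ext n f (x + real j *\<^sub>R y)) - f x
        = (\<Sum>j=1..n. fd_weight n j *
            (cube_ext n f (x + real j *\<^sub>R y) - coord_poly n a x (x + real j *\<^sub>R y)))"
      by (simp add: sum_subtractf right_diff_distrib)
    then show ?thesis
      using abs_sum_fd_weight_le[OF close] by (simp add: W_def mult_ac)
  qed
  moreover have "W * (K * real n powr r) \<ge> 0" using \<open>W \<ge> 0\<close> \<open>K \<ge> 0\<close> by simp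
  ultimately show ?thesis using that by blast
qed

lemma lip_class_kcomb_approximable:
  assumes "lip_class r c f" "r > 0" "c > 0"
  obtains K where "K > 0" "kcomb_approximable r K f"
proof -
  obtain n B C where n: "n > 0" "real n < r + 1" and "B \<ge> 0" "C \<ge> 0"
    and approx: "locally_poly_approx n B C r f"
    using lip_class_locally_poly_approx[OF assms] by blast
  obtain K where K: "K \<ge> 0" "\<And>x y. x \<in> unit_cube \<Longrightarrow>
      \<bar>(\<Sum>j=1..n. fd_weight n j * cube_ext n f (x + real j *\<^sub>R y)) - f x\<bar> \<le> K * norm y powr r"
    using cube_ext_difference_bound[OF approx n \<open>r > 0\<close> \<open>B \<ge> 0\<close> \<open>C \<ge> 0\<close>] by blast
  obtain M where "bounded_integrable (cube_ext n f) M"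
    using bounded_integrable_cube_ext[OF lip_class_continuous_on[OF assms]] by blast
  then interpret bounded_integrable "cube_ext n f" M .
  have "\<exists>K>0. kcomb_approximable r K f"
    by (rule kcomb_approximable_of_difference_bound[OF _ _ K]) (use n \<open>r > 0\<close> in auto)
  then show ?thesis using that by blast
qed

section \<open>Loss functions\<close>

definition clippable :: "(real \<Rightarrow> real) \<Rightarrow> bool" where
  "clippable \<phi> \<longleftrightarrow> continuous_on UNIV \<phi> \<and> (\<forall>u. 0 \<le> \<phi> u \<and> \<phi> (clip u) \<le> \<phi> u)"

lemma clippable_of_convex:
  assumes conv: "convex_on UNIV \<phi>" and nonneg: "\<And>u. 0 \<le> \<phi> u" and "\<phi> 1 = 0"
  shows "clippable \<phi>"
proof -
  have "\<phi> (clip u) \<le> \<phi> u" for u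
  proof (cases "u < - 1")
    case True
    define l where "l = 2 / (1 - u)"
    have l: "0 \<le> l" "l \<le> 1" using True by (auto simp: l_def)
    have "l * (1 - u) = 2" using True by (simp add: l_def divide_eq_eq)
    then have combination: "(1 - l) *\<^sub>R 1 + l *\<^sub>R u = - 1" by (simp add: algebra_simps)
    have "\<phi> (- 1) \<le> (1 - l) * \<phi> 1 + l * \<phi> u"
      using convex_onD[OF conv l, of 1 u] unfolding combination by simp
    also have "\<dots> \<le> \<phi> u" using \<open>\<phi> 1 = 0\<close> nonneg[of u] l by (simp add: mult_left_le_one_le)
    finally show ?thesis using True by (simp add: clip_def)
  next
    case False
    then show ?thesis using \<open>\<phi> 1 = 0\<close> nonneg[of u] by (cases "u \<le> 1") (simp_all add: clip_def)
  qed
  moreover have "continuous_on UNIV \<phi>" using conv by (intro convex_on_continuous) auto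
  ultimately show ?thesis using nonneg by (simp add: clippable_def)
qed

lemma convex_on_hinge_loss: "convex_on UNIV hinge_loss"
proof (rule convex_onI)
  fix t x y :: real assume t: "0 < t" "t < 1"
  have "(1 - t) * (1 - x) \<le> (1 - t) * hinge_loss x" "t * (1 - y) \<le> t * hinge_loss y"
    "0 \<le> (1 - t) * hinge_loss x" "0 \<le> t * hinge_loss y"
    using t by (auto simp: hinge_loss_def intro!: mult_left_mono mult_nonneg_nonneg)
  then show "hinge_loss ((1 - t) *\<^sub>R x + t *\<^sub>R y) \<le> (1 - t) * hinge_loss x + t * hinge_loss y"
    unfolding hinge_loss_def[of "(1 - t) *\<^sub>R x + t *\<^sub>R y"] by (auto simp: algebra_simps)
qed simp

lemma clippable_hinge_loss: "clippable hinge_loss"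
  by (rule clippable_of_convex[OF convex_on_hinge_loss]) (simp_all add: hinge_loss_def)

lemma clippable_classifying_loss: "classifying_loss \<phi> \<Longrightarrow> clippable \<phi>"
  by (rule clippable_of_convex) (auto simp: classifying_loss_def)

definition cond_minimizer :: "(real \<Rightarrow> real) \<Rightarrow> real \<Rightarrow> real \<Rightarrow> bool" where
  "cond_minimizer \<phi> e s \<longleftrightarrow> (\<forall>t. cond_phi_risk \<phi> e s \<le> cond_phi_risk \<phi> e t)"

definition cond_excess :: "(real \<Rightarrow> real) \<Rightarrow> real \<Rightarrow> real \<Rightarrow> real \<Rightarrow> real" where
  "cond_excess \<phi> e t s = cond_phi_risk \<phi> e t - cond_phi_risk \<phi> e s"

definition cond_square_gap :: "(real \<Rightarrow> real) \<Rightarrow> real \<Rightarrow> real \<Rightarrow> real \<Rightarrow> real" where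
  "cond_square_gap \<phi> e t s = e * (\<phi> t - \<phi> s)\<^sup>2 + (1 - e) * (\<phi> (- t) - \<phi> (- s))\<^sup>2"

definition wrong_side :: "real \<Rightarrow> real \<Rightarrow> bool" where
  "wrong_side e t \<longleftrightarrow> 0 \<le> t \<and> e < 1 / 2 \<or> t < 0 \<and> 1 / 2 \<le> e"

lemma cond_excess_nonneg: "cond_minimizer \<phi> e s \<Longrightarrow> cond_excess \<phi> e t s \<ge> 0"
  by (simp add: cond_minimizer_def cond_excess_def)

lemma wrong_side_mult_nonpos: "wrong_side e t \<Longrightarrow> (2 * e - 1) * t \<le> 0"
  by (auto simp: wrong_side_def intro: mult_nonpos_nonneg mult_nonneg_nonpos)

definition excess_upper_bounded :: "(real \<Rightarrow> real) \<Rightarrow> nat \<Rightarrow> real \<Rightarrow> real \<Rightarrow> bool" where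
  "excess_upper_bounded \<phi> p M U \<longleftrightarrow> (\<forall>e\<in>{0..1}. \<forall>s\<in>{- M..M}. \<forall>t\<in>{- M..M}. cond_minimizer \<phi> e s \<longrightarrow>
     cond_excess \<phi> e t s \<le> U * \<bar>t - s\<bar> ^ p)"

definition variance_bounded :: "(real \<Rightarrow> real) \<Rightarrow> nat \<Rightarrow> real \<Rightarrow> real \<Rightarrow> bool" where
  "variance_bounded \<phi> p M V \<longleftrightarrow> (\<forall>e\<in>{0..1}. \<forall>s\<in>{- M..M}. \<forall>t\<in>{- M..M}. cond_minimizer \<phi> e s \<longrightarrow>
     cond_square_gap \<phi> e t s \<le> V * cond_excess \<phi> e t s ^ (p - 1))"

definition calibrated :: "(real \<Rightarrow> real) \<Rightarrow> nat \<Rightarrow> real \<Rightarrow> bool" where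
  "calibrated \<phi> p U \<longleftrightarrow> (\<forall>e\<in>{0..1}. \<forall>s. \<forall>t\<in>{- 1..1}. cond_minimizer \<phi> e s \<longrightarrow> wrong_side e t \<longrightarrow>
     \<bar>2 * e - 1\<bar> ^ p \<le> U * cond_excess \<phi> e t s)"

text \<open>The hinge loss satisfies this with \<open>p = 1\<close>, where the variance bound only says that the gap is
  bounded, and the twice smooth losses with \<open>p = 2\<close>.\<close>

definition loss_bounds :: "(real \<Rightarrow> real) \<Rightarrow> nat \<Rightarrow> real \<Rightarrow> real \<Rightarrow> real \<Rightarrow> real \<Rightarrow> bool" where
  "loss_bounds \<phi> p M \<Lambda> U V \<longleftrightarrow> \<Lambda>-lipschitz_on {- M..M} \<phi> \<and>
     excess_upper_bounded \<phi> p M U \<and> variance_bounded \<phi> p M V \<and> calibrated \<phi> p U"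

lemma cond_square_gap_le_of_lipschitz:
  assumes lipschitz: "\<Lambda>-lipschitz_on {- M..M} \<phi>" and "e \<in> {0..1}" "s \<in> {- M..M}" "t \<in> {- M..M}"
  shows "cond_square_gap \<phi> e t s \<le> \<Lambda>\<^sup>2 * (t - s)\<^sup>2"
proof -
  have square_le: "(\<phi> u - \<phi> v)\<^sup>2 \<le> \<Lambda>\<^sup>2 * (u - v)\<^sup>2" if "u \<in> {- M..M}" "v \<in> {- M..M}" for u v
    using power_mono[OF lipschitz_onD[OF lipschitz that] zero_le_dist, of 2]
    by (simp add: dist_real_def power_mult_distrib)
  have "cond_square_gap \<phi> e t s \<le> e * (\<Lambda>\<^sup>2 * (t - s)\<^sup>2) + (1 - e) * (\<Lambda>\<^sup>2 * (- t - - s)\<^sup>2)"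
    unfolding cond_square_gap_def using assms by (intro add_mono mult_left_mono square_le) auto
  also have "\<dots> = \<Lambda>\<^sup>2 * (t - s)\<^sup>2" by (simp add: algebra_simps power2_eq_square)
  finally show ?thesis .
qed

lemma excess_upper_bounded_of_lipschitz:
  assumes lipschitz: "\<Lambda>-lipschitz_on {- M..M} \<phi>"
  shows "excess_upper_bounded \<phi> 1 M \<Lambda>"
  unfolding excess_upper_bounded_def
proof (intro ballI impI)
  fix e s t :: real assume e: "e \<in> {0..1}" and st: "s \<in> {- M..M}" "t \<in> {- M..M}"
  have "cond_excess \<phi> e t s = e * (\<phi> t - \<phi> s) + (1 - e) * (\<phi> (- t) - \<phi> (- s))"
    by (simp add: cond_excess_def cond_phi_risk_def algebra_simps)
  also have "\<dots> \<le> e * (\<Lambda> * \<bar>t - s\<bar>) + (1 - e) * (\<Lambda> * \<bar>t - s\<bar>)"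
    using e st lipschitz_onD[OF lipschitz, of t s] lipschitz_onD[OF lipschitz, of "- t" "- s"]
    by (intro add_mono mult_left_mono) (auto simp: dist_real_def abs_minus_commute[of s])
  finally show "cond_excess \<phi> e t s \<le> \<Lambda> * \<bar>t - s\<bar> ^ 1" by (simp add: algebra_simps)
qed

lemma variance_bounded_of_lipschitz:
  assumes lipschitz: "\<Lambda>-lipschitz_on {- M..M} \<phi>"
  shows "variance_bounded \<phi> 1 M ((\<Lambda> * (2 * M))\<^sup>2)"
  unfolding variance_bounded_def
proof (intro ballI impI)
  fix e s t :: real assume assms: "e \<in> {0..1}" "s \<in> {- M..M}" "t \<in> {- M..M}"
  have "\<bar>t - s\<bar>\<^sup>2 \<le> (2 * M)\<^sup>2" using assms by (intro power_mono) auto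
  then have "\<Lambda>\<^sup>2 * (t - s)\<^sup>2 \<le> (\<Lambda> * (2 * M))\<^sup>2" by (simp add: power_mult_distrib mult_left_mono)
  then show "cond_square_gap \<phi> e t s \<le> (\<Lambda> * (2 * M))\<^sup>2 * cond_excess \<phi> e t s ^ (1 - 1)"
    using cond_square_gap_le_of_lipschitz[OF lipschitz assms] by simp
qed

lemma lipschitz_on_hinge_loss: "1-lipschitz_on S hinge_loss"
  by (rule lipschitz_onI) (simp_all add: hinge_loss_def dist_real_def)

lemma calibrated_hinge_loss: "calibrated hinge_loss 1 1"
  unfolding calibrated_def
proof (intro ballI allI impI)
  fix e s t :: real assume t: "t \<in> {- 1..1}" and min: "cond_minimizer hinge_loss e s"
    and wrong: "wrong_side e t"
  have "cond_phi_risk hinge_loss e t = 1 - (2 * e - 1) * t"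
    using t by (simp add: cond_phi_risk_def hinge_loss_def algebra_simps)
  moreover have "cond_phi_risk hinge_loss e s \<le> 2 * e" "cond_phi_risk hinge_loss e s \<le> 2 * (1 - e)"
    using min[unfolded cond_minimizer_def, rule_format, of "- 1"]
      min[unfolded cond_minimizer_def, rule_format, of 1]
    by (simp_all add: cond_phi_risk_def hinge_loss_def)
  ultimately show "\<bar>2 * e - 1\<bar> ^ 1 \<le> 1 * cond_excess hinge_loss e t s"
    using wrong_side_mult_nonpos[OF wrong] by (simp add: cond_excess_def abs_if)
qed

lemma loss_bounds_hinge_loss: "loss_bounds hinge_loss 1 M 1 1 ((2 * M)\<^sup>2)"
  using excess_upper_bounded_of_lipschitz[OF lipschitz_on_hinge_loss]
    variance_bounded_of_lipschitz[OF lipschitz_on_hinge_loss] calibrated_hinge_loss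
  by (simp add: loss_bounds_def lipschitz_on_hinge_loss)

lemma lipschitz_derivative_remainder_le:
  fixes \<phi> \<phi>' :: "real \<Rightarrow> real"
  assumes deriv: "\<And>u. (\<phi> has_real_derivative \<phi>' u) (at u)" and lipschitz: "L-lipschitz_on UNIV \<phi>'"
  shows "\<bar>\<phi> t - \<phi> s - \<phi>' s * (t - s)\<bar> \<le> L * (t - s)\<^sup>2"
proof -
  define p where "p u = \<phi> u - \<phi>' s * u" for u
  have "norm (p t - p s) \<le> (L * \<bar>t - s\<bar>) * norm (t - s)"
  proof (rule field_differentiable_bound[of "closed_segment s t"])
    fix u assume u: "u \<in> closed_segment s t"
    show "(p has_field_derivative \<phi>' u - \<phi>' s) (at u within closed_segment s t)"
      unfolding p_def by (auto intro!: derivative_eq_intros has_field_derivative_at_within[OF deriv])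
    have "\<bar>u - s\<bar> \<le> \<bar>t - s\<bar>" using u by (auto simp: closed_segment_eq_real_ivl split: if_splits)
    then have "L * \<bar>u - s\<bar> \<le> L * \<bar>t - s\<bar>"
      by (rule mult_left_mono) (rule lipschitz_on_nonneg[OF lipschitz])
    then show "norm (\<phi>' u - \<phi>' s) \<le> L * \<bar>t - s\<bar>"
      using lipschitz_onD[OF lipschitz, of u s] by (simp add: dist_real_def)
  qed auto
  also have "\<dots> = L * (t - s)\<^sup>2" by (simp add: power2_eq_square abs_mult_self_eq mult.assoc)
  finally show ?thesis by (simp add: p_def algebra_simps)
qed

lemma modulus_of_convexity_le:
  assumes "convex_on UNIV \<phi>"
  shows "modulus_of_convexity \<phi> \<bar>u - v\<bar> \<le> (\<phi> u + \<phi> v) / 2 - \<phi> ((u + v) / 2)"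
  unfolding modulus_of_convexity_def
proof (rule cInf_lower)
  have "0 \<le> (\<phi> u' + \<phi> v') / 2 - \<phi> ((u' + v') / 2)" for u' v'
    using convex_onD[OF assms, of "1 / 2" u' v'] by (simp add: add_divide_distrib)
  then show "bdd_below {(\<phi> u' + \<phi> v') / 2 - \<phi> ((u' + v') / 2) |u' v'. \<bar>u - v\<bar> \<le> \<bar>u' - v'\<bar>}"
    by (intro bdd_belowI[of _ 0]) blast
qed blast

locale smooth_loss =
  fixes \<phi> \<phi>' :: "real \<Rightarrow> real" and L \<mu> :: real
  assumes convex: "convex_on UNIV \<phi>"
    and deriv: "\<And>u. (\<phi> has_real_derivative \<phi>' u) (at u)"
    and lipschitz_deriv: "L-lipschitz_on UNIV \<phi>'" and L_pos: "L > 0"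
    and strongly_convex: "\<mu> * (u - v)\<^sup>2 \<le> (\<phi> u + \<phi> v) / 2 - \<phi> ((u + v) / 2)" and \<mu>_pos: "\<mu> > 0"
    and deriv_0_neg: "\<phi>' 0 < 0"
begin

lemma lipschitz_on_interval:
  assumes "M \<ge> 0"
  shows "(\<bar>\<phi>' 0\<bar> + L * M)-lipschitz_on {- M..M} \<phi>"
proof (rule lipschitz_onI)
  fix u v assume uv: "u \<in> {- M..M}" "v \<in> {- M..M}"
  have "norm (\<phi> u - \<phi> v) \<le> (\<bar>\<phi>' 0\<bar> + L * M) * norm (u - v)"
  proof (rule field_differentiable_bound[of "{- M..M}"])
    fix w assume w: "w \<in> {- M..M}"
    show "(\<phi> has_field_derivative \<phi>' w) (at w within {- M..M})"
      by (rule has_field_derivative_at_within[OF deriv])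
    have "L * \<bar>w\<bar> \<le> L * M" using w L_pos by (intro mult_left_mono) auto
    then show "norm (\<phi>' w) \<le> \<bar>\<phi>' 0\<bar> + L * M"
      using lipschitz_onD[OF lipschitz_deriv, of w 0] by (simp add: dist_real_def)
  qed (use uv in auto)
  then show "dist (\<phi> u) (\<phi> v) \<le> (\<bar>\<phi>' 0\<bar> + L * M) * dist u v" by (simp add: dist_norm)
qed (use L_pos assms in simp)

lemma cond_minimizer_stationary:
  assumes "cond_minimizer \<phi> e s"
  shows "e * \<phi>' s = (1 - e) * \<phi>' (- s)"
proof -
  have "((\<lambda>t. \<phi> (- t)) has_real_derivative \<phi>' (- s) * (- 1)) (at s)"
    by (rule DERIV_chain2[where g="\<lambda>t. - t"]) (auto intro!: derivative_eq_intros deriv)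
  then have "(cond_phi_risk \<phi> e has_real_derivative e * \<phi>' s + (1 - e) * (\<phi>' (- s) * (- 1))) (at s)"
    unfolding cond_phi_risk_def[abs_def] by (intro DERIV_add DERIV_cmult deriv)
  then have "e * \<phi>' s + (1 - e) * (\<phi>' (- s) * (- 1)) = 0"
    by (rule DERIV_local_min[of _ _ _ 1]) (use assms in \<open>auto simp: cond_minimizer_def\<close>)
  then show ?thesis by simp
qed

lemma excess_upper_bounded: "excess_upper_bounded \<phi> 2 M L"
  unfolding excess_upper_bounded_def
proof (intro ballI impI)
  fix e s t :: real assume e: "e \<in> {0..1}" and min: "cond_minimizer \<phi> e s"
  have remainder_le: "\<phi> u - \<phi> v - \<phi>' v * (u - v) \<le> L * (u - v)\<^sup>2" for u v
    using lipschitz_derivative_remainder_le[OF deriv lipschitz_deriv, of u v] by linarith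
  have "cond_excess \<phi> e t s
      = e * (\<phi> t - \<phi> s - \<phi>' s * (t - s)) + (1 - e) * (\<phi> (- t) - \<phi> (- s) - \<phi>' (- s) * (- t - - s))
      + (e * \<phi>' s - (1 - e) * \<phi>' (- s)) * (t - s)"
    by (simp add: cond_excess_def cond_phi_risk_def algebra_simps)
  also have "\<dots> \<le> e * (L * (t - s)\<^sup>2) + (1 - e) * (L * (- t - - s)\<^sup>2) + 0"
    using e cond_minimizer_stationary[OF min] by (intro add_mono mult_left_mono remainder_le) auto
  also have "\<dots> = L * \<bar>t - s\<bar>\<^sup>2" by (simp add: algebra_simps power2_eq_square)
  finally show "cond_excess \<phi> e t s \<le> L * \<bar>t - s\<bar>\<^sup>2" .
qed

lemma cond_excess_strongly_convex:
  assumes e: "e \<in> {0..1}" and min: "cond_minimizer \<phi> e s"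
  shows "2 * \<mu> * (t - s)\<^sup>2 \<le> cond_excess \<phi> e t s"
proof -
  have "- ((t + s) / 2) = (- t + - s) / 2" by (simp add: field_simps)
  then have "cond_phi_risk \<phi> e s \<le> e * \<phi> ((t + s) / 2) + (1 - e) * \<phi> ((- t + - s) / 2)"
    using min by (metis cond_minimizer_def cond_phi_risk_def)
  also have "\<dots> \<le> e * ((\<phi> t + \<phi> s) / 2 - \<mu> * (t - s)\<^sup>2)
      + (1 - e) * ((\<phi> (- t) + \<phi> (- s)) / 2 - \<mu> * (- t - - s)\<^sup>2)"
    using strongly_convex[of t s] strongly_convex[of "- t" "- s"] e by (intro add_mono mult_left_mono) auto
  also have "\<dots> = (cond_phi_risk \<phi> e t + cond_phi_risk \<phi> e s) / 2 - \<mu> * (t - s)\<^sup>2"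
    by (simp add: cond_phi_risk_def field_simps power2_eq_square)
  finally show ?thesis by (simp add: cond_excess_def field_simps)
qed

lemma variance_bounded:
  assumes "M \<ge> 0"
  shows "variance_bounded \<phi> 2 M ((\<bar>\<phi>' 0\<bar> + L * M)\<^sup>2 / (2 * \<mu>))"
  unfolding variance_bounded_def
proof (intro ballI impI)
  fix e s t :: real
  assume e: "e \<in> {0..1}" and st: "s \<in> {- M..M}" "t \<in> {- M..M}" and min: "cond_minimizer \<phi> e s"
  have "cond_square_gap \<phi> e t s \<le> (\<bar>\<phi>' 0\<bar> + L * M)\<^sup>2 * (t - s)\<^sup>2"
    by (rule cond_square_gap_le_of_lipschitz[OF lipschitz_on_interval[OF assms] e st])
  also have "(t - s)\<^sup>2 \<le> cond_excess \<phi> e t s / (2 * \<mu>)"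
    using cond_excess_strongly_convex[OF e min] \<mu>_pos by (simp add: field_simps)
  finally show "cond_square_gap \<phi> e t s \<le> (\<bar>\<phi>' 0\<bar> + L * M)\<^sup>2 / (2 * \<mu>) * cond_excess \<phi> e t s ^ (2 - 1)"
    by (simp add: mult_left_mono)
qed

text \<open>The tangent at \<open>0\<close> bounds the risk at a point on the wrong side from below by \<open>\<phi> 0\<close>, while the
  quadratic upper bound at \<open>0\<close> puts the minimal risk below \<open>\<phi> 0\<close> by a multiple of \<open>(2 * e - 1)\<^sup>2\<close>.\<close>

lemma cond_phi_risk_wrong_side_ge:
  assumes e: "e \<in> {0..1}" and wrong: "wrong_side e t"
  shows "\<phi> 0 \<le> cond_phi_risk \<phi> e t"
proof -
  have tangent: "\<phi> 0 + \<phi>' 0 * t \<le> \<phi> t" for t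
    using convex_on_imp_above_tangent[OF convex, of 0 t "\<phi>' 0"] deriv[of 0] by (simp add: algebra_simps)
  have "0 \<le> \<phi>' 0 * ((2 * e - 1) * t)"
    using deriv_0_neg wrong_side_mult_nonpos[OF wrong] by (intro mult_nonpos_nonpos) auto
  then have "\<phi> 0 \<le> e * (\<phi> 0 + \<phi>' 0 * t) + (1 - e) * (\<phi> 0 + \<phi>' 0 * (- t))"
    by (simp add: algebra_simps)
  also have "\<dots> \<le> cond_phi_risk \<phi> e t"
    unfolding cond_phi_risk_def using e tangent[of t] tangent[of "- t"]
    by (intro add_mono mult_left_mono) auto
  finally show ?thesis .
qed

lemma cond_phi_risk_minimum_le:
  assumes e: "e \<in> {0..1}" and min: "cond_minimizer \<phi> e s"
  shows "cond_phi_risk \<phi> e s \<le> \<phi> 0 - ((2 * e - 1) * \<phi>' 0)\<^sup>2 / (4 * L)"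
proof -
  define g where "g = (2 * e - 1) * \<phi>' 0"
  define t where "t = - g / (2 * L)"
  have quadratic: "\<phi> u \<le> \<phi> 0 + \<phi>' 0 * u + L * u\<^sup>2" for u
    using lipschitz_derivative_remainder_le[OF deriv lipschitz_deriv, of u 0] by simp
  have "cond_phi_risk \<phi> e s \<le> cond_phi_risk \<phi> e t" using min by (simp add: cond_minimizer_def)
  also have "\<dots> \<le> e * (\<phi> 0 + \<phi>' 0 * t + L * t\<^sup>2) + (1 - e) * (\<phi> 0 + \<phi>' 0 * (- t) + L * (- t)\<^sup>2)"
    unfolding cond_phi_risk_def using e by (intro add_mono mult_left_mono quadratic) auto
  also have "\<dots> = \<phi> 0 + g * t + L * t\<^sup>2" by (simp add: g_def algebra_simps)
  also have "\<dots> = \<phi> 0 - g\<^sup>2 / (4 * L)"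
    using L_pos by (simp add: t_def field_simps power2_eq_square)
  finally show ?thesis by (simp add: g_def)
qed

lemma calibrated: "calibrated \<phi> 2 (4 * L / (\<phi>' 0)\<^sup>2)"
  unfolding calibrated_def
proof (intro ballI allI impI)
  fix e s t :: real assume e: "e \<in> {0..1}" and min: "cond_minimizer \<phi> e s" and wrong: "wrong_side e t"
  have "((2 * e - 1) * \<phi>' 0)\<^sup>2 / (4 * L) \<le> cond_excess \<phi> e t s"
    using cond_phi_risk_wrong_side_ge[OF e wrong] cond_phi_risk_minimum_le[OF e min]
    by (simp add: cond_excess_def)
  then have "4 * L / (\<phi>' 0)\<^sup>2 * (((2 * e - 1) * \<phi>' 0)\<^sup>2 / (4 * L)) \<le> 4 * L / (\<phi>' 0)\<^sup>2 * cond_excess \<phi> e t s"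
    using L_pos by (intro mult_left_mono) auto
  then show "\<bar>2 * e - 1\<bar> ^ 2 \<le> 4 * L / (\<phi>' 0)\<^sup>2 * cond_excess \<phi> e t s"
    using L_pos deriv_0_neg by (simp add: power_mult_distrib)
qed

lemma loss_bounds:
  assumes "M \<ge> 0"
  shows "loss_bounds \<phi> 2 M (\<bar>\<phi>' 0\<bar> + L * M) (L + 4 * L / (\<phi>' 0)\<^sup>2) ((\<bar>\<phi>' 0\<bar> + L * M)\<^sup>2 / (2 * \<mu>))"
proof -
  have "L * \<bar>t - s\<bar> ^ 2 \<le> (L + 4 * L / (\<phi>' 0)\<^sup>2) * \<bar>t - s\<bar> ^ 2" for t s
    using L_pos by (intro mult_right_mono) auto
  then have "excess_upper_bounded \<phi> 2 M (L + 4 * L / (\<phi>' 0)\<^sup>2)"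
    using excess_upper_bounded[of M] unfolding excess_upper_bounded_def by (meson order.trans)
  moreover have "4 * L / (\<phi>' 0)\<^sup>2 * cond_excess \<phi> e t s \<le> (L + 4 * L / (\<phi>' 0)\<^sup>2) * cond_excess \<phi> e t s"
    if "cond_minimizer \<phi> e s" for e s t
    using L_pos cond_excess_nonneg[OF that] by (intro mult_right_mono) auto
  then have "calibrated \<phi> 2 (L + 4 * L / (\<phi>' 0)\<^sup>2)"
    using calibrated unfolding calibrated_def by (meson order.trans)
  ultimately show ?thesis
    using lipschitz_on_interval[OF assms] variance_bounded[OF assms] by (simp add: loss_bounds_def)
qed

end

lemma twice_smooth_classifying_loss_smooth_loss:
  assumes "twice_smooth_classifying_loss \<phi>"
  obtains \<phi>' L \<mu> where "smooth_loss \<phi> \<phi>' L \<mu>"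
proof -
  have convex: "convex_on UNIV \<phi>" and "deriv \<phi> 0 < 0"
    using assms by (auto simp: twice_smooth_classifying_loss_def classifying_loss_def)
  obtain \<phi>' L where deriv: "\<And>u. (\<phi> has_real_derivative \<phi>' u) (at u)" and "L > 0"
    and L: "\<And>u v. \<bar>\<phi>' u - \<phi>' v\<bar> \<le> L * \<bar>u - v\<bar>"
    using assms unfolding twice_smooth_classifying_loss_def by blast
  obtain \<mu> where "\<mu> > 0" and \<mu>: "\<And>\<epsilon>. \<epsilon> > 0 \<Longrightarrow> modulus_of_convexity \<phi> \<epsilon> \<ge> \<mu> * \<epsilon>\<^sup>2"
    using assms unfolding twice_smooth_classifying_loss_def by blast
  have "\<mu> * (u - v)\<^sup>2 \<le> (\<phi> u + \<phi> v) / 2 - \<phi> ((u + v) / 2)" for u v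
    using modulus_of_convexity_le[OF convex, of u v] \<mu>[of "\<bar>u - v\<bar>"] by (cases "u = v") auto
  moreover have "L-lipschitz_on UNIV \<phi>'"
    using L \<open>L > 0\<close> by (intro lipschitz_onI) (auto simp: dist_real_def)
  moreover have "\<phi>' 0 < 0" using \<open>deriv \<phi> 0 < 0\<close> DERIV_imp_deriv[OF deriv[of 0]] by simp
  ultimately have "smooth_loss \<phi> \<phi>' L \<mu>"
    using convex deriv \<open>L > 0\<close> \<open>\<mu> > 0\<close> by unfold_locales
  then show ?thesis using that by blast
qed

lemma loss_bounds_exist:
  assumes "\<phi> = hinge_loss \<or> twice_smooth_classifying_loss \<phi>" and "M \<ge> 1"
  obtains p \<Lambda> U V where "p = 1 \<or> p = 2" "\<Lambda> > 0" "U > 0" "V > 0" "loss_bounds \<phi> p M \<Lambda> U V"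
  using assms(1)
proof
  assume "\<phi> = hinge_loss"
  then show ?thesis using that[of 1 1 1 "(2 * M)\<^sup>2"] loss_bounds_hinge_loss \<open>M \<ge> 1\<close> by simp
next
  assume "twice_smooth_classifying_loss \<phi>"
  then obtain \<phi>' L \<mu> where "smooth_loss \<phi> \<phi>' L \<mu>" by (rule twice_smooth_classifying_loss_smooth_loss)
  then interpret smooth_loss \<phi> \<phi>' L \<mu> .
  have \<Lambda>_pos: "\<bar>\<phi>' 0\<bar> + L * M > 0" using L_pos \<open>M \<ge> 1\<close> by (simp add: add_nonneg_pos)
  moreover have "L + 4 * L / (\<phi>' 0)\<^sup>2 > 0" using L_pos by (simp add: add_pos_nonneg)
  moreover have "(\<bar>\<phi>' 0\<bar> + L * M)\<^sup>2 / (2 * \<mu>) > 0"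
    using \<Lambda>_pos \<mu>_pos by (intro divide_pos_pos zero_less_power) auto
  ultimately show ?thesis using that[of 2] loss_bounds[of M] \<open>M \<ge> 1\<close> by simp
qed

lemma clippable_loss:
  "\<phi> = hinge_loss \<or> twice_smooth_classifying_loss \<phi> \<Longrightarrow> clippable \<phi>"
  using clippable_hinge_loss clippable_classifying_loss by (auto simp: twice_smooth_classifying_loss_def)

section \<open>Concentration of empirical means\<close>

lemma exp_le_quadratic:
  fixes x :: real
  assumes "\<bar>x\<bar> \<le> 1"
  shows "exp x \<le> 1 + x + x\<^sup>2"
proof (cases "x \<ge> 0")
  case True
  then show ?thesis using exp_bound[of x] assms by simp
next
  case False
  define y where "y = - x"
  have y: "0 < y" "y \<le> 1" using False assms by (auto simp: y_def)
  have "1 \<le> 1 + y ^ 3" using y by simp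
  also have "\<dots> = (1 - y + y\<^sup>2) * (1 + y)" by (simp add: algebra_simps power2_eq_square power3_eq_cube)
  also have "\<dots> \<le> (1 - y + y\<^sup>2) * exp y"
    using y exp_ge_add_one_self[of y] by (intro mult_left_mono) auto
  finally have "exp (- y) \<le> 1 - y + y\<^sup>2" by (simp add: exp_minus field_simps)
  then show ?thesis by (simp add: y_def)
qed

definition empirical_mean :: "nat \<Rightarrow> ('a \<Rightarrow> real) \<Rightarrow> (nat \<Rightarrow> 'a) \<Rightarrow> real" where
  "empirical_mean m G D = 1 / real m * (\<Sum>i<m. G (D i))"

lemma borel_measurable_empirical_mean [measurable]:
  assumes [measurable]: "G \<in> borel_measurable M"
  shows "empirical_mean m G \<in> borel_measurable (PiM {..<m} (\<lambda>_. M))"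
  unfolding empirical_mean_def by measurable

lemma empirical_mean_mono:
  assumes "\<And>i. i < m \<Longrightarrow> G (D i) \<le> H (D i)"
  shows "empirical_mean m G D \<le> empirical_mean m H D"
  unfolding empirical_mean_def using assms by (intro mult_left_mono sum_mono) auto

lemma empirical_mean_add_const:
  assumes "m \<ge> 1"
  shows "empirical_mean m (\<lambda>z. G z + c) D = empirical_mean m G D + c"
  using assms by (simp add: empirical_mean_def sum.distrib distrib_left)

lemma empirical_mean_uminus: "empirical_mean m (\<lambda>z. - G z) D = - empirical_mean m G D"
  by (simp add: empirical_mean_def sum_negf)

context prob_space
begin

lemma integrable_bounded:
  fixes G :: "'a \<Rightarrow> real"
  assumes "G \<in> borel_measurable M" "\<And>z. \<bar>G z\<bar> \<le> B"
  shows "integrable M G"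
  by (rule integrable_const_bound[of _ B]) (use assms in auto)

lemma expectation_exp_le:
  fixes G :: "'a \<Rightarrow> real"
  assumes [measurable]: "G \<in> borel_measurable M" and bound: "\<And>z. \<bar>s * G z\<bar> \<le> 1" and "s > 0"
  shows "integrable M (\<lambda>z. exp (- s * G z))"
    "expectation (\<lambda>z. exp (- s * G z)) \<le> exp (- s * expectation G + s\<^sup>2 * expectation (\<lambda>z. (G z)\<^sup>2))"
proof -
  have G: "\<bar>G z\<bar> \<le> 1 / s" for z using bound[of z] \<open>s > 0\<close> by (simp add: abs_mult field_simps)
  have G_integrable: "integrable M G" by (rule integrable_bounded[of _ "1 / s"]) (use G in auto)
  have square_integrable: "integrable M (\<lambda>z. (G z)\<^sup>2)"
    by (rule integrable_bounded[of _ "(1 / s)\<^sup>2"]) (use power_mono[OF G abs_ge_zero, of _ 2] in auto)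
  show exp_integrable: "integrable M (\<lambda>z. exp (- s * G z))"
    by (rule integrable_bounded[of _ "exp 1"]) (use bound in \<open>auto simp: abs_le_iff\<close>)
  have "expectation (\<lambda>z. exp (- s * G z)) \<le> expectation (\<lambda>z. 1 + (- s * G z + s\<^sup>2 * (G z)\<^sup>2))"
  proof (rule integral_mono[OF exp_integrable])
    show "integrable M (\<lambda>z. 1 + (- s * G z + s\<^sup>2 * (G z)\<^sup>2))"
      using G_integrable square_integrable
      by (intro Bochner_Integration.integrable_add integrable_mult_right) auto
    show "exp (- s * G z) \<le> 1 + (- s * G z + s\<^sup>2 * (G z)\<^sup>2)" for z
      using exp_le_quadratic[of "- s * G z"] bound[of z] by (simp add: power_mult_distrib)
  qed
  also have "\<dots> = 1 + (- s * expectation G + s\<^sup>2 * expectation (\<lambda>z. (G z)\<^sup>2))"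
    using G_integrable square_integrable by (simp add: prob_space)
  also have "\<dots> \<le> exp (- s * expectation G + s\<^sup>2 * expectation (\<lambda>z. (G z)\<^sup>2))"
    using exp_ge_add_one_self by blast
  finally show "expectation (\<lambda>z. exp (- s * G z))
      \<le> exp (- s * expectation G + s\<^sup>2 * expectation (\<lambda>z. (G z)\<^sup>2))" .
qed

lemma iid_prod_tail:
  fixes m :: nat and h :: "'a \<Rightarrow> real" and T :: real
  assumes h: "integrable M h" "\<And>z. h z \<ge> 0" "expectation h \<le> 1"
  defines "P \<equiv> PiM {..<m} (\<lambda>_. M)"
  shows "measure P {D \<in> space P. exp T \<le> (\<Prod>i<m. h (D i))} \<le> exp (- T)"
proof -
  interpret product_sigma_finite "\<lambda>_ :: nat. M" by unfold_locales
  have prod_integrable: "integrable P (\<lambda>D. \<Prod>i<m. h (D i))"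
    unfolding P_def by (rule product_integrable_prod) (auto simp: h)
  have "(\<integral>D. (\<Prod>i<m. h (D i)) \<partial>P) = expectation h ^ m"
    unfolding P_def by (subst product_integral_prod) (auto simp: h)
  also have "\<dots> \<le> 1" using h by (simp add: power_le_one)
  finally have prod_le_1: "(\<integral>D. (\<Prod>i<m. h (D i)) \<partial>P) \<le> 1" .
  have "measure P {D \<in> space P. exp T \<le> (\<Prod>i<m. h (D i))} \<le> (\<integral>D. (\<Prod>i<m. h (D i)) \<partial>P) / exp T"
    using integral_Markov_inequality_measure[OF prod_integrable sets.empty_sets, of "exp T"] h(2)
    by (simp add: prod_nonneg)
  also have "\<dots> \<le> 1 / exp T" using prod_le_1 by (intro divide_right_mono) auto
  finally show ?thesis by (simp add: exp_minus inverse_eq_divide)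
qed

lemma expectation_exp_centered_le_1:
  fixes G :: "'a \<Rightarrow> real"
  assumes "G \<in> borel_measurable M" "\<And>z. \<bar>s * G z\<bar> \<le> 1" "s > 0"
  defines "h \<equiv> \<lambda>z. exp (- s * G z + (s * expectation G - s\<^sup>2 * expectation (\<lambda>z. (G z)\<^sup>2)))"
  shows "integrable M h" "expectation h \<le> 1"
proof -
  define c where "c = s * expectation G - s\<^sup>2 * expectation (\<lambda>z. (G z)\<^sup>2)"
  have h: "h = (\<lambda>z. exp (- s * G z) * exp c)" unfolding h_def c_def exp_add ..
  show "integrable M h"
    unfolding h using expectation_exp_le(1)[OF assms(1-3)] by (rule integrable_mult_left)
  have "expectation h = expectation (\<lambda>z. exp (- s * G z)) * exp c"
    unfolding h by (rule integral_mult_left_zero)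
  also have "\<dots> \<le> exp (- c) * exp c"
    using expectation_exp_le(2)[OF assms(1-3)] by (intro mult_right_mono) (auto simp: c_def)
  also have "\<dots> = 1" by (simp add: exp_minus)
  finally show "expectation h \<le> 1" .
qed

lemma iid_lower_deviation:
  fixes m :: nat and G :: "'a \<Rightarrow> real"
  assumes G [measurable]: "G \<in> borel_measurable M" and bound: "\<And>z. \<bar>s * G z\<bar> \<le> 1" and "s > 0" "m \<ge> 1"
  defines "P \<equiv> PiM {..<m} (\<lambda>_. M)"
  shows "measure P {D \<in> space P. T / (s * real m) + s * expectation (\<lambda>z. (G z)\<^sup>2)
      < expectation G - empirical_mean m G D} \<le> exp (- T)"
proof -
  interpret P: prob_space P unfolding P_def by (intro prob_space_PiM) unfold_locales
  define E V where "E = expectation G" and "V = expectation (\<lambda>z. (G z)\<^sup>2)"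
  define h where "h z = exp (- s * G z + (s * E - s\<^sup>2 * V))" for z
  have "exp T \<le> (\<Prod>i<m. h (D i))" if "T / (s * real m) + s * V < E - empirical_mean m G D" for D
  proof -
    have "(T / (s * real m) + s * V) * (s * real m) < (E - empirical_mean m G D) * (s * real m)"
      using that \<open>s > 0\<close> \<open>m \<ge> 1\<close> by (intro mult_strict_right_mono) auto
    moreover have "(T / (s * real m) + s * V) * (s * real m) = T + real m * (s\<^sup>2 * V)"
      using \<open>s > 0\<close> \<open>m \<ge> 1\<close> by (simp add: field_simps power2_eq_square)
    moreover have "(E - empirical_mean m G D) * (s * real m) = real m * (s * E) - s * (\<Sum>i<m. G (D i))"
      using \<open>m \<ge> 1\<close> by (simp add: empirical_mean_def field_simps)
    ultimately have "T \<le> (\<Sum>i<m. - s * G (D i) + (s * E - s\<^sup>2 * V))"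
      by (simp add: sum.distrib sum_subtractf sum_negf sum_distrib_left right_diff_distrib)
    then show ?thesis by (simp add: h_def exp_sum[symmetric])
  qed
  then have "{D \<in> space P. T / (s * real m) + s * V < E - empirical_mean m G D}
      \<subseteq> {D \<in> space P. exp T \<le> (\<Prod>i<m. h (D i))}" by blast
  moreover have "{D \<in> space P. exp T \<le> (\<Prod>i<m. h (D i))} \<in> sets P"
    unfolding P_def h_def by measurable
  ultimately have "measure P {D \<in> space P. T / (s * real m) + s * V < E - empirical_mean m G D}
      \<le> measure P {D \<in> space P. exp T \<le> (\<Prod>i<m. h (D i))}"
    by (rule P.finite_measure_mono)
  also have "\<dots> \<le> exp (- T)"
    unfolding P_def h_def E_def V_def
    by (intro iid_prod_tail expectation_exp_centered_le_1 G bound \<open>s > 0\<close>) simp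
  finally show ?thesis by (simp add: E_def V_def)
qed

lemma iid_deviation:
  fixes m :: nat and G :: "'a \<Rightarrow> real"
  assumes G [measurable]: "G \<in> borel_measurable M" and bound: "\<And>z. \<bar>s * G z\<bar> \<le> 1" and "s > 0" "m \<ge> 1"
  defines "P \<equiv> PiM {..<m} (\<lambda>_. M)"
  shows "measure P {D \<in> space P. T / (s * real m) + s * expectation (\<lambda>z. (G z)\<^sup>2)
      < \<bar>expectation G - empirical_mean m G D\<bar>} \<le> 2 * exp (- T)"
proof -
  interpret P: prob_space P unfolding P_def by (intro prob_space_PiM) unfold_locales
  define B where "B = T / (s * real m) + s * expectation (\<lambda>z. (G z)\<^sup>2)"
  define low where "low = {D \<in> space P. B < expectation G - empirical_mean m G D}"
  define high where "high = {D \<in> space P. B < expectation (\<lambda>z. - G z) - empirical_mean m (\<lambda>z. - G z) D}"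
  have "low \<in> sets P" "high \<in> sets P" unfolding low_def high_def P_def by measurable
  then have "measure P (low \<union> high) \<le> measure P low + measure P high" by (rule measure_Un_le)
  also have "measure P low \<le> exp (- T)"
    unfolding low_def B_def P_def by (rule iid_lower_deviation[OF G bound \<open>s > 0\<close> \<open>m \<ge> 1\<close>])
  also have "measure P high \<le> exp (- T)"
    using iid_lower_deviation[of "\<lambda>z. - G z" s m T] bound \<open>s > 0\<close> \<open>m \<ge> 1\<close>
    unfolding high_def B_def P_def by simp
  moreover have "{D \<in> space P. B < \<bar>expectation G - empirical_mean m G D\<bar>} = low \<union> high"
    by (auto simp: low_def high_def empirical_mean_uminus)
  ultimately show ?thesis by (simp add: B_def)
qed

lemma iid_uniform_deviation:
  fixes m :: nat and G :: "'i \<Rightarrow> 'a \<Rightarrow> real" and T :: real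
  assumes "finite I" and G: "\<And>i. i \<in> I \<Longrightarrow> G i \<in> borel_measurable M"
    and "\<And>i z. i \<in> I \<Longrightarrow> \<bar>s * G i z\<bar> \<le> 1" "s > 0" "m \<ge> 1"
  defines "P \<equiv> PiM {..<m} (\<lambda>_. M)"
    and "bad \<equiv> \<lambda>i. {D \<in> space (PiM {..<m} (\<lambda>_. M)). T / (s * real m) + s * expectation (\<lambda>z. (G i z)\<^sup>2)
      < \<bar>expectation (G i) - empirical_mean m (G i) D\<bar>}"
  shows "(\<Union>i\<in>I. bad i) \<in> sets P" and "measure P (\<Union>i\<in>I. bad i) \<le> real (card I) * (2 * exp (- T))"
proof -
  interpret P: prob_space P unfolding P_def by (intro prob_space_PiM) unfold_locales
  have bad_sets: "bad i \<in> sets P" if "i \<in> I" for i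
    using G[OF that, measurable] unfolding bad_def P_def by measurable
  show "(\<Union>i\<in>I. bad i) \<in> sets P" using \<open>finite I\<close> bad_sets by (intro sets.finite_UN) auto
  have "measure P (\<Union>i\<in>I. bad i) \<le> (\<Sum>i\<in>I. measure P (bad i))"
    using \<open>finite I\<close> bad_sets by (intro P.finite_measure_subadditive_finite) auto
  also have "\<dots> \<le> (\<Sum>i\<in>I. 2 * exp (- T))"
    unfolding bad_def P_def using assms by (intro sum_mono iid_deviation) auto
  finally show "measure P (\<Union>i\<in>I. bad i) \<le> real (card I) * (2 * exp (- T))" by simp
qed

lemma AE_iid_all:
  assumes "AE z in M. Q z"
  shows "AE D in PiM {..<m::nat} (\<lambda>_. M). \<forall>i<m. Q (D i)"
proof -
  have "AE D in PiM {..<m} (\<lambda>_. M). i < m \<longrightarrow> Q (D i)" for i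
  proof (cases "i < m")
    case True
    then have "AE D in PiM {..<m} (\<lambda>_. M). Q (D i)"
      using assms by (intro AE_PiM_component) (auto intro: prob_space_axioms)
    then show ?thesis by simp
  qed simp
  then show ?thesis by (simp add: AE_all_countable)
qed

lemma iid_uniform_deviation_event:
  fixes m :: nat and G :: "'i \<Rightarrow> 'a \<Rightarrow> real" and T \<delta> :: real
  assumes I: "finite I" "\<And>i. i \<in> I \<Longrightarrow> G i \<in> borel_measurable M" "\<And>i z. i \<in> I \<Longrightarrow> \<bar>s * G i z\<bar> \<le> 1"
    and "s > 0" "m \<ge> 1" and card: "real (card I) * (2 * exp (- T)) \<le> \<delta>"
    and AE: "AE z in M. Q z" and Q [measurable]: "Measurable.pred M Q"
  defines "P \<equiv> PiM {..<m} (\<lambda>_. M)"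
  obtains A where "A \<in> sets P" "measure P A \<ge> 1 - \<delta>" "\<And>D j. D \<in> A \<Longrightarrow> j < m \<Longrightarrow> Q (D j)"
    "\<And>D i. D \<in> A \<Longrightarrow> i \<in> I \<Longrightarrow> \<bar>expectation (G i) - empirical_mean m (G i) D\<bar>
       \<le> T / (s * real m) + s * expectation (\<lambda>z. (G i z)\<^sup>2)"
proof -
  interpret P: prob_space P unfolding P_def by (intro prob_space_PiM) unfold_locales
  define bad where "bad i = {D \<in> space P. T / (s * real m) + s * expectation (\<lambda>z. (G i z)\<^sup>2)
      < \<bar>expectation (G i) - empirical_mean m (G i) D\<bar>}" for i
  have bad: "(\<Union>i\<in>I. bad i) \<in> sets P" "measure P (\<Union>i\<in>I. bad i) \<le> real (card I) * (2 * exp (- T))"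
    unfolding bad_def P_def by (rule iid_uniform_deviation[OF I \<open>s > 0\<close> \<open>m \<ge> 1\<close>], assumption+)+
  have Q_sets: "{D \<in> space P. \<forall>j<m. Q (D j)} \<in> sets P" unfolding P_def by measurable
  define A where "A = {D \<in> space P. \<forall>j<m. Q (D j)} - (\<Union>i\<in>I. bad i)"
  have A: "A \<in> sets P" unfolding A_def using Q_sets bad(1) by (rule sets.Diff)
  have "AE D in P. \<forall>j<m. Q (D j)" unfolding P_def by (rule AE_iid_all[OF AE])
  then have "AE D in P. D \<in> A \<longleftrightarrow> D \<in> space P - (\<Union>i\<in>I. bad i)"
    using AE_space by eventually_elim (simp add: A_def)
  then have "measure P A = measure P (space P - (\<Union>i\<in>I. bad i))"
    using A bad(1) by (intro measure_eq_AE) auto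
  then have "measure P A \<ge> 1 - \<delta>" using bad card by (simp add: P.prob_compl)
  then show ?thesis by (rule that[OF A]) (auto simp: A_def bad_def not_less)
qed

end

section \<open>Labelled samples\<close>

definition label_fun :: "('a \<Rightarrow> real) \<Rightarrow> ('a \<Rightarrow> real) \<Rightarrow> 'a \<times> real \<Rightarrow> real" where
  "label_fun a b z = (if snd z = 1 then a (fst z) else if snd z = - 1 then b (fst z) else 0)"

lemma abs_label_fun_le:
  "\<bar>a (fst z)\<bar> \<le> B \<Longrightarrow> \<bar>b (fst z)\<bar> \<le> B \<Longrightarrow> \<bar>label_fun a b z\<bar> \<le> B"
  by (auto simp: label_fun_def)

lemma label_fun_power2: "(label_fun a b z)\<^sup>2 = label_fun (\<lambda>x. (a x)\<^sup>2) (\<lambda>x. (b x)\<^sup>2) z"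
  by (simp add: label_fun_def)

lemma borel_measurable_sign_clf [measurable]:
  assumes [measurable]: "f \<in> borel_measurable borel"
  shows "sign_clf f \<in> borel_measurable borel"
  unfolding sign_clf_def by measurable

lemma borel_measurable_bayes_rule [measurable]:
  assumes [measurable]: "\<eta> \<in> borel_measurable borel"
  shows "bayes_rule \<eta> \<in> borel_measurable borel"
  unfolding bayes_rule_def by measurable

locale labelled_sample = prob_space \<rho>
  for \<rho> :: "((real^'d) \<times> real) measure" +
  fixes \<eta> :: "real^'d \<Rightarrow> real"
  assumes sets_rho [measurable_cong]: "sets \<rho> = sets borel"
    and supp: "AE z in \<rho>. fst z \<in> unit_cube \<and> snd z \<in> {- 1, 1}"
    and eta_measurable [measurable]: "\<eta> \<in> borel_measurable borel"
    and eta_bounds: "\<forall>x. 0 \<le> \<eta> x \<and> \<eta> x \<le> 1"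
    and eta_cond: "\<forall>A\<in>sets borel. measure \<rho> (A \<times> {1}) = (\<integral>x. indicator A x * \<eta> x \<partial>(distr \<rho> borel fst))"
begin

definition \<rho>X :: "(real^'d) measure" where
  "\<rho>X = distr \<rho> borel fst"

lemma fst_snd_measurable [measurable]: "fst \<in> \<rho> \<rightarrow>\<^sub>M borel" "snd \<in> \<rho> \<rightarrow>\<^sub>M borel"
  by (auto simp: measurable_cong_sets[OF sets_rho refl]
      intro!: borel_measurable_continuous_onI continuous_intros)

lemma space_rho [simp]: "space \<rho> = UNIV"
  using sets_eq_imp_space_eq[OF sets_rho] by simp

lemma sets_rhoX [simp, measurable_cong]: "sets \<rho>X = sets borel"
  by (simp add: \<rho>X_def)

sublocale X: prob_space \<rho>X
  unfolding \<rho>X_def by (rule prob_space_distr) simp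

lemma AE_rhoX_unit_cube: "AE x in \<rho>X. x \<in> unit_cube"
  unfolding \<rho>X_def using supp by (subst AE_distr_iff) (auto elim: AE_mp)

lemma borel_measurable_rhoX: "f \<in> borel_measurable borel \<Longrightarrow> f \<in> borel_measurable \<rho>X"
  by (simp cong: measurable_cong_sets)

lemma integrable_rhoX_bounded:
  "f \<in> borel_measurable borel \<Longrightarrow> (\<And>x. \<bar>f x\<bar> \<le> B) \<Longrightarrow> integrable \<rho>X (f :: _ \<Rightarrow> real)"
  by (intro X.integrable_bounded borel_measurable_rhoX)

lemma borel_measurable_label_fun [measurable]:
  assumes [measurable]: "a \<in> borel_measurable borel" "b \<in> borel_measurable borel"
  shows "label_fun a b \<in> borel_measurable \<rho>"
  unfolding label_fun_def by measurable

lemma distr_fst_label_one: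
  "distr (density \<rho> (indicator {z. snd z = 1})) borel fst = density \<rho>X \<eta>"
proof (rule measure_eqI)
  fix A assume "A \<in> sets (distr (density \<rho> (indicator {z. snd z = 1})) borel fst)"
  then have A [measurable]: "A \<in> sets borel" by simp
  have vimage_A [measurable]: "fst -` A \<in> sets \<rho>" using measurable_sets[OF fst_snd_measurable(1) A] by simp
  have "emeasure (distr (density \<rho> (indicator {z. snd z = 1})) borel fst) A
      = emeasure (density \<rho> (indicator {z. snd z = 1})) (fst -` A)"
    by (subst emeasure_distr) auto
  also have "\<dots> = (\<integral>\<^sup>+z. indicator {z. snd z = 1} z * indicator (fst -` A) z \<partial>\<rho>)"
    by (intro emeasure_density) auto
  also have "\<dots> = (\<integral>\<^sup>+z. indicator (fst -` A \<inter> {z. snd z = 1}) z \<partial>\<rho>)"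
    by (intro nn_integral_cong) (auto simp: indicator_def)
  also have "\<dots> = emeasure \<rho> (fst -` A \<inter> {z. snd z = 1})" by (rule nn_integral_indicator) measurable
  also have "fst -` A \<inter> {z. snd z = 1} = A \<times> {1 :: real}" by auto
  also have "emeasure \<rho> (A \<times> {1}) = ennreal (\<integral>x. indicator A x * \<eta> x \<partial>\<rho>X)"
    using eta_cond A by (simp add: emeasure_eq_measure \<rho>X_def)
  also have "\<dots> = (\<integral>\<^sup>+x. ennreal (indicator A x * \<eta> x) \<partial>\<rho>X)"
    using eta_bounds
    by (intro nn_integral_eq_integral[symmetric] integrable_rhoX_bounded[of _ 1]) (auto simp: indicator_def)
  also have "\<dots> = emeasure (density \<rho>X \<eta>) A"
    by (subst emeasure_density) (auto intro!: nn_integral_cong simp: indicator_def mult.commute)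
  finally show "emeasure (distr (density \<rho> (indicator {z. snd z = 1})) borel fst) A
      = emeasure (density \<rho>X \<eta>) A" .
qed simp

lemma integral_label_one:
  assumes [measurable]: "a \<in> borel_measurable borel"
  shows "(\<integral>z. indicator {z. snd z = 1} z * a (fst z) \<partial>\<rho>) = (\<integral>x. \<eta> x * a x \<partial>\<rho>X)"
proof -
  have "(\<integral>z. indicator {z. snd z = 1} z * a (fst z) \<partial>\<rho>)
      = (\<integral>z. a (fst z) \<partial>density \<rho> (indicator {z. snd z = 1}))"
    using integral_density[of "\<lambda>z. a (fst z)" \<rho> "indicator {z. snd z = 1}"] by (simp add: ennreal_indicator)
  also have "\<dots> = (\<integral>x. a x \<partial>distr (density \<rho> (indicator {z. snd z = 1})) borel fst)"
    by (subst integral_distr) auto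
  also have "\<dots> = (\<integral>x. \<eta> x * a x \<partial>\<rho>X)"
    unfolding distr_fst_label_one using eta_bounds by (subst integral_density) auto
  finally show ?thesis .
qed

lemma expectation_label_fun:
  assumes [measurable]: "a \<in> borel_measurable borel" "b \<in> borel_measurable borel"
    and a: "\<And>x. \<bar>a x\<bar> \<le> B" and b: "\<And>x. \<bar>b x\<bar> \<le> B"
  shows "expectation (label_fun a b) = (\<integral>x. \<eta> x * a x + (1 - \<eta> x) * b x \<partial>\<rho>X)"
proof -
  have integrable: "integrable \<rho> (\<lambda>z. h (fst z))"
    "integrable \<rho> (\<lambda>z. indicator {z. snd z = 1} z * h (fst z))"
    "integrable \<rho>X h" "integrable \<rho>X (\<lambda>x. \<eta> x * h x)"
    if [measurable]: "h \<in> borel_measurable borel" and h: "\<And>x. \<bar>h x\<bar> \<le> B" for h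
  proof -
    have "B \<ge> 0" using order.trans[OF abs_ge_zero h] .
    have "\<bar>\<eta> x * h x\<bar> \<le> B" for x
      using mult_mono[of "\<bar>\<eta> x\<bar>" 1 "\<bar>h x\<bar>" B] eta_bounds h by (simp add: abs_mult)
    then show "integrable \<rho>X (\<lambda>x. \<eta> x * h x)" by (intro integrable_rhoX_bounded) simp_all
    show "integrable \<rho> (\<lambda>z. h (fst z))" "integrable \<rho>X h"
      by (rule integrable_bounded integrable_rhoX_bounded, simp, rule h)+
    have "\<bar>indicator {z. snd z = 1} z * h (fst z)\<bar> \<le> B" for z
      using h[of "fst z"] \<open>B \<ge> 0\<close> by (simp add: indicator_def)
    then show "integrable \<rho> (\<lambda>z. indicator {z. snd z = 1} z * h (fst z))"
      by (rule integrable_bounded[rotated]) measurable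
  qed
  note integrable_a = integrable[OF assms(1) a] and integrable_b = integrable[OF assms(2) b]
  have "expectation (label_fun a b)
      = (\<integral>z. indicator {z. snd z = 1} z * a (fst z)
        + (b (fst z) - indicator {z. snd z = 1} z * b (fst z)) \<partial>\<rho>)"
  proof (rule integral_cong_AE)
    show "AE z in \<rho>. label_fun a b z
        = indicator {z. snd z = 1} z * a (fst z) + (b (fst z) - indicator {z. snd z = 1} z * b (fst z))"
      using supp by eventually_elim (auto simp: label_fun_def)
  qed simp_all
  also have "\<dots> = (\<integral>z. indicator {z. snd z = 1} z * a (fst z) \<partial>\<rho>)
      + ((\<integral>z. b (fst z) \<partial>\<rho>) - (\<integral>z. indicator {z. snd z = 1} z * b (fst z) \<partial>\<rho>))"
    using integrable_a integrable_b by (simp add: Bochner_Integration.integral_diff)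
  also have "\<dots> = (\<integral>x. \<eta> x * a x \<partial>\<rho>X) + ((\<integral>x. b x \<partial>\<rho>X) - (\<integral>x. \<eta> x * b x \<partial>\<rho>X))"
    by (simp add: integral_label_one \<rho>X_def integral_distr)
  also have "\<dots> = (\<integral>x. \<eta> x * a x + (b x - \<eta> x * b x) \<partial>\<rho>X)"
    using integrable_a integrable_b by (simp add: Bochner_Integration.integral_diff)
  finally show ?thesis by (simp add: algebra_simps)
qed

lemma misclass_risk_eq:
  assumes [measurable]: "C \<in> borel_measurable borel" and C: "\<And>x. C x = 1 \<or> C x = - 1"
  shows "misclass_risk \<rho> C = (\<integral>x. \<eta> x * of_bool (C x \<noteq> 1) + (1 - \<eta> x) * of_bool (C x \<noteq> - 1) \<partial>\<rho>X)"
proof -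
  have "{z \<in> space \<rho>. C (fst z) \<noteq> snd z} \<in> sets \<rho>" by measurable
  then have errors [measurable]: "{z. C (fst z) \<noteq> snd z} \<in> sets \<rho>" by simp
  have "misclass_risk \<rho> C = expectation (indicator {z. C (fst z) \<noteq> snd z})"
    unfolding misclass_risk_def by simp
  also have "\<dots> = expectation (label_fun (\<lambda>x. of_bool (C x \<noteq> 1)) (\<lambda>x. of_bool (C x \<noteq> - 1)))"
  proof (rule integral_cong_AE)
    show "AE z in \<rho>. indicator {z. C (fst z) \<noteq> snd z} z
        = label_fun (\<lambda>x. of_bool (C x \<noteq> 1)) (\<lambda>x. of_bool (C x \<noteq> - 1)) z"
      using supp by eventually_elim (auto simp: label_fun_def indicator_def)
  qed measurable
  also have "\<dots> = (\<integral>x. \<eta> x * of_bool (C x \<noteq> 1) + (1 - \<eta> x) * of_bool (C x \<noteq> - 1) \<partial>\<rho>X)"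
    by (rule expectation_label_fun[of _ _ 1]) auto
  finally show ?thesis .
qed

lemma excess_misclass_risk_eq:
  assumes [measurable]: "f \<in> borel_measurable borel"
  shows "misclass_risk \<rho> (sign_clf f) - misclass_risk \<rho> (bayes_rule \<eta>)
    = (\<integral>x. \<bar>2 * \<eta> x - 1\<bar> * of_bool (sign_clf f x \<noteq> bayes_rule \<eta> x) \<partial>\<rho>X)"
proof -
  define err where "err C x = \<eta> x * of_bool (C x \<noteq> (1::real)) + (1 - \<eta> x) * of_bool (C x \<noteq> - 1)" for C x
  have err_integrable: "integrable \<rho>X (err C)" if [measurable]: "C \<in> borel_measurable borel" for C
  proof (rule integrable_rhoX_bounded)
    show "\<bar>err C x\<bar> \<le> 1" for x using eta_bounds[rule_format, of x] by (auto simp: err_def of_bool_def)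
  qed (simp add: err_def[abs_def])
  have "misclass_risk \<rho> (sign_clf f) - misclass_risk \<rho> (bayes_rule \<eta>)
      = (\<integral>x. err (sign_clf f) x \<partial>\<rho>X) - (\<integral>x. err (bayes_rule \<eta>) x \<partial>\<rho>X)"
    unfolding err_def by (subst (1 2) misclass_risk_eq) (auto simp: sign_clf_def bayes_rule_def)
  also have "\<dots> = (\<integral>x. err (sign_clf f) x - err (bayes_rule \<eta>) x \<partial>\<rho>X)"
    by (rule Bochner_Integration.integral_diff[symmetric]) (auto intro: err_integrable)
  also have "\<dots> = (\<integral>x. \<bar>2 * \<eta> x - 1\<bar> * of_bool (sign_clf f x \<noteq> bayes_rule \<eta> x) \<partial>\<rho>X)"
    by (intro Bochner_Integration.integral_cong refl)
      (auto simp: err_def sign_clf_def bayes_rule_def abs_if)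
  finally show ?thesis .
qed

end

section \<open>Excess risk\<close>

locale excess_risk = labelled_sample \<rho> \<eta>
  for \<rho> :: "((real^'d) \<times> real) measure" and \<eta> +
  fixes \<phi> :: "real \<Rightarrow> real" and target :: "real^'d \<Rightarrow> real" and p :: nat and M \<Lambda> U V :: real
  assumes clippable_phi: "clippable \<phi>"
    and p: "p = 1 \<or> p = 2" and phi_bounds: "loss_bounds \<phi> p M \<Lambda> U V"
    and pos: "\<Lambda> > 0" "U > 0" "V > 0" "M \<ge> 1"
    and target_measurable [measurable]: "target \<in> borel_measurable borel"
    and target_bound: "\<bar>target x\<bar> \<le> M"
    and target_minimizer: "x \<in> unit_cube \<Longrightarrow> cond_minimizer \<phi> (\<eta> x) (target x)"
begin

definition admissible :: "(real^'d \<Rightarrow> real) \<Rightarrow> bool" where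
  "admissible t \<longleftrightarrow> t \<in> borel_measurable borel \<and> (\<forall>x. \<bar>t x\<bar> \<le> M)"

definition label_gap :: "real \<Rightarrow> (real^'d \<Rightarrow> real) \<Rightarrow> real^'d \<Rightarrow> real" where
  "label_gap y t x = indicator unit_cube x * (\<phi> (y * t x) - \<phi> (y * target x))"

definition loss_gap :: "(real^'d \<Rightarrow> real) \<Rightarrow> (real^'d) \<times> real \<Rightarrow> real" where
  "loss_gap t = label_fun (label_gap 1 t) (label_gap (- 1) t)"

definition pointwise_excess :: "(real^'d \<Rightarrow> real) \<Rightarrow> real^'d \<Rightarrow> real" where
  "pointwise_excess t x = indicator unit_cube x * cond_excess \<phi> (\<eta> x) (t x) (target x)"

definition excess :: "(real^'d \<Rightarrow> real) \<Rightarrow> real" where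
  "excess t = (\<integral>x. pointwise_excess t x \<partial>\<rho>X)"

lemma borel_measurable_phi [measurable]: "\<phi> \<in> borel_measurable borel"
  using clippable_phi unfolding clippable_def by (intro borel_measurable_continuous_onI) blast

lemma phi_lipschitz: "\<bar>u\<bar> \<le> M \<Longrightarrow> \<bar>v\<bar> \<le> M \<Longrightarrow> \<bar>\<phi> u - \<phi> v\<bar> \<le> \<Lambda> * \<bar>u - v\<bar>"
  using phi_bounds lipschitz_onD[of \<Lambda> "{- M..M}" \<phi> u v]
  by (auto simp: loss_bounds_def dist_real_def abs_le_iff)

lemma admissible_clip: "f \<in> borel_measurable borel \<Longrightarrow> admissible (\<lambda>x. clip (f x))"
  using pos by (auto simp: admissible_def intro: order.trans[OF abs_clip_le_1])

lemma eta_in_unit_interval: "\<eta> x \<in> {0..1}"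
  using eta_bounds by simp

lemma target_in_interval: "target x \<in> {- M..M}"
  using target_bound[of x] by (auto simp: abs_le_iff)

lemma admissible_in_interval: "admissible t \<Longrightarrow> t x \<in> {- M..M}"
  using abs_le_iff[of "t x" M] by (auto simp: admissible_def)

lemma loss_gap_eq:
  "fst z \<in> unit_cube \<Longrightarrow> snd z \<in> {- 1, 1} \<Longrightarrow> loss_gap t z = \<phi> (snd z * t (fst z)) - \<phi> (snd z * target (fst z))"
  by (auto simp: loss_gap_def label_fun_def label_gap_def)

lemma pointwise_excess_nonneg: "pointwise_excess t x \<ge> 0"
  using cond_excess_nonneg[OF target_minimizer] by (simp add: pointwise_excess_def indicator_def)

lemma excess_nonneg: "excess t \<ge> 0"
  unfolding excess_def by (simp add: pointwise_excess_nonneg)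

lemma pointwise_excess_eq_label_gap:
  "pointwise_excess t x = \<eta> x * label_gap 1 t x + (1 - \<eta> x) * label_gap (- 1) t x"
  by (simp add: pointwise_excess_def cond_excess_def cond_phi_risk_def label_gap_def algebra_simps)

lemma borel_measurable_label_gap [measurable]:
  assumes "admissible t"
  shows "label_gap y t \<in> borel_measurable borel"
proof -
  have [measurable]: "t \<in> borel_measurable borel" using assms by (simp add: admissible_def)
  show ?thesis unfolding label_gap_def by measurable
qed

lemma borel_measurable_loss_gap [measurable]: "admissible t \<Longrightarrow> loss_gap t \<in> borel_measurable \<rho>"
  unfolding loss_gap_def by (intro borel_measurable_label_fun borel_measurable_label_gap)

lemma abs_label_gap_le:
  assumes "admissible t" "y \<in> {- 1, 1}"
  shows "\<bar>label_gap y t x\<bar> \<le> 2 * \<Lambda> * M"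
proof -
  have bounds: "\<bar>y * t x\<bar> \<le> M" "\<bar>y * target x\<bar> \<le> M"
    using assms target_bound[of x] by (auto simp: admissible_def)
  have "\<bar>\<phi> (y * t x) - \<phi> (y * target x)\<bar> \<le> \<Lambda> * \<bar>y * t x - y * target x\<bar>" by (rule phi_lipschitz[OF bounds])
  also have "\<dots> \<le> \<Lambda> * (2 * M)" using bounds pos by (intro mult_left_mono) auto
  finally show ?thesis using pos by (simp add: label_gap_def indicator_def)
qed

lemma abs_loss_gap_le: "admissible t \<Longrightarrow> \<bar>loss_gap t z\<bar> \<le> 2 * \<Lambda> * M"
  unfolding loss_gap_def by (intro abs_label_fun_le abs_label_gap_le) auto

lemma expectation_loss_gap:
  assumes "admissible t"
  shows "expectation (loss_gap t) = excess t"
  unfolding excess_def loss_gap_def pointwise_excess_eq_label_gap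
  by (rule expectation_label_fun[where B="2 * \<Lambda> * M"])
    (use assms in \<open>auto intro: abs_label_gap_le borel_measurable_label_gap\<close>)

lemma integrable_pointwise_excess:
  assumes "admissible t"
  shows "integrable \<rho>X (pointwise_excess t)"
proof (rule integrable_rhoX_bounded)
  have [measurable]: "label_gap y t \<in> borel_measurable borel" for y
    by (rule borel_measurable_label_gap[OF assms])
  show "pointwise_excess t \<in> borel_measurable borel"
    unfolding pointwise_excess_eq_label_gap[abs_def] by measurable
  fix x
  have "\<bar>pointwise_excess t x\<bar> \<le> \<bar>\<eta> x\<bar> * \<bar>label_gap 1 t x\<bar> + \<bar>1 - \<eta> x\<bar> * \<bar>label_gap (- 1) t x\<bar>"
    unfolding pointwise_excess_eq_label_gap abs_mult[symmetric] by (rule abs_triangle_ineq)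
  also have "\<dots> \<le> \<eta> x * (2 * \<Lambda> * M) + (1 - \<eta> x) * (2 * \<Lambda> * M)"
    using eta_bounds abs_label_gap_le[OF assms] by (intro add_mono mult_mono) auto
  finally show "\<bar>pointwise_excess t x\<bar> \<le> 2 * \<Lambda> * M" by (simp add: algebra_simps)
qed

lemma pointwise_square_gap_le:
  assumes "admissible t"
  shows "\<eta> x * (label_gap 1 t x)\<^sup>2 + (1 - \<eta> x) * (label_gap (- 1) t x)\<^sup>2
    \<le> V * pointwise_excess t x ^ (p - 1)"
proof (cases "x \<in> unit_cube")
  case True
  then have "\<eta> x * (label_gap 1 t x)\<^sup>2 + (1 - \<eta> x) * (label_gap (- 1) t x)\<^sup>2
      = cond_square_gap \<phi> (\<eta> x) (t x) (target x)"
    by (simp add: label_gap_def cond_square_gap_def)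
  also have "\<dots> \<le> V * cond_excess \<phi> (\<eta> x) (t x) (target x) ^ (p - 1)"
    using phi_bounds target_minimizer[OF True] eta_in_unit_interval target_in_interval
      admissible_in_interval[OF assms]
    unfolding loss_bounds_def variance_bounded_def by blast
  finally show ?thesis using True by (simp add: pointwise_excess_def)
qed (use pos in \<open>simp add: label_gap_def pointwise_excess_def\<close>)

lemma expectation_square_loss_gap_le:
  assumes "admissible t"
  shows "expectation (\<lambda>z. (loss_gap t z)\<^sup>2) \<le> V * excess t ^ (p - 1)"
proof -
  have square_bound: "\<bar>(label_gap y t x)\<^sup>2\<bar> \<le> (2 * \<Lambda> * M)\<^sup>2" if "y \<in> {- 1, 1}" for y x
    using power_mono[OF abs_label_gap_le[OF assms that] abs_ge_zero, of x 2] by simp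
  have "expectation (\<lambda>z. (loss_gap t z)\<^sup>2)
      = (\<integral>x. \<eta> x * (label_gap 1 t x)\<^sup>2 + (1 - \<eta> x) * (label_gap (- 1) t x)\<^sup>2 \<partial>\<rho>X)"
    unfolding loss_gap_def label_fun_power2
    by (rule expectation_label_fun[where B="(2 * \<Lambda> * M)\<^sup>2"])
      (use assms square_bound in \<open>auto intro!: borel_measurable_power borel_measurable_label_gap\<close>)
  also have "\<dots> \<le> (\<integral>x. V * pointwise_excess t x ^ (p - 1) \<partial>\<rho>X)"
  proof (rule integral_mono')
    show "integrable \<rho>X (\<lambda>x. V * pointwise_excess t x ^ (p - 1))"
      using integrable_pointwise_excess[OF assms] p by auto
    show "0 \<le> V * pointwise_excess t x ^ (p - 1)" for x using pos pointwise_excess_nonneg by simp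
  qed (rule pointwise_square_gap_le[OF assms])
  also have "\<dots> = V * excess t ^ (p - 1)" using p X.prob_space by (auto simp: excess_def)
  finally show ?thesis .
qed

definition variance_slack :: "real \<Rightarrow> real" where
  "variance_slack s = (if p = 1 then s * V else 0)"

lemma scaled_square_loss_gap_le:
  assumes "admissible t" "s \<ge> 0" "s * V \<le> 1 / 2"
  shows "s * expectation (\<lambda>z. (loss_gap t z)\<^sup>2) \<le> excess t / 2 + variance_slack s"
proof -
  have "s * expectation (\<lambda>z. (loss_gap t z)\<^sup>2) \<le> s * (V * excess t ^ (p - 1))"
    using expectation_square_loss_gap_le[OF assms(1)] \<open>s \<ge> 0\<close> by (rule mult_left_mono)
  also have "\<dots> \<le> excess t / 2 + variance_slack s"
    using p excess_nonneg[of t] mult_right_mono[OF assms(3) excess_nonneg[of t]]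
    by (auto simp: variance_slack_def mult_ac)
  finally show ?thesis .
qed

lemma excess_le_of_close:
  assumes "admissible t" "\<And>x. x \<in> unit_cube \<Longrightarrow> \<bar>t x - target x\<bar> \<le> \<epsilon>" "\<epsilon> \<ge> 0"
  shows "excess t \<le> U * \<epsilon> ^ p"
proof -
  have "excess t \<le> (\<integral>x. U * \<epsilon> ^ p \<partial>\<rho>X)"
    unfolding excess_def
  proof (rule integral_mono')
    show "0 \<le> U * \<epsilon> ^ p" using pos \<open>\<epsilon> \<ge> 0\<close> by simp
    show "pointwise_excess t x \<le> U * \<epsilon> ^ p" for x
    proof (cases "x \<in> unit_cube")
      case True
      have "cond_excess \<phi> (\<eta> x) (t x) (target x) \<le> U * \<bar>t x - target x\<bar> ^ p"
        using phi_bounds target_minimizer[OF True] eta_in_unit_interval target_in_interval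
          admissible_in_interval[OF assms(1)]
        unfolding loss_bounds_def excess_upper_bounded_def by blast
      also have "\<dots> \<le> U * \<epsilon> ^ p" using pos assms(2)[OF True] by (intro mult_left_mono power_mono) auto
      finally show ?thesis using True by (simp add: pointwise_excess_def)
    qed (use pos \<open>\<epsilon> \<ge> 0\<close> in \<open>simp add: pointwise_excess_def\<close>)
  qed simp
  then show ?thesis using X.prob_space by simp
qed

lemma loss_gap_perturb:
  assumes "admissible t" "admissible t'" "\<And>x. x \<in> unit_cube \<Longrightarrow> \<bar>t x - t' x\<bar> \<le> \<epsilon>" "\<epsilon> \<ge> 0"
  shows "loss_gap t z \<le> loss_gap t' z + \<Lambda> * \<epsilon>"
proof -
  have "label_gap y t x \<le> label_gap y t' x + \<Lambda> * \<epsilon>" if "y \<in> {- 1, 1}" for y x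
  proof (cases "x \<in> unit_cube")
    case True
    have "\<bar>\<phi> (y * t x) - \<phi> (y * t' x)\<bar> \<le> \<Lambda> * \<bar>y * t x - y * t' x\<bar>"
      using assms(1,2) that by (intro phi_lipschitz) (auto simp: admissible_def)
    also have "\<dots> \<le> \<Lambda> * \<epsilon>"
      using assms(3)[OF True] that pos by (intro mult_left_mono) (auto simp: abs_minus_commute)
    finally show ?thesis using True by (simp add: label_gap_def)
  qed (use pos \<open>\<epsilon> \<ge> 0\<close> in \<open>simp add: label_gap_def\<close>)
  then show ?thesis using pos \<open>\<epsilon> \<ge> 0\<close> by (simp add: loss_gap_def label_fun_def)
qed

lemma excess_perturb:
  assumes adm: "admissible t" "admissible t'" and "\<And>x. x \<in> unit_cube \<Longrightarrow> \<bar>t x - t' x\<bar> \<le> \<epsilon>" "\<epsilon> \<ge> 0"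
  shows "excess t \<le> excess t' + \<Lambda> * \<epsilon>"
proof -
  have integrable: "integrable \<rho> (loss_gap q)" if "admissible q" for q
    by (rule integrable_bounded[OF borel_measurable_loss_gap[OF that] abs_loss_gap_le[OF that]])
  have "expectation (loss_gap t) \<le> expectation (\<lambda>z. loss_gap t' z + \<Lambda> * \<epsilon>)"
    using integrable adm loss_gap_perturb[OF assms] by (intro integral_mono) auto
  also have "\<dots> = expectation (loss_gap t') + \<Lambda> * \<epsilon>"
    using integrable[OF adm(2)] by (simp add: prob_space[unfolded space_rho])
  finally show ?thesis using adm by (simp add: expectation_loss_gap)
qed

lemma pointwise_calibration:
  assumes x: "x \<in> unit_cube"
  shows "(\<bar>2 * \<eta> x - 1\<bar> * of_bool (sign_clf f x \<noteq> bayes_rule \<eta> x)) ^ p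
    \<le> U * pointwise_excess (\<lambda>x. clip (f x)) x"
proof (cases "sign_clf f x = bayes_rule \<eta> x")
  case True
  then show ?thesis using p pos pointwise_excess_nonneg by auto
next
  case False
  then have "wrong_side (\<eta> x) (clip (f x))"
    using clip_nonneg_iff[of "f x"]
    by (auto simp: wrong_side_def sign_clf_def bayes_rule_def split: if_splits)
  moreover have "clip (f x) \<in> {- 1..1}" using abs_clip_le_1[of "f x"] by (simp add: abs_le_iff)
  ultimately have "\<bar>2 * \<eta> x - 1\<bar> ^ p \<le> U * cond_excess \<phi> (\<eta> x) (clip (f x)) (target x)"
    using phi_bounds target_minimizer[OF x] eta_in_unit_interval
    unfolding loss_bounds_def calibrated_def by blast
  then show ?thesis using False x by (simp add: pointwise_excess_def)
qed

lemma misclass_risk_calibration: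
  assumes f [measurable]: "f \<in> borel_measurable borel"
  shows "(misclass_risk \<rho> (sign_clf f) - misclass_risk \<rho> (bayes_rule \<eta>)) ^ p \<le> U * excess (\<lambda>x. clip (f x))"
proof -
  define w where "w x = \<bar>2 * \<eta> x - 1\<bar> * of_bool (sign_clf f x \<noteq> bayes_rule \<eta> x)" for x
  have [measurable]: "w \<in> borel_measurable borel"
    unfolding w_def by measurable
  have "\<bar>w x\<bar> \<le> 1" for x using eta_bounds[rule_format, of x] by (auto simp: w_def of_bool_def)
  then have w_power_bound: "\<bar>w x ^ k\<bar> \<le> 1" for x k by (simp add: power_abs power_le_one)
  have w_integrable: "integrable \<rho>X (\<lambda>x. w x ^ k)" for k
    by (rule integrable_rhoX_bounded[OF _ w_power_bound]) simp
  have "(\<integral>x. w x \<partial>\<rho>X)\<^sup>2 \<le> (\<integral>x. (w x)\<^sup>2 \<partial>\<rho>X)"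
    using X.variance_positive[of w] X.variance_eq[of w] w_integrable[of 1] w_integrable[of 2]
    by (simp del: Bochner_Integration.integral_nonneg)
  then have "(\<integral>x. w x \<partial>\<rho>X) ^ p \<le> (\<integral>x. w x ^ p \<partial>\<rho>X)" using p by auto
  also have "\<dots> \<le> (\<integral>x. U * pointwise_excess (\<lambda>x. clip (f x)) x \<partial>\<rho>X)"
  proof (rule integral_mono_AE[OF w_integrable])
    show "integrable \<rho>X (\<lambda>x. U * pointwise_excess (\<lambda>x. clip (f x)) x)"
      by (intro integrable_mult_right integrable_pointwise_excess admissible_clip f)
    show "AE x in \<rho>X. w x ^ p \<le> U * pointwise_excess (\<lambda>x. clip (f x)) x"
      using AE_rhoX_unit_cube by eventually_elim (unfold w_def, rule pointwise_calibration)
  qed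
  also have "\<dots> = U * excess (\<lambda>x. clip (f x))" by (simp add: excess_def)
  finally show ?thesis unfolding excess_misclass_risk_eq[OF f] w_def .
qed

end

section \<open>Regularized empirical risk minimizers\<close>

lemma reg_objective_eq:
  "reg_objective \<phi> \<sigma> lam m D f = empirical_mean m (\<lambda>z. \<phi> (snd z * f (fst z))) D + lam * rkhs_norm2 \<sigma> f"
  by (simp add: reg_objective_def empirical_mean_def)

lemma reg_minimizer_objective_le_kcomb:
  assumes "is_reg_minimizer \<phi> \<sigma> lam m D f" "lam \<ge> 0" and L: "kcomb_centers L \<subseteq> unit_cube"
  shows "empirical_mean m (\<lambda>z. \<phi> (snd z * f (fst z))) D + lam * rkhs_norm2 \<sigma> f
    \<le> empirical_mean m (\<lambda>z. \<phi> (snd z * rkhs_of_kcomb \<sigma> L (fst z))) D + lam * kcomb_norm2 \<sigma> L"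
proof -
  have "lam * rkhs_norm2 \<sigma> (rkhs_of_kcomb \<sigma> L) \<le> lam * kcomb_norm2 \<sigma> L"
    using rkhs_norm2_of_kcomb_le[OF L] \<open>lam \<ge> 0\<close> by (rule mult_left_mono)
  moreover have "reg_objective \<phi> \<sigma> lam m D f \<le> reg_objective \<phi> \<sigma> lam m D (rkhs_of_kcomb \<sigma> L)"
    using assms(1) in_rkhs_of_kcomb[OF L] by (simp add: is_reg_minimizer_def)
  ultimately show ?thesis by (simp add: reg_objective_eq)
qed

lemma reg_minimizer_norm2_le:
  fixes f :: "real^'d \<Rightarrow> real"
  assumes "is_reg_minimizer \<phi> \<sigma> lam m D f" "lam \<ge> 0" and "m \<ge> 1" and "\<And>u. 0 \<le> \<phi> u"
  shows "lam * rkhs_norm2 \<sigma> f \<le> \<phi> 0"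
proof -
  have "rkhs_of_kcomb \<sigma> [] x = 0" for x :: "real^'d" by (simp add: rkhs_of_kcomb_def kcomb_eval_def)
  then have "empirical_mean m (\<lambda>z. \<phi> (snd z * f (fst z))) D + lam * rkhs_norm2 \<sigma> f
      \<le> empirical_mean m (\<lambda>_. \<phi> 0) D"
    using reg_minimizer_objective_le_kcomb[OF assms(1,2), of "[]"]
    by (simp add: kcomb_centers_def kcomb_norm2_def)
  moreover have "empirical_mean m (\<lambda>_. \<phi> 0) D = \<phi> 0" using \<open>m \<ge> 1\<close> by (simp add: empirical_mean_def)
  moreover have "empirical_mean m (\<lambda>z. \<phi> (snd z * f (fst z))) D \<ge> 0"
    using assms(4) by (simp add: empirical_mean_def sum_nonneg)
  ultimately show ?thesis by simp
qed

context excess_risk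
begin

lemma reg_minimizer_loss_gap_le:
  assumes min: "is_reg_minimizer \<phi> \<sigma> lam m D f" and "lam \<ge> 0"
    and D: "\<And>i. i < m \<Longrightarrow> fst (D i) \<in> unit_cube \<and> snd (D i) \<in> {- 1, 1}"
    and L: "kcomb_centers L \<subseteq> unit_cube"
  shows "empirical_mean m (loss_gap (\<lambda>x. clip (f x))) D
    \<le> empirical_mean m (loss_gap (rkhs_of_kcomb \<sigma> L)) D + lam * kcomb_norm2 \<sigma> L"
proof -
  define risk where "risk h = empirical_mean m (\<lambda>z. \<phi> (snd z * h (fst z))) D" for h :: "real^'d \<Rightarrow> real"
  have gap_eq: "empirical_mean m (loss_gap h) D = risk h - risk target" for h
    unfolding empirical_mean_def risk_def right_diff_distrib[symmetric] sum_subtractf[symmetric]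
    using D by (intro arg_cong2[where f=times] sum.cong refl) (simp add: loss_gap_eq)
  have "\<phi> (snd (D i) * clip (f (fst (D i)))) \<le> \<phi> (snd (D i) * f (fst (D i)))" if "i < m" for i
  proof -
    have "snd (D i) * clip (f (fst (D i))) = clip (snd (D i) * f (fst (D i)))"
      using D[OF that] by (auto simp: clip_def)
    then show ?thesis using clippable_phi by (simp add: clippable_def)
  qed
  then have "risk (\<lambda>x. clip (f x)) \<le> risk f" unfolding risk_def by (rule empirical_mean_mono)
  moreover have "lam * rkhs_norm2 \<sigma> f \<ge> 0"
    using \<open>lam \<ge> 0\<close> rkhs_norm2_nonneg[of \<sigma> f] min by (simp add: is_reg_minimizer_def)
  ultimately show ?thesis
    using reg_minimizer_objective_le_kcomb[OF min \<open>lam \<ge> 0\<close> L] unfolding gap_eq risk_def by linarith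
qed

lemma excess_oracle_inequality:
  fixes D :: "nat \<Rightarrow> (real^'d) \<times> real" and L :: "'d kcomb" and \<sigma> :: real
  defines "g \<equiv> rkhs_of_kcomb \<sigma> L"
  assumes min: "is_reg_minimizer \<phi> \<sigma> lam m D f" and "lam \<ge> 0" "m \<ge> 1"
    and D: "\<And>i. i < m \<Longrightarrow> fst (D i) \<in> unit_cube \<and> snd (D i) \<in> {- 1, 1}"
    and L: "kcomb_centers L \<subseteq> unit_cube"
    and q: "admissible q" "\<And>x. x \<in> unit_cube \<Longrightarrow> \<bar>clip (f x) - q x\<bar> \<le> \<epsilon>" and "\<epsilon> \<ge> 0"
    and deviation: "\<And>t. t \<in> {q, g} \<Longrightarrow> \<bar>excess t - empirical_mean m (loss_gap t) D\<bar> \<le> excess t / 2 + B"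
  shows "excess (\<lambda>x. clip (f x)) \<le> 3 * (\<Lambda> * \<epsilon>) + 2 * (lam * kcomb_norm2 \<sigma> L) + 3 * excess g + 4 * B"
proof -
  define h where "h = (\<lambda>x. clip (f x))"
  have "f \<in> borel_measurable borel"
    using min borel_measurable_rkhs by (auto simp: is_reg_minimizer_def)
  then have h: "admissible h" unfolding h_def by (rule admissible_clip)
  have close: "\<bar>h x - q x\<bar> \<le> \<epsilon>" "\<bar>q x - h x\<bar> \<le> \<epsilon>" if "x \<in> unit_cube" for x
    using q(2)[OF that] by (auto simp: h_def abs_minus_commute)
  have "excess h \<le> excess q + \<Lambda> * \<epsilon>" using h q(1) close \<open>\<epsilon> \<ge> 0\<close> by (intro excess_perturb)
  moreover have "empirical_mean m (loss_gap q) D \<le> empirical_mean m (\<lambda>z. loss_gap h z + \<Lambda> * \<epsilon>) D"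
    using h q(1) close \<open>\<epsilon> \<ge> 0\<close> by (intro empirical_mean_mono loss_gap_perturb)
  then have "empirical_mean m (loss_gap q) D \<le> empirical_mean m (loss_gap h) D + \<Lambda> * \<epsilon>"
    by (simp add: empirical_mean_add_const[OF \<open>m \<ge> 1\<close>])
  moreover have "empirical_mean m (loss_gap h) D \<le> empirical_mean m (loss_gap g) D + lam * kcomb_norm2 \<sigma> L"
    unfolding h_def g_def by (rule reg_minimizer_loss_gap_le[OF min \<open>lam \<ge> 0\<close> D L])
  moreover have "\<bar>excess q - empirical_mean m (loss_gap q) D\<bar> \<le> excess q / 2 + B"
    "\<bar>excess g - empirical_mean m (loss_gap g) D\<bar> \<le> excess g / 2 + B"
    using deviation by simp_all
  ultimately have "excess h \<le> 3 * (\<Lambda> * \<epsilon>) + 2 * (lam * kcomb_norm2 \<sigma> L) + 3 * excess g + 4 * B"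
    by linarith
  then show ?thesis by (simp add: h_def)
qed

lemma uniform_deviation_event:
  fixes m :: nat and s T \<delta> :: real
  assumes "finite Q" and Q: "\<And>q. q \<in> Q \<Longrightarrow> admissible q"
    and m: "m \<ge> 1" and s: "s > 0" "s * (2 * \<Lambda> * M) \<le> 1" "s * V \<le> 1 / 2"
    and T: "real (card Q) * (2 * exp (- T)) \<le> \<delta>"
  defines "P \<equiv> PiM {..<m} (\<lambda>_. \<rho>)"
  obtains A where "A \<in> sets P" "measure P A \<ge> 1 - \<delta>"
    "\<And>D i. D \<in> A \<Longrightarrow> i < m \<Longrightarrow> fst (D i) \<in> unit_cube \<and> snd (D i) \<in> {- 1, 1}"
    "\<And>D q. D \<in> A \<Longrightarrow> q \<in> Q \<Longrightarrow> \<bar>excess q - empirical_mean m (loss_gap q) D\<bar>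
       \<le> excess q / 2 + (T / (s * real m) + variance_slack s)"
proof -
  have scaled_bound: "\<bar>s * loss_gap q z\<bar> \<le> 1" if "q \<in> Q" for q z
  proof -
    have "\<bar>s * loss_gap q z\<bar> = s * \<bar>loss_gap q z\<bar>" using s by (simp add: abs_mult)
    also have "\<dots> \<le> s * (2 * \<Lambda> * M)" using abs_loss_gap_le[OF Q[OF that]] s by (intro mult_left_mono) auto
    finally show ?thesis using s by linarith
  qed
  have "Measurable.pred \<rho> (\<lambda>z. fst z \<in> unit_cube \<and> snd z \<in> {- 1, 1})" by measurable
  note event = iid_uniform_deviation_event[OF \<open>finite Q\<close> borel_measurable_loss_gap[OF Q] scaled_bound
      s(1) m T supp this, folded P_def]
  obtain A where A: "A \<in> sets P" "measure P A \<ge> 1 - \<delta>"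
    "\<And>D i. D \<in> A \<Longrightarrow> i < m \<Longrightarrow> fst (D i) \<in> unit_cube \<and> snd (D i) \<in> {- 1, 1}"
    and deviation: "\<And>D q. D \<in> A \<Longrightarrow> q \<in> Q \<Longrightarrow> \<bar>expectation (loss_gap q) - empirical_mean m (loss_gap q) D\<bar>
       \<le> T / (s * real m) + s * expectation (\<lambda>z. (loss_gap q z)\<^sup>2)"
    by (rule event) blast+
  have "\<bar>excess q - empirical_mean m (loss_gap q) D\<bar> \<le> excess q / 2 + (T / (s * real m) + variance_slack s)"
    if "D \<in> A" "q \<in> Q" for D q
    using deviation[OF that] scaled_square_loss_gap_le[OF Q[OF that(2)], of s] s
    by (simp add: expectation_loss_gap[OF Q[OF that(2)]])
  then show ?thesis using that[OF A(1,2)] A(3) by blast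
qed

definition minimizers_satisfy :: "real \<Rightarrow> nat \<Rightarrow> real \<Rightarrow> ((real^'d \<Rightarrow> real) \<Rightarrow> bool) \<Rightarrow> bool" where
  "minimizers_satisfy \<sigma> m \<delta> Q \<longleftrightarrow> (\<exists>A\<in>sets (PiM {..<m} (\<lambda>_. \<rho>)). measure (PiM {..<m} (\<lambda>_. \<rho>)) A \<ge> 1 - \<delta> \<and>
     (\<forall>D\<in>A. \<forall>f. is_reg_minimizer \<phi> \<sigma> (1 / real m) m D f \<longrightarrow> Q f))"

lemma minimizers_satisfy_mono:
  assumes "minimizers_satisfy \<sigma> m \<delta> Q" "\<And>f. f \<in> borel_measurable borel \<Longrightarrow> Q f \<Longrightarrow> Q' f"
  shows "minimizers_satisfy \<sigma> m \<delta> Q'"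
  using assms borel_measurable_rkhs unfolding minimizers_satisfy_def is_reg_minimizer_def by meson

lemma excess_oracle_event:
  fixes m :: nat and s T \<delta> \<sigma> R \<epsilon> :: real and L :: "'d kcomb" and N :: "(real^'d \<Rightarrow> real) set"
  assumes N: "clip_net N (rkhs_ball \<sigma> R) \<epsilon>" and "\<epsilon> \<ge> 0" and R: "real m * \<phi> 0 < R\<^sup>2"
    and L: "kcomb_centers L \<subseteq> unit_cube" and g: "admissible (rkhs_of_kcomb \<sigma> L)"
    and m: "m \<ge> 1" and s: "s > 0" "s * (2 * \<Lambda> * M) \<le> 1" "s * V \<le> 1 / 2"
    and T: "(real (card N) + 1) * (2 * exp (- T)) \<le> \<delta>"
  shows "minimizers_satisfy \<sigma> m \<delta> (\<lambda>f. excess (\<lambda>x. clip (f x))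
    \<le> 3 * (\<Lambda> * \<epsilon>) + 2 * (kcomb_norm2 \<sigma> L / real m)
      + 3 * excess (rkhs_of_kcomb \<sigma> L) + 4 * (T / (s * real m) + variance_slack s))"
proof -
  define g where "g = rkhs_of_kcomb \<sigma> L"
  have "finite (insert g N)" using N by (simp add: clip_net_def)
  moreover have adm: "admissible q" if "q \<in> insert g N" for q
    using that N pos assms(5) by (auto simp: clip_net_def admissible_def g_def intro: order.trans[of _ 1])
  moreover have "real (card (insert g N)) * (2 * exp (- T)) \<le> \<delta>"
  proof -
    have "real (card (insert g N)) \<le> real (card N) + 1"
      using card_insert_le_m1[of "card N + 1" N g] by simp
    then have "real (card (insert g N)) * (2 * exp (- T)) \<le> (real (card N) + 1) * (2 * exp (- T))"
      by (rule mult_right_mono) simp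
    then show ?thesis using T by linarith
  qed
  ultimately obtain A where A: "A \<in> sets (PiM {..<m} (\<lambda>_. \<rho>))" "measure (PiM {..<m} (\<lambda>_. \<rho>)) A \<ge> 1 - \<delta>"
    and good: "\<And>D i. D \<in> A \<Longrightarrow> i < m \<Longrightarrow> fst (D i) \<in> unit_cube \<and> snd (D i) \<in> {- 1, 1}"
    and deviation: "\<And>D q. D \<in> A \<Longrightarrow> q \<in> insert g N \<Longrightarrow> \<bar>excess q - empirical_mean m (loss_gap q) D\<bar>
       \<le> excess q / 2 + (T / (s * real m) + variance_slack s)"
    using uniform_deviation_event[OF _ _ m s, of "insert g N" T \<delta>] by blast
  have "excess (\<lambda>x. clip (f x)) \<le> 3 * (\<Lambda> * \<epsilon>) + 2 * (kcomb_norm2 \<sigma> L / real m)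
      + 3 * excess g + 4 * (T / (s * real m) + variance_slack s)"
    if D: "D \<in> A" and f: "is_reg_minimizer \<phi> \<sigma> (1 / real m) m D f" for D f
  proof -
    have "rkhs_norm2 \<sigma> f \<le> real m * \<phi> 0"
      using reg_minimizer_norm2_le[OF f _ m] clippable_phi m by (simp add: clippable_def field_simps)
    then have "f \<in> rkhs_ball \<sigma> R" using R f by (simp add: rkhs_ball_def is_reg_minimizer_def)
    then obtain q where q: "q \<in> N" "\<And>x. x \<in> unit_cube \<Longrightarrow> \<bar>clip (f x) - q x\<bar> \<le> \<epsilon>"
      using N unfolding clip_net_def by blast
    have "excess (\<lambda>x. clip (f x)) \<le> 3 * (\<Lambda> * \<epsilon>) + 2 * (1 / real m * kcomb_norm2 \<sigma> L)
        + 3 * excess g + 4 * (T / (s * real m) + variance_slack s)"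
      unfolding g_def using q adm[of q] deviation[OF D] good[OF D] \<open>\<epsilon> \<ge> 0\<close> m L f
      by (intro excess_oracle_inequality[where q=q]) (auto simp: g_def)
    then show ?thesis by simp
  qed
  then show ?thesis using A unfolding minimizers_satisfy_def g_def by blast
qed

end

section \<open>The learning rate\<close>

lemma powr_le_powr_mult:
  fixes x l :: real
  assumes "x \<ge> 1" "l \<ge> 1" "a \<le> b"
  shows "x powr a \<le> x powr b * l"
proof -
  have "x powr a \<le> x powr b * 1" using assms by (simp add: powr_mono)
  also have "\<dots> \<le> x powr b * l" using \<open>l \<ge> 1\<close> by (intro mult_left_mono) auto
  finally show ?thesis .
qed

lemma stochastic_error_rate:
  fixes x l b s a c :: real
  assumes "x \<ge> 1" "l \<ge> 1" "s > 0" "b \<ge> 0" "a \<ge> 0"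
  shows "(b * x powr a + l) / (s * x powr (- c) * x) \<le> (b + 1) / s * (x powr (a + c - 1) * l)"
proof -
  have "b * x powr a \<le> b * (x powr a * l)"
    using powr_le_powr_mult[of x l a a] assms by (intro mult_left_mono) auto
  moreover have "l \<le> x powr a * l"
    using ge_one_powr_ge_zero[of x a] assms by (simp add: mult_le_cancel_right1)
  ultimately have "b * x powr a + l \<le> (b + 1) * (x powr a * l)" by (simp add: distrib_right)
  then have "(b * x powr a + l) / (s * x powr (- c) * x)
      \<le> (b + 1) * (x powr a * l) / (s * x powr (- c) * x)"
    using assms by (intro divide_right_mono) auto
  also have "\<dots> = (b + 1) / s * (x powr a / (x powr (- c) * x powr 1) * l)"
    using assms by simp
  also have "x powr a / (x powr (- c) * x powr 1) = x powr (a + c - 1)"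
    unfolding powr_add[symmetric] powr_diff[symmetric] by (simp add: algebra_simps)
  finally show ?thesis .
qed

lemma one_le_ln_four_div:
  fixes \<delta> :: real
  assumes "0 < \<delta>" "\<delta> < 1"
  shows "1 \<le> ln (4 / \<delta>)"
proof -
  have "exp 1 \<le> (4 :: real)" using exp_le by simp
  also have "\<dots> \<le> 4 / \<delta>" using assms by (simp add: field_simps)
  finally show ?thesis using assms by (simp add: ln_ge_iff)
qed

lemma union_bound_le:
  fixes n B \<delta> :: real
  assumes "n \<le> exp B" "B \<ge> 0" "0 < \<delta>"
  shows "(n + 1) * (2 * exp (- (B + ln (4 / \<delta>)))) \<le> \<delta>"
proof -
  have "1 \<le> exp B" using \<open>B \<ge> 0\<close> by simp
  then have "(n + 1) * exp (- B) \<le> (2 * exp B) * exp (- B)"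
    using \<open>n \<le> exp B\<close> by (intro mult_right_mono) (linarith, simp)
  also have "\<dots> = 2" by (simp add: exp_minus)
  finally have "(n + 1) * exp (- B) * (\<delta> / 2) \<le> 2 * (\<delta> / 2)"
    using \<open>0 < \<delta>\<close> by (intro mult_right_mono) auto
  moreover have "exp (- (B + ln (4 / \<delta>))) = exp (- B) * (\<delta> / 4)"
    using assms by (simp add: exp_diff exp_minus field_simps)
  then have "(n + 1) * (2 * exp (- (B + ln (4 / \<delta>)))) = (n + 1) * exp (- B) * (\<delta> / 2)" by simp
  ultimately show ?thesis by linarith
qed

context excess_risk
begin

lemma kcomb_approximant_rate:
  fixes r K x :: real
  assumes "r > 0" "K > 0" "x \<ge> 1" and approx: "kcomb_approximable r K target"
    and room: "\<And>y. \<bar>target y\<bar> + K \<le> M"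
  defines "b \<equiv> 2 * r + real CARD('d)"
  defines "\<sigma> \<equiv> x powr (- 1 / b)"
  obtains L where "kcomb_centers L \<subseteq> unit_cube" "admissible (rkhs_of_kcomb \<sigma> L)"
    "kcomb_norm2 \<sigma> L / x \<le> K * x powr (- (2 * (r / b)))"
    "excess (rkhs_of_kcomb \<sigma> L) \<le> U * K ^ p * x powr (- (real p * (r / b)))"
proof -
  have "b > 0" using \<open>r > 0\<close> by (simp add: b_def add_pos_nonneg)
  then have \<sigma>: "0 < \<sigma>" "\<sigma> \<le> 1" using \<open>x \<ge> 1\<close> powr_mono[of "- 1 / b" 0 x] by (auto simp: \<sigma>_def)
  have \<sigma>_powr: "\<sigma> powr r = x powr (- (r / b))" by (simp add: \<sigma>_def powr_powr)
  obtain L where L: "kcomb_centers L \<subseteq> unit_cube" and norm2: "kcomb_norm2 \<sigma> L \<le> K / \<sigma> ^ CARD('d)"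
    and close: "\<And>y. y \<in> unit_cube \<Longrightarrow> \<bar>kcomb_eval \<sigma> L y - target y\<bar> \<le> K * \<sigma> powr r"
    using approx \<sigma> unfolding kcomb_approximable_def by blast
  define g where "g = rkhs_of_kcomb \<sigma> L"
  have g_close: "\<bar>g y - target y\<bar> \<le> K * \<sigma> powr r" if "y \<in> unit_cube" for y
    using close[OF that] that by (simp add: g_def rkhs_of_kcomb_def)
  have "\<sigma> powr r \<le> 1" using \<sigma> \<open>r > 0\<close> powr_mono2[of r \<sigma> 1] by simp
  then have "K * \<sigma> powr r \<le> K" using \<open>K > 0\<close> by simp
  then have "\<bar>g y\<bar> \<le> M" for y
    using g_close[of y] room[of y] pos by (cases "y \<in> unit_cube") (auto simp: g_def rkhs_of_kcomb_def)
  moreover have "g \<in> borel_measurable borel"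
    unfolding g_def by (intro borel_measurable_rkhs[of \<sigma>] in_rkhs_of_kcomb L)
  ultimately have g: "admissible g" by (simp add: admissible_def)
  have "kcomb_norm2 \<sigma> L / x \<le> K / \<sigma> ^ CARD('d) / x"
    using norm2 \<open>x \<ge> 1\<close> by (intro divide_right_mono) auto
  also have "\<dots> = K * (x powr (real CARD('d) / b) * x powr (- 1))"
  proof -
    have "\<sigma> ^ CARD('d) = x powr (- (real CARD('d) / b))" using \<open>x \<ge> 1\<close> by (simp add: \<sigma>_def powr_power)
    then show ?thesis using \<open>x \<ge> 1\<close> by (simp add: powr_minus_divide)
  qed
  also have "x powr (real CARD('d) / b) * x powr (- 1) = x powr (- (2 * (r / b)))"
    unfolding powr_add[symmetric] using \<open>b > 0\<close> by (simp add: b_def field_simps)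
  finally have "kcomb_norm2 \<sigma> L / x \<le> K * x powr (- (2 * (r / b)))" .
  moreover have "excess g \<le> U * (K * \<sigma> powr r) ^ p"
    using \<open>K > 0\<close> by (intro excess_le_of_close g g_close) auto
  then have "excess g \<le> U * K ^ p * x powr (- (real p * (r / b)))"
    unfolding \<sigma>_powr using \<open>x \<ge> 1\<close> by (simp add: power_mult_distrib powr_power mult_ac)
  ultimately show ?thesis using that L g unfolding g_def by blast
qed

definition step_const :: real where
  "step_const = 1 / (2 * \<Lambda> * M + 2 * V)"

definition step_size :: "real \<Rightarrow> real \<Rightarrow> real" where
  "step_size x \<beta> = step_const * x powr (- ((2 - real p) * \<beta>))"

lemma step_const_bounds: "step_const > 0" "step_const * (2 * \<Lambda> * M) \<le> 1" "step_const * V \<le> 1 / 2"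
proof -
  have "2 * \<Lambda> * M + 2 * V > 0" using pos by (simp add: add_pos_pos)
  then show "step_const > 0" "step_const * (2 * \<Lambda> * M) \<le> 1" "step_const * V \<le> 1 / 2"
    using pos by (auto simp: step_const_def field_simps)
qed

lemma step_size_bounds:
  assumes "x \<ge> 1" "\<beta> \<ge> 0"
  shows "step_size x \<beta> > 0" "step_size x \<beta> * (2 * \<Lambda> * M) \<le> 1" "step_size x \<beta> * V \<le> 1 / 2"
proof -
  show "step_size x \<beta> > 0" using step_const_bounds(1) \<open>x \<ge> 1\<close> by (simp add: step_size_def)
  have "x powr (- ((2 - real p) * \<beta>)) \<le> x powr 0" using assms p by (intro powr_mono) auto
  then have "step_size x \<beta> \<le> step_const" using step_const_bounds(1) \<open>x \<ge> 1\<close> by (simp add: step_size_def)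
  then have "step_size x \<beta> * (2 * \<Lambda> * M) \<le> step_const * (2 * \<Lambda> * M)" "step_size x \<beta> * V \<le> step_const * V"
    using pos by (auto intro!: mult_right_mono)
  then show "step_size x \<beta> * (2 * \<Lambda> * M) \<le> 1" "step_size x \<beta> * V \<le> 1 / 2"
    using step_const_bounds by linarith+
qed

lemma variance_slack_rate:
  assumes "x \<ge> 1" "l \<ge> 1" "\<nu> \<ge> 0"
  shows "variance_slack (step_size x \<beta>) \<le> step_const * V * (x powr (\<nu> - real p * \<beta>) * l)"
proof (cases "p = 1")
  case True
  have "step_const * V * x powr (- \<beta>) \<le> step_const * V * (x powr (\<nu> - real p * \<beta>) * l)"
    using True assms pos step_const_bounds(1) by (intro mult_left_mono powr_le_powr_mult) auto
  then show ?thesis unfolding variance_slack_def step_size_def using True by (simp add: mult_ac)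
next
  case False
  then show ?thesis using assms pos step_const_bounds(1) by (simp add: variance_slack_def)
qed

definition excess_const :: "real \<Rightarrow> real \<Rightarrow> real \<Rightarrow> real" where
  "excess_const K c c' = 3 * (\<Lambda> * c) + 2 * K + 3 * (U * K ^ p)
      + 4 * ((c' + 1) / step_const + step_const * V)"

lemma oracle_terms_rate:
  fixes x l \<nu> \<beta> K c c' n e :: real
  assumes "x \<ge> 1" "l \<ge> 1" "\<nu> > 0" "\<beta> > 0" "2 * \<beta> < 1" "K > 0" "c > 0" "c' > 0"
    and n: "n \<le> K * x powr (- (2 * \<beta>))" and e: "e \<le> U * K ^ p * x powr (- (real p * \<beta>))"
  defines "s \<equiv> step_size x \<beta>" and "T \<equiv> c' * x powr (\<nu> + (1 - 2 * \<beta>)) + l"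
  shows "3 * (\<Lambda> * (c / x)) + 2 * n + 3 * e + 4 * (T / (s * x) + variance_slack s)
    \<le> excess_const K c c' * (x powr (\<nu> - real p * \<beta>) * l)"
proof -
  define \<theta> where "\<theta> = x powr (\<nu> - real p * \<beta>) * l"
  have p_le: "real p * \<beta> \<le> 2 * \<beta>" using p \<open>\<beta> > 0\<close> by auto
  have powr_le_\<theta>: "x powr a \<le> \<theta>" if "a \<le> \<nu> - real p * \<beta>" for a
    unfolding \<theta>_def by (rule powr_le_powr_mult[OF \<open>x \<ge> 1\<close> \<open>l \<ge> 1\<close> that])
  have "x powr (- 1) \<le> \<theta>" using p_le \<open>2 * \<beta> < 1\<close> \<open>\<nu> > 0\<close> by (intro powr_le_\<theta>) linarith
  then have "1 / x \<le> \<theta>" using \<open>x \<ge> 1\<close> by (simp add: powr_minus_divide)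
  then have "\<Lambda> * (c / x) \<le> \<Lambda> * c * \<theta>"
    using mult_left_mono[of "1 / x" \<theta> "\<Lambda> * c"] pos \<open>c > 0\<close> by simp
  moreover have "n \<le> K * \<theta>"
    using \<open>\<nu> > 0\<close> \<open>K > 0\<close> p_le by (intro order.trans[OF n] mult_left_mono powr_le_\<theta>) linarith+
  moreover have "e \<le> U * K ^ p * \<theta>"
    using \<open>\<nu> > 0\<close> \<open>K > 0\<close> pos by (intro order.trans[OF e] mult_left_mono powr_le_\<theta>) auto
  moreover have "\<nu> + (1 - 2 * \<beta>) + (2 - real p) * \<beta> - 1 = \<nu> - real p * \<beta>" by (simp add: algebra_simps)
  then have "T / (s * x) \<le> (c' + 1) / step_const * \<theta>"
    using stochastic_error_rate[OF \<open>x \<ge> 1\<close> \<open>l \<ge> 1\<close> step_const_bounds(1),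
        of c' "\<nu> + (1 - 2 * \<beta>)" "(2 - real p) * \<beta>"] assms
    by (simp add: T_def s_def step_size_def \<theta>_def)
  moreover have "variance_slack s \<le> step_const * V * \<theta>"
    unfolding s_def \<theta>_def using assms by (intro variance_slack_rate) auto
  ultimately have "3 * (\<Lambda> * (c / x)) + 2 * n + 3 * e + 4 * (T / (s * x) + variance_slack s)
      \<le> 3 * (\<Lambda> * c * \<theta>) + 2 * (K * \<theta>) + 3 * (U * K ^ p * \<theta>)
        + 4 * ((c' + 1) / step_const * \<theta> + step_const * V * \<theta>)"
    by (intro add_mono mult_left_mono) simp_all
  also have "\<dots> = excess_const K c c' * \<theta>" by (simp add: excess_const_def algebra_simps)
  finally show ?thesis by (simp add: \<theta>_def)
qed

lemma excess_const_pos: "K > 0 \<Longrightarrow> c > 0 \<Longrightarrow> c' > 0 \<Longrightarrow> excess_const K c c' > 0"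
  unfolding excess_const_def using pos step_const_bounds(1)
  by (intro add_pos_pos mult_pos_pos divide_pos_pos zero_less_power) auto

lemma excess_rate_of_net:
  fixes r \<nu> K c c' \<delta> :: real and m :: nat and N :: "(real^'d \<Rightarrow> real) set"
  assumes "r > 0" "\<nu> > 0" "K > 0" and approx: "kcomb_approximable r K target"
    and room: "\<And>x. \<bar>target x\<bar> + K \<le> M" and "c > 0" "c' > 0" and m: "m \<ge> 1" and \<delta>: "0 < \<delta>" "\<delta> < 1"
  defines "b \<equiv> 2 * r + real CARD('d)"
  defines "\<sigma> \<equiv> real m powr (- 1 / b)" and "\<beta> \<equiv> r / b"
  assumes net: "clip_net N (rkhs_ball \<sigma> (sqrt (\<phi> 0 + 1) * sqrt (real m))) (c / real m)"
    and card: "real (card N) \<le> exp (c' * real m powr (\<nu> + (1 - 2 * \<beta>)))"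
  shows "minimizers_satisfy \<sigma> m \<delta> (\<lambda>f.
    excess (\<lambda>x. clip (f x)) \<le> excess_const K c c' * (real m powr (\<nu> - real p * \<beta>) * ln (4 / \<delta>)))"
proof -
  have "b > 0" using \<open>r > 0\<close> by (simp add: b_def add_pos_nonneg)
  have \<beta>: "\<beta> > 0" "2 * \<beta> < 1" using \<open>r > 0\<close> \<open>b > 0\<close> by (auto simp: \<beta>_def b_def field_simps)
  have x: "real m \<ge> 1" using m by simp
  obtain L where L: "kcomb_centers L \<subseteq> unit_cube" "admissible (rkhs_of_kcomb \<sigma> L)"
    and norm2: "kcomb_norm2 \<sigma> L / real m \<le> K * real m powr (- (2 * \<beta>))"
    and excess: "excess (rkhs_of_kcomb \<sigma> L) \<le> U * K ^ p * real m powr (- (real p * \<beta>))"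
    using kcomb_approximant_rate[OF \<open>r > 0\<close> \<open>K > 0\<close> x approx room] unfolding \<sigma>_def b_def \<beta>_def by blast
  define s where "s = step_size (real m) \<beta>"
  have s: "s > 0" "s * (2 * \<Lambda> * M) \<le> 1" "s * V \<le> 1 / 2"
    unfolding s_def using step_size_bounds[OF x, of \<beta>] \<beta>(1) by simp_all
  define T where "T = c' * real m powr (\<nu> + (1 - 2 * \<beta>)) + ln (4 / \<delta>)"
  have T: "(real (card N) + 1) * (2 * exp (- T)) \<le> \<delta>"
    unfolding T_def using card \<open>c' > 0\<close> \<delta> by (intro union_bound_le) auto
  have "\<phi> 0 \<ge> 0" using clippable_phi by (simp add: clippable_def)
  then have "real m * \<phi> 0 < (sqrt (\<phi> 0 + 1) * sqrt (real m))\<^sup>2"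
    using x by (simp add: power_mult_distrib algebra_simps)
  moreover have "c / real m \<ge> 0" using \<open>c > 0\<close> by simp
  ultimately have excess_le: "minimizers_satisfy \<sigma> m \<delta> (\<lambda>f. excess (\<lambda>x. clip (f x))
      \<le> 3 * (\<Lambda> * (c / real m)) + 2 * (kcomb_norm2 \<sigma> L / real m)
        + 3 * excess (rkhs_of_kcomb \<sigma> L) + 4 * (T / (s * real m) + variance_slack s))"
    using net L m s T by (intro excess_oracle_event)
  have sum_le: "3 * (\<Lambda> * (c / real m)) + 2 * (kcomb_norm2 \<sigma> L / real m)
      + 3 * excess (rkhs_of_kcomb \<sigma> L) + 4 * (T / (s * real m) + variance_slack s)
      \<le> excess_const K c c' * (real m powr (\<nu> - real p * \<beta>) * ln (4 / \<delta>))"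
    unfolding T_def s_def using norm2 excess
    by (intro oracle_terms_rate x one_le_ln_four_div \<delta> \<beta> \<open>\<nu> > 0\<close> \<open>K > 0\<close> \<open>c > 0\<close> \<open>c' > 0\<close>)
  show ?thesis using minimizers_satisfy_mono[OF excess_le order.trans[OF _ sum_le]] .
qed

lemma excess_rate:
  fixes r \<nu> K :: real
  assumes "r > 0" "\<nu> > 0" "K > 0" "kcomb_approximable r K target" "\<And>x. \<bar>target x\<bar> + K \<le> M"
  defines "b \<equiv> 2 * r + real CARD('d)"
  shows "\<exists>C>0. \<forall>m::nat. m \<ge> 1 \<longrightarrow> (\<forall>\<delta>. 0 < \<delta> \<and> \<delta> < 1 \<longrightarrow>
    minimizers_satisfy (real m powr (- 1 / b)) m \<delta> (\<lambda>f.
      excess (\<lambda>x. clip (f x)) \<le> C * (real m powr (\<nu> - real p * (r / b)) * ln (4 / \<delta>))))"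
proof -
  have "b > 0" using \<open>r > 0\<close> by (simp add: b_def add_pos_nonneg)
  then have exponent: "1 / b * real CARD('d) = 1 - 2 * (r / b)" by (simp add: b_def field_simps)
  have "\<phi> 0 \<ge> 0" using clippable_phi by (simp add: clippable_def)
  then obtain c c' where "c > 0" "c' > 0" and net: "\<And>x. x \<ge> 1 \<Longrightarrow> \<exists>N :: (real^'d \<Rightarrow> real) set.
      clip_net N (rkhs_ball (x powr (- 1 / b)) (sqrt (\<phi> 0 + 1) * sqrt x)) (c / x) \<and>
      real (card N) \<le> exp (c' * x powr (\<nu> + (1 - 2 * (r / b))))"
    using rkhs_ball_net_rate[of "sqrt (\<phi> 0 + 1)" \<nu> "1 / b", where 'd='d] \<open>\<nu> > 0\<close> \<open>b > 0\<close>
    unfolding exponent by auto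
  have "minimizers_satisfy (real m powr (- 1 / b)) m \<delta> (\<lambda>f.
      excess (\<lambda>x. clip (f x)) \<le> excess_const K c c' * (real m powr (\<nu> - real p * (r / b)) * ln (4 / \<delta>)))"
    if "m \<ge> 1" "0 < \<delta>" "\<delta> < 1" for m :: nat and \<delta>
    using net[of "real m"] excess_rate_of_net[OF assms(1-5) \<open>c > 0\<close> \<open>c' > 0\<close> that] that(1)
    unfolding b_def by auto
  then show ?thesis using excess_const_pos[OF \<open>K > 0\<close> \<open>c > 0\<close> \<open>c' > 0\<close>] by blast
qed

lemma misclass_risk_le_of_excess_le:
  fixes x l \<nu> \<beta> C :: real
  assumes f: "f \<in> borel_measurable borel" and "x \<ge> 1" "l \<ge> 1" "\<nu> \<ge> 0" "C > 0"
    and excess_le: "excess (\<lambda>x. clip (f x)) \<le> C * (x powr (\<nu> - real p * \<beta>) * l)"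
  shows "misclass_risk \<rho> (sign_clf f) - misclass_risk \<rho> (bayes_rule \<eta>) \<le> (U * C + 1) * x powr (- \<beta> + \<nu>) * l"
proof -
  define y where "y = x powr (- \<beta> + \<nu>) * l"
  have "1 \<le> p" using p by auto
  have "x powr (\<nu> - real p * \<beta>) * l \<le> x powr (real p * (- \<beta> + \<nu>)) * l ^ p"
    using assms \<open>1 \<le> p\<close> mult_right_mono[of 1 "real p" \<nu>]
    by (intro mult_mono powr_mono self_le_power) (auto simp: algebra_simps)
  also have "\<dots> = y ^ p" using assms by (simp add: y_def power_mult_distrib powr_power mult.commute)
  finally have rate_le: "x powr (\<nu> - real p * \<beta>) * l \<le> y ^ p" .
  have "(misclass_risk \<rho> (sign_clf f) - misclass_risk \<rho> (bayes_rule \<eta>)) ^ p \<le> U * excess (\<lambda>x. clip (f x))"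
    by (rule misclass_risk_calibration[OF f])
  also have "\<dots> \<le> U * (C * y ^ p)"
    using order.trans[OF excess_le mult_left_mono[OF rate_le]] pos \<open>C > 0\<close> by (intro mult_left_mono) auto
  also have "\<dots> \<le> (U * C + 1) ^ p * y ^ p"
  proof -
    have "U * C \<le> (U * C + 1) ^ p"
      using self_le_power[of "U * C + 1" p] pos \<open>C > 0\<close> \<open>1 \<le> p\<close> by simp
    moreover have "y ^ p \<ge> 0" using \<open>l \<ge> 1\<close> by (simp add: y_def)
    ultimately show ?thesis by (simp add: mult.assoc[symmetric] mult_right_mono)
  qed
  also have "\<dots> = ((U * C + 1) * y) ^ Suc (p - 1)" using \<open>1 \<le> p\<close> by (simp add: power_mult_distrib)
  finally have "(misclass_risk \<rho> (sign_clf f) - misclass_risk \<rho> (bayes_rule \<eta>)) ^ Suc (p - 1)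
      \<le> ((U * C + 1) * y) ^ Suc (p - 1)"
    using \<open>1 \<le> p\<close> by simp
  moreover have "(U * C + 1) * y \<ge> 0" using pos \<open>C > 0\<close> \<open>l \<ge> 1\<close> by (simp add: y_def)
  ultimately have "misclass_risk \<rho> (sign_clf f) - misclass_risk \<rho> (bayes_rule \<eta>) \<le> (U * C + 1) * y"
    by (rule power_le_imp_le_base)
  then show ?thesis by (simp add: y_def mult.assoc)
qed

lemma misclass_risk_rate:
  fixes r \<nu> K :: real
  assumes "r > 0" "\<nu> > 0" "K > 0" "kcomb_approximable r K target" "\<And>x. \<bar>target x\<bar> + K \<le> M"
  defines "b \<equiv> 2 * r + real CARD('d)"
  shows "\<exists>C>0. \<forall>m::nat. m \<ge> 1 \<longrightarrow> (\<forall>\<delta>. 0 < \<delta> \<and> \<delta> < 1 \<longrightarrow>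
    minimizers_satisfy (real m powr (- 1 / b)) m \<delta> (\<lambda>f.
      misclass_risk \<rho> (sign_clf f) - misclass_risk \<rho> (bayes_rule \<eta>)
        \<le> C * real m powr (- r / b + \<nu>) * ln (4 / \<delta>)))"
proof -
  obtain C where "C > 0" and C: "\<And>m \<delta>. m \<ge> 1 \<Longrightarrow> 0 < \<delta> \<Longrightarrow> \<delta> < 1 \<Longrightarrow>
    minimizers_satisfy (real m powr (- 1 / b)) m \<delta> (\<lambda>f.
      excess (\<lambda>x. clip (f x)) \<le> C * (real m powr (\<nu> - real p * (r / b)) * ln (4 / \<delta>)))"
    using excess_rate[OF assms(1-5)] unfolding b_def by blast
  have "minimizers_satisfy (real m powr (- 1 / b)) m \<delta> (\<lambda>f.
      misclass_risk \<rho> (sign_clf f) - misclass_risk \<rho> (bayes_rule \<eta>)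
        \<le> (U * C + 1) * real m powr (- r / b + \<nu>) * ln (4 / \<delta>))"
    if m: "m \<ge> 1" and \<delta>: "0 < \<delta>" "\<delta> < 1" for m \<delta>
    using C[OF that]
  proof (rule minimizers_satisfy_mono)
    fix f :: "real^'d \<Rightarrow> real"
    assume "f \<in> borel_measurable borel"
      "excess (\<lambda>x. clip (f x)) \<le> C * (real m powr (\<nu> - real p * (r / b)) * ln (4 / \<delta>))"
    from misclass_risk_le_of_excess_le[OF this(1) _ one_le_ln_four_div[OF \<delta>] _ \<open>C > 0\<close> this(2)]
    show "misclass_risk \<rho> (sign_clf f) - misclass_risk \<rho> (bayes_rule \<eta>)
        \<le> (U * C + 1) * real m powr (- r / b + \<nu>) * ln (4 / \<delta>)"
      using m \<open>\<nu> > 0\<close> by simp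
  qed
  moreover have "U * C + 1 > 0" using pos \<open>C > 0\<close> by (simp add: add_pos_pos)
  ultimately show ?thesis by blast
qed

end

lemma (in labelled_sample) excess_risk_of_lip_class:
  assumes loss: "\<phi> = hinge_loss \<or> twice_smooth_classifying_loss \<phi>"
    and min: "\<And>x. x \<in> unit_cube \<Longrightarrow> cond_minimizer \<phi> (\<eta> x) (f x)"
    and lip: "lip_class r c f" "r > 0" "c > 0"
  obtains target p M \<Lambda> U V K where "excess_risk \<rho> \<eta> \<phi> target p M \<Lambda> U V"
    "K > 0" "kcomb_approximable r K target" "\<And>x. \<bar>target x\<bar> + K \<le> M"
proof -
  have continuous: "continuous_on unit_cube f" by (rule lip_class_continuous_on[OF lip])
  obtain B where "B \<ge> 0" and B: "\<And>x. x \<in> unit_cube \<Longrightarrow> \<bar>f x\<bar> \<le> B"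
    using continuous_on_unit_cube_bounded[OF continuous] by blast
  obtain K where "K > 0" and K: "kcomb_approximable r K f"
    using lip_class_kcomb_approximable[OF lip] by blast
  define M where "M = B + K + 1"
  have "M \<ge> 1" using \<open>B \<ge> 0\<close> \<open>K > 0\<close> by (simp add: M_def)
  then obtain p \<Lambda> U V where p: "p = 1 \<or> p = 2" and pos: "\<Lambda> > 0" "U > 0" "V > 0"
    and bounds: "loss_bounds \<phi> p M \<Lambda> U V"
    by (rule loss_bounds_exist[OF loss])
  define target where "target x = indicator unit_cube x *\<^sub>R f x" for x
  have target_bound: "\<bar>target x\<bar> + K \<le> M" for x
    using B[of x] \<open>B \<ge> 0\<close> by (cases "x \<in> unit_cube") (auto simp: target_def M_def)
  have "excess_risk \<rho> \<eta> \<phi> target p M \<Lambda> U V"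
  proof
    show "target \<in> borel_measurable borel"
      unfolding target_def using continuous by (intro borel_measurable_continuous_on_indicator) auto
    show "\<bar>target x\<bar> \<le> M" for x using target_bound[of x] \<open>K > 0\<close> by linarith
    show "cond_minimizer \<phi> (\<eta> x) (target x)" if "x \<in> unit_cube" for x
      using min[OF that] that by (simp add: target_def)
  qed (use clippable_loss[OF loss] p pos bounds \<open>M \<ge> 1\<close> in auto)
  moreover have "kcomb_approximable r K target" using K by (simp add: kcomb_approximable_def target_def)
  ultimately show ?thesis using that \<open>K > 0\<close> target_bound by blast
qed

theorem theorem1:
  fixes \<rho> :: "((real^'d) \<times> real) measure"
    and \<eta> :: "real^'d \<Rightarrow> real"
    and \<phi> :: "real \<Rightarrow> real"
    and f\<rho> :: "real^'d \<Rightarrow> real"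
    and r c0 \<nu> :: real
  assumes "prob_space \<rho>"
    and "sets \<rho> = sets borel"
    and "AE z in \<rho>. fst z \<in> unit_cube \<and> snd z \<in> {-1, 1}"
    and "\<eta> \<in> borel_measurable borel"
    and "\<forall>x. 0 \<le> \<eta> x \<and> \<eta> x \<le> 1"
    and "\<forall>A\<in>sets borel. measure \<rho> (A \<times> {1}) = (\<integral>x. indicator A x * \<eta> x \<partial>(distr \<rho> borel fst))"
    and "\<phi> = hinge_loss \<or> twice_smooth_classifying_loss \<phi>"
    and "\<forall>x\<in>unit_cube. \<forall>t. cond_phi_risk \<phi> (\<eta> x) (f\<rho> x) \<le> cond_phi_risk \<phi> (\<eta> x) t"
    and "r > 0" and "c0 > 0"
    and "lip_class r c0 f\<rho>"
    and "0 < \<nu>" and "\<nu> < r / (2 * r + real CARD('d))"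
  shows "\<exists>C>0. \<forall>m::nat. m \<ge> 1 \<longrightarrow> (\<forall>\<delta>. 0 < \<delta> \<and> \<delta> < 1 \<longrightarrow>
           (\<exists>A\<in>sets (PiM {..<m} (\<lambda>_. \<rho>)).
              measure (PiM {..<m} (\<lambda>_. \<rho>)) A \<ge> 1 - \<delta> \<and>
              (\<forall>D\<in>A. \<forall>f. is_reg_minimizer \<phi> (real m powr (- 1 / (2 * r + real CARD('d)))) (1 / real m) m D f \<longrightarrow>
                 misclass_risk \<rho> (sign_clf f) - misclass_risk \<rho> (bayes_rule \<eta>)
                   \<le> C * real m powr (- r / (2 * r + real CARD('d)) + \<nu>) * ln (4 / \<delta>))))"
proof -
  interpret labelled_sample \<rho> \<eta>
    using assms(1-6) by (intro labelled_sample.intro labelled_sample_axioms.intro)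
  have "cond_minimizer \<phi> (\<eta> x) (f\<rho> x)" if "x \<in> unit_cube" for x
    using assms(8) that by (simp add: cond_minimizer_def)
  then obtain target p M \<Lambda> U V K where "excess_risk \<rho> \<eta> \<phi> target p M \<Lambda> U V"
    and K: "K > 0" "kcomb_approximable r K target" "\<And>x. \<bar>target x\<bar> + K \<le> M"
    using excess_risk_of_lip_class[OF assms(7) _ assms(11,9,10)] by blast
  then interpret excess_risk \<rho> \<eta> \<phi> target p M \<Lambda> U V by simp
  show ?thesis
    using misclass_risk_rate[OF \<open>r > 0\<close> \<open>0 < \<nu>\<close> K] unfolding minimizers_satisfy_def .
qed

end
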